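(* Let $\gamma\ge1$. Let $(h,u,v)$ be a classical solution of $$\partial_t h+h^2\partial_\xi u=0,\qquad \partial_t u+\partial_\xi\big(h^\gamma/\gamma\big)-v=0,\qquad \partial_t v+u=0,$$ with initial data $(h_0,u_0,v_0)$ such that $(h_0-1,u_0,v_0)\in C_0^1(\mathbb{R})$ and $\inf_\xi h_0>0$, and suppose $$-\sqrt{2\omega_0^\sharp}<\inf_\xi\min\{Z_1,Z_2\}\Big|_{t=0}<-\sqrt2\,\sqrt{\omega_0^\sharp-\Big[\mathcal{F}_\gamma^{-1}\big(G_0E_0\big)+1\Big]^{-\frac2\gamma}}.$$ Then there is a finite time $T_*$, bounded by a continuous function of $G_0$, $E_0$, $\omega_0^\sharp$ and $\inf_\xi\min\{Z_1,Z_2\}|_{t=0}$, such that if the classical solution exists on $[0,T)$ with $T>T_*$, then $\inf_\xi\min\{Z_1,Z_2\}(t)$ reaches $-\sqrt{2\omega_0^\sharp}$ at some time $t\le T_*$.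
   Context: A classical solution is a $C^1$ solution with $h>0$; $C_0^1$ means compactly supported $C^1$. $Z_j=\sqrt{h}\,\big[\partial_\xi u+(-1)^j h^{\frac{\gamma-3}{2}}\partial_\xi h\big]$ ($j=1,2$), $\omega_0(\xi)=\frac{1}{h_0(\xi)}+v_0'(\xi)$, $\omega_0^\sharp=\sup_\xi\omega_0$, $Z_0^\sharp=\sup_\xi\max_{i=1,2}Z_i(0,\xi)$. Energy: $E(t)=\int_{\mathbb{R}}\frac12(u^2+v^2)(t,\xi)+\mathcal{Q}(h(t,\xi))\,d\xi$ with $\mathcal{Q}(h)=\frac1\gamma\int_1^h(s^{\gamma-2}-s^{-2})\,ds$, $E_0=E(0)$. $G_0=\sqrt{2\omega_0^\sharp}+\max\{Z_0^\sharp,\sqrt{2\omega_0^\sharp}\}$. $\mathcal{F}_\gamma(\alpha)=\frac{16}{3\gamma^3}\frac{\alpha^3}{(\alpha+1)^3}\big\{(\alpha+1)^{3-\frac2\gamma}+(\alpha+1)^{2-\frac2\gamma}\big\}$, an increasing bijection of $(0,\infty)$, with inverse $\mathcal{F}_\gamma^{-1}$. *)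

theory Defs
  imports "HOL-Analysis.Analysis"
begin

definition dxi :: "(real \<Rightarrow> real \<Rightarrow> real) \<Rightarrow> real \<Rightarrow> real \<Rightarrow> real" where
  "dxi f t x = deriv (\<lambda>y. f t y) x"

definition C1_with :: "(real \<times> real) set \<Rightarrow> (real \<Rightarrow> real \<Rightarrow> real)
    \<Rightarrow> (real \<Rightarrow> real \<Rightarrow> real) \<Rightarrow> (real \<Rightarrow> real \<Rightarrow> real) \<Rightarrow> bool" where
  "C1_with S f ft fx \<longleftrightarrow>
     continuous_on S (\<lambda>p. ft (fst p) (snd p)) \<and>
     continuous_on S (\<lambda>p. fx (fst p) (snd p)) \<and>
     (\<forall>p\<in>S. ((\<lambda>q. f (fst q) (snd q)) has_derivative
               (\<lambda>d. ft (fst p) (snd p) * fst d + fx (fst p) (snd p) * snd d)) (at p within S))"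

definition classical_solution :: "real \<Rightarrow> real \<Rightarrow> (real \<Rightarrow> real \<Rightarrow> real)
    \<Rightarrow> (real \<Rightarrow> real \<Rightarrow> real) \<Rightarrow> (real \<Rightarrow> real \<Rightarrow> real) \<Rightarrow> bool" where
  "classical_solution \<gamma> T h u v \<longleftrightarrow>
     (\<exists>ht hx ut ux vt vx.
        C1_with ({0..<T} \<times> UNIV) h ht hx \<and>
        C1_with ({0..<T} \<times> UNIV) u ut ux \<and>
        C1_with ({0..<T} \<times> UNIV) v vt vx \<and>
        (\<forall>t\<in>{0..<T}. \<forall>x.
           h t x > 0 \<and>
           ht t x + (h t x)\<^sup>2 * ux t x = 0 \<and>
           ut t x + deriv (\<lambda>y. h t y powr \<gamma> / \<gamma>) x - v t x = 0 \<and>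
           vt t x + u t x = 0))"

definition Zj :: "real \<Rightarrow> nat \<Rightarrow> (real \<Rightarrow> real \<Rightarrow> real) \<Rightarrow> (real \<Rightarrow> real \<Rightarrow> real)
    \<Rightarrow> real \<Rightarrow> real \<Rightarrow> real" where
  "Zj \<gamma> j h u t x = sqrt (h t x) *
     (dxi u t x + (-1) ^ j * h t x powr ((\<gamma> - 3) / 2) * dxi h t x)"

definition minZ :: "real \<Rightarrow> (real \<Rightarrow> real \<Rightarrow> real) \<Rightarrow> (real \<Rightarrow> real \<Rightarrow> real) \<Rightarrow> real \<Rightarrow> real" where
  "minZ \<gamma> h u t = (INF x. min (Zj \<gamma> 1 h u t x) (Zj \<gamma> 2 h u t x))"

definition Zsharp0 :: "real \<Rightarrow> (real \<Rightarrow> real \<Rightarrow> real) \<Rightarrow> (real \<Rightarrow> real \<Rightarrow> real) \<Rightarrow> real" where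
  "Zsharp0 \<gamma> h u = (SUP x. max (Zj \<gamma> 1 h u 0 x) (Zj \<gamma> 2 h u 0 x))"

definition omega_sharp0 :: "(real \<Rightarrow> real \<Rightarrow> real) \<Rightarrow> (real \<Rightarrow> real \<Rightarrow> real) \<Rightarrow> real" where
  "omega_sharp0 h v = (SUP x. 1 / h 0 x + deriv (v 0) x)"

definition Qpot :: "real \<Rightarrow> real \<Rightarrow> real" where
  "Qpot \<gamma> r = (1 / \<gamma>) *
     (if 1 \<le> r then integral {1..r} (\<lambda>s. s powr (\<gamma> - 2) - s powr (-2))
      else - integral {r..1} (\<lambda>s. s powr (\<gamma> - 2) - s powr (-2)))"

definition energy :: "real \<Rightarrow> (real \<Rightarrow> real \<Rightarrow> real) \<Rightarrow> (real \<Rightarrow> real \<Rightarrow> real)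
    \<Rightarrow> (real \<Rightarrow> real \<Rightarrow> real) \<Rightarrow> real \<Rightarrow> real" where
  "energy \<gamma> h u v t = integral UNIV (\<lambda>x. (1/2) * ((u t x)\<^sup>2 + (v t x)\<^sup>2) + Qpot \<gamma> (h t x))"

definition G0 :: "real \<Rightarrow> (real \<Rightarrow> real \<Rightarrow> real) \<Rightarrow> (real \<Rightarrow> real \<Rightarrow> real)
    \<Rightarrow> (real \<Rightarrow> real \<Rightarrow> real) \<Rightarrow> real" where
  "G0 \<gamma> h u v = sqrt (2 * omega_sharp0 h v) + max (Zsharp0 \<gamma> h u) (sqrt (2 * omega_sharp0 h v))"

definition Fgam :: "real \<Rightarrow> real \<Rightarrow> real" where
  "Fgam \<gamma> \<alpha> = 16 / (3 * \<gamma> ^ 3) * (\<alpha> ^ 3 / (\<alpha> + 1) ^ 3) *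
     ((\<alpha> + 1) powr (3 - 2 / \<gamma>) + (\<alpha> + 1) powr (2 - 2 / \<gamma>))"

text \<open>Inverse of F_gamma (an increasing bijection of [0,oo), F_gamma(0) = 0).\<close>
definition Fgam_inv :: "real \<Rightarrow> real \<Rightarrow> real" where
  "Fgam_inv \<gamma> y = (THE \<alpha>. \<alpha> \<ge> 0 \<and> Fgam \<gamma> \<alpha> = y)"

text \<open>Admissible parameter region (G0, E0, omega_sharp, m0) described by the hypothesis.\<close>
definition adm_region :: "real \<Rightarrow> (real \<times> real \<times> real \<times> real) set" where
  "adm_region \<gamma> = {(G, E, w, m). 0 \<le> G \<and> 0 \<le> E \<and> 0 < w \<and>
      - sqrt (2 * w) < m \<and>
      m < - sqrt 2 * sqrt (w - (Fgam_inv \<gamma> (G * E) + 1) powr (- 2 / \<gamma>))}"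

end

theory Submission
  imports Defs "HOL-Analysis.Analysis"
begin

text \<open>Vorticity \<open>1 / h + \<partial>\<^sub>\<xi> v\<close> is conserved, so \<open>Z\<^sub>1\<close> and \<open>Z\<^sub>2\<close> satisfy coupled Riccati equations along the
  characteristics with speeds \<open>\<mp> h\<^bsup>(\<gamma>+1)/2\<^esup>\<close>:
  \<open>D Z\<^sub>j = \<surd>h (\<omega>\<^sub>0 - 1 / h - (\<gamma> + 1) / 4 Z\<^sub>j\<^sup>2 + (\<gamma> - 1) / 4 Z\<^sub>1 Z\<^sub>2)\<close>.
  They give the upper bound for \<open>Z\<^sub>j\<close>. As long as no \<open>Z\<^sub>j\<close> has reached \<open>- \<surd>(2 \<omega>\<^sub>0\<^sup>\<sharp>)\<close>, also
  \<open>Z\<^sub>2 - Z\<^sub>1 = 2 h\<^bsup>\<gamma>/2-1\<^esup> \<partial>\<^sub>\<xi> h\<close> is bounded by \<open>G\<^sub>0\<close>, so a large amplitude of \<open>h\<close> at \<open>\<xi>\<close> costs energy on both sides of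
  \<open>\<xi>\<close>. If this forced \<open>h \<le> H := (\<F>\<^sub>\<gamma>\<^sup>-\<^sup>1(G\<^sub>0 E\<^sub>0) + 1)\<^bsup>2/\<gamma>\<^esup>\<close>, the minimum of the \<open>Z\<^sub>j\<close> would decrease at a fixed rate, by the
  Riccati equation. The energy argument yields only twice the amplitude, and the gap is closed by a modified
  barrier. Unless \<open>\<gamma>\<close> is below \<open>8/5\<close> and \<open>H\<^bsup>\<gamma>/2\<^esup> < 3\<close>, the quantity \<open>Z\<^sub>j (h / H)\<^bsup>b\<^esup>\<close> with a suitable \<open>b \<ge> 0\<close> also decreases where
  \<open>h \<ge> H\<close>. In the remaining case one adds to \<open>Z\<^sub>j\<close> a multiple of the fraction of energy ahead of the characteristic,
  which decreases at a rate controlled by the energy flux.\<close>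

section \<open>The pressure profile\<close>

text \<open>With y = h^(\<gamma>/2) and T = 2 / \<gamma>, the energy on either side of a point
  bounds the primitive \<open>af y\<close>; the smaller side holds at most half of the energy, so
  \<open>af y \<le> Fh yF / 3\<close>, where \<open>yF\<close> stands for H^(\<gamma>/2). The bound
  h \<le> H would follow from \<open>Fh y / 3 \<le> af y\<close>, but near y = 1 both
  \<open>af y\<close> and \<open>Fh y / 6\<close> are (y - 1)^3 / 3 to leading order, so the loss
  sits at small amplitudes. The two barriers draw on different reserves. The weight spends the
  coupling term (\<gamma> - 1) / 4 Z_1 Z_2, which forces b \<le> (\<gamma> - 1) / 4; b = 3/20
  suffices and is admissible exactly for \<gamma> \<ge> 8/5. If \<gamma> < 8/5 and yF \<ge> 3, there
  is no loss to repair and b = 0. In the remaining case the coupling is weak, but a doubled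
  amplitude requires energy on both sides of the point, and the characteristic sweeps up the part
  ahead of it. The potential vanishes when a quarter of the energy lies behind, since so little
  energy on one side already gives h \<le> H.\<close>

lemma nondecreasing_from_deriv:
  fixes f f' :: "real \<Rightarrow> real"
  assumes "a \<le> b" "\<And>x. a \<le> x \<Longrightarrow> x \<le> b \<Longrightarrow> (f has_real_derivative f' x) (at x)"
    "\<And>x. a \<le> x \<Longrightarrow> x \<le> b \<Longrightarrow> 0 \<le> f' x"
  shows "f a \<le> f b"
  using assms by (intro DERIV_nonneg_imp_nondecreasing[of a b f]) auto

lemma nonincreasing_from_deriv:
  fixes f f' :: "real \<Rightarrow> real"
  assumes "a \<le> b" "\<And>x. a \<le> x \<Longrightarrow> x \<le> b \<Longrightarrow> (f has_real_derivative f' x) (at x)"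
    "\<And>x. a \<le> x \<Longrightarrow> x \<le> b \<Longrightarrow> f' x \<le> 0"
  shows "f b \<le> f a"
  using assms by (intro DERIV_nonpos_imp_nonincreasing[of a b f]) auto

definition prim1 :: "(real \<Rightarrow> real) \<Rightarrow> real \<Rightarrow> real" where
  "prim1 f x = (if 1 \<le> x then integral {1..x} f else - integral {x..1} f)"

lemma prim1_at_1 [simp]: "prim1 f 1 = 0"
  by (simp add: prim1_def)

lemma prim1_deriv:
  assumes f: "continuous_on {0<..} f" and x: "0 < x"
  shows "(prim1 f has_real_derivative f x) (at x)"
proof -
  define a b where "a = min x 1 / 2" and "b = max x 1 + 1"
  have ab: "0 < a" "a < x" "a < 1" "x < b" "1 < b" using x by (auto simp: a_def b_def)
  have cont: "continuous_on {a..b} f"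
    by (rule continuous_on_subset[OF f]) (use ab in auto)
  have int: "f integrable_on {c..d}" if "a \<le> c" "d \<le> b" for c d
    by (rule integrable_continuous_real, rule continuous_on_subset[OF cont]) (use that in auto)
  have eq: "prim1 f z = integral {a..z} f - integral {a..1} f" if "z \<in> {a..b}" for z
  proof (cases "1 \<le> z")
    case True
    have "integral {a..1} f + integral {1..z} f = integral {a..z} f"
      by (rule Henstock_Kurzweil_Integration.integral_combine) (use True that ab int in auto)
    then show ?thesis using True by (simp add: prim1_def)
  next
    case False
    have "integral {a..z} f + integral {z..1} f = integral {a..1} f"
      by (rule Henstock_Kurzweil_Integration.integral_combine) (use False that ab int in auto)
    then show ?thesis using False by (simp add: prim1_def)
  qed
  have "((\<lambda>z. integral {a..z} f) has_real_derivative f x) (at x within {a..b})"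
    by (rule integral_has_real_derivative[OF cont]) (use ab in auto)
  then have "((\<lambda>z. integral {a..z} f - integral {a..1} f) has_real_derivative f x) (at x within {a..b})"
    by (auto intro!: derivative_eq_intros)
  then have "(prim1 f has_real_derivative f x) (at x within {a..b})"
    by (rule has_field_derivative_transform_within[where d=1]) (use ab eq in auto)
  then show ?thesis using at_within_interior[of x "{a..b}"] ab by auto
qed

text \<open>In the application \<open>y = h\<^bsup>\<gamma>/2\<^esup>\<close> and \<open>T = 2 / \<gamma>\<close>. Then \<open>qf y = \<gamma>\<^sup>2 / 2 \<Q>(h)\<close>, and \<open>Fh y = 3 \<gamma>\<^sup>3 / 16 \<F>\<^sub>\<gamma>(y - 1)\<close> for the
  function \<open>Fh\<close> defined below.\<close>
locale profile =
  fixes T :: real and qf af :: "real \<Rightarrow> real"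
  assumes T_pos: "0 < T" and T_le2: "T \<le> 2"
    and qf_deriv: "\<And>y. 0 < y \<Longrightarrow> (qf has_real_derivative (y\<^sup>2 - 1) * y powr (- 1 - T)) (at y)"
    and qf_1 [simp]: "qf 1 = 0"
    and af_deriv: "\<And>y. 0 < y \<Longrightarrow> (af has_real_derivative qf y) (at y)"
    and af_1 [simp]: "af 1 = 0"
begin

definition pp :: "real \<Rightarrow> real" where
  "pp y = y powr (- 1 - T)"

definition Fh :: "real \<Rightarrow> real" where
  "Fh y = (y - 1) ^ 3 * (y + 1) * pp y"

definition PP :: "real \<Rightarrow> real" where
  "PP a = 6 + (8 - 2 * T) * a + (3 - T) * a\<^sup>2"

text \<open>The negative of the normalized energy flux through a characteristic, maximized over the velocity for given
  \<open>y\<close> (see \<open>flux_bound\<close>).\<close>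
definition St :: "real \<Rightarrow> real" where
  "St y = y * qf y - (y\<^sup>2 - 1)\<^sup>2 * pp y / 4"

lemma PP_ge: "0 \<le> a \<Longrightarrow> 6 \<le> PP a"
  using T_le2 by (simp add: PP_def)

lemma pp_pos [simp]: "0 < y \<Longrightarrow> 0 < pp y" by (simp add: pp_def)
lemma pp_nonneg [simp]: "0 \<le> pp y" by (simp add: pp_def)

lemma pp_deriv: "0 < y \<Longrightarrow> (pp has_real_derivative (- 1 - T) * (pp y / y)) (at y)"
proof -
  assume y: "0 < y"
  have "y powr (- 1 - T - 1) = y powr (- 1 - T) / y"
    using y by (subst powr_diff) simp
  then show ?thesis unfolding pp_def
    using has_real_derivative_powr[OF y, of "-1-T"] by simp
qed

lemma qf_deriv': "0 < y \<Longrightarrow> (qf has_real_derivative (y\<^sup>2 - 1) * pp y) (at y)"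
  using qf_deriv by (simp add: pp_def)

lemma Fh_deriv:
  assumes "0 < y"
  shows "(Fh has_real_derivative pp y / y * (y - 1)\<^sup>2 * PP (y - 1)) (at y)"
proof -
  have "((\<lambda>y. (y - 1) ^ 3 * (y + 1) * pp y) has_real_derivative
     (3 * (y - 1)\<^sup>2 * (y + 1) + (y - 1) ^ 3) * pp y
      + (y - 1) ^ 3 * (y + 1) * ((- 1 - T) * (pp y / y))) (at y)"
    using assms by (auto intro!: derivative_eq_intros pp_deriv)
  moreover have "(3 * (y - 1)\<^sup>2 * (y + 1) + (y - 1) ^ 3) * pp y
      + (y - 1) ^ 3 * (y + 1) * ((- 1 - T) * (pp y / y))
     = pp y / y * (y - 1)\<^sup>2 * PP (y - 1)"
    using assms by (simp add: PP_def field_simps power2_eq_square power3_eq_cube)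
  ultimately show ?thesis unfolding Fh_def by simp
qed

lemma Fh_1 [simp]: "Fh 1 = 0" by (simp add: Fh_def)

lemma Fh_strict_mono: "1 \<le> x \<Longrightarrow> x < y \<Longrightarrow> Fh x < Fh y"
proof -
  assume xy: "1 \<le> x" "x < y"
  have c: "continuous_on {x..y} Fh"
    by (rule DERIV_continuous_on, rule DERIV_subset[OF Fh_deriv]) (use xy in auto)
  show "Fh x < Fh y"
  proof (rule DERIV_pos_imp_increasing_open[OF xy(2)])
    fix z assume z: "x < z" "z < y"
    have "0 < pp z / z * (z - 1)\<^sup>2 * PP (z - 1)"
      using z xy PP_ge[of "z-1"] by (auto intro!: mult_pos_pos divide_pos_pos)
    then show "\<exists>d. (Fh has_real_derivative d) (at z) \<and> 0 < d"
      using Fh_deriv[of z] z xy by (intro exI[of _ "pp z / z * (z - 1)\<^sup>2 * PP (z - 1)"]) auto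
  qed (rule c)
qed

lemma Fh_mono_iff: "1 \<le> x \<Longrightarrow> 1 \<le> y \<Longrightarrow> Fh x \<le> Fh y \<longleftrightarrow> x \<le> y"
  using Fh_strict_mono[of x y] Fh_strict_mono[of y x] by (cases x y rule: linorder_cases) auto

lemma Fh_pos: "1 < y \<Longrightarrow> 0 < Fh y"
  using Fh_strict_mono[of 1 y] by simp

text \<open>Two functions vanishing at 1 are compared by the sign of the derivative of their
  difference; most inequalities for the profile follow this pattern. Here the derivative keeps a
  factor (y - 1)^2, and what remains is positive because (1 + T)(y + 1) / y exceeds 1.\<close>

lemma qf_lower:
  assumes "1 \<le> y"
  shows "(y - 1)\<^sup>2 * (y + 1) * pp y / 2 \<le> qf y"
proof -
  let ?f = "\<lambda>y. qf y - (y - 1)\<^sup>2 * (y + 1) * pp y / 2"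
  let ?f' = "\<lambda>y. pp y * (y - 1)\<^sup>2 * ((1 + T) * (y + 1) / y - 1) / 2"
  have "?f 1 \<le> ?f y"
  proof (rule nondecreasing_from_deriv[OF assms])
    fix x :: real assume x: "1 \<le> x"
    have "(?f has_real_derivative (x\<^sup>2 - 1) * pp x -
      (((2 * (x - 1) * (x + 1) + (x - 1)\<^sup>2) * pp x
        + (x - 1)\<^sup>2 * (x + 1) * ((- 1 - T) * (pp x / x))) / 2)) (at x)"
      using x by (auto intro!: derivative_eq_intros qf_deriv' pp_deriv simp: field_simps)
    moreover have "(x\<^sup>2 - 1) * pp x -
      (((2 * (x - 1) * (x + 1) + (x - 1)\<^sup>2) * pp x
        + (x - 1)\<^sup>2 * (x + 1) * ((- 1 - T) * (pp x / x))) / 2) = ?f' x"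
      using x by (simp add: field_simps power2_eq_square)
    ultimately show "(?f has_real_derivative ?f' x) (at x)" by (rule DERIV_cong)
    have "1 \<le> (1 + T) * (x + 1) / x" using x T_pos by (simp add: field_simps)
    then show "0 \<le> ?f' x" using x by simp
  qed
  then show ?thesis by simp
qed

lemma af_lower:
  assumes "1 \<le> y"
  shows "Fh y / 6 \<le> af y"
proof -
  let ?f = "\<lambda>y. af y - Fh y / 6"
  let ?f' = "\<lambda>y. qf y - pp y / y * (y - 1)\<^sup>2 * PP (y - 1) / 6"
  have "?f 1 \<le> ?f y"
  proof (rule nondecreasing_from_deriv[OF assms])
    fix x :: real assume x: "1 \<le> x"
    show "(?f has_real_derivative ?f' x) (at x)"
      using x by (auto intro!: derivative_eq_intros af_deriv Fh_deriv simp: field_simps)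
    have "pp x / x * (x - 1)\<^sup>2 * PP (x - 1) / 6
       = (x - 1)\<^sup>2 * pp x * (PP (x-1) / (6 * x))"
      by (simp only: times_divide_eq_left times_divide_eq_right divide_divide_eq_left mult_ac)
    also have "PP (x-1) / (6 * x) \<le> (x + 1) / 2"
    proof -
      have "3 * x * (x+1) - PP (x-1) = (x - 1) * (1 + T * (x+1))"
        by (simp add: PP_def algebra_simps power2_eq_square)
      moreover have "0 \<le> (x - 1) * (1 + T * (x+1))" using x T_pos by auto
      ultimately show ?thesis using x by (simp add: field_simps)
    qed
    finally have "pp x / x * (x - 1)\<^sup>2 * PP (x - 1) / 6 \<le> (x - 1)\<^sup>2 * pp x * ((x + 1) / 2)"
      by (simp add: mult_left_mono)
    also have "\<dots> \<le> qf x" using qf_lower[OF x] by (simp add: mult_ac)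
    finally show "0 \<le> ?f' x" by simp
  qed
  then show ?thesis by simp
qed

text \<open>The left side is shaped for \<open>St_lower_left\<close>: (1 + T) times it is y^2 times
  the excess of the derivative of \<open>St\<close> over \<open>qf\<close>.\<close>

lemma qf_lower_left:
  assumes "0 < y" "y \<le> 1"
  shows "(y\<^sup>2 - 1)\<^sup>2 * pp y * y / 4 \<le> qf y"
proof -
  let ?f = "\<lambda>y. qf y - (y\<^sup>2 - 1)\<^sup>2 * pp y * y / 4"
  let ?f' = "\<lambda>y. - ((y\<^sup>2 - 1)\<^sup>2 * pp y * (1 - T / 4))"
  have "?f 1 \<le> ?f y"
  proof (rule nonincreasing_from_deriv[OF assms(2)])
    fix x :: real assume x: "y \<le> x" "x \<le> 1"
    then have x0: "0 < x" using assms by simp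
    have "(?f has_real_derivative (x\<^sup>2 - 1) * pp x -
      ((2 * (x\<^sup>2 - 1) * (2 * x) * pp x + (x\<^sup>2 - 1)\<^sup>2 * ((- 1 - T) * (pp x / x))) * x
        + (x\<^sup>2 - 1)\<^sup>2 * pp x) / 4) (at x)"
      using x0 by (auto intro!: derivative_eq_intros qf_deriv' pp_deriv simp: field_simps)
    moreover have "(x\<^sup>2 - 1) * pp x -
      ((2 * (x\<^sup>2 - 1) * (2 * x) * pp x + (x\<^sup>2 - 1)\<^sup>2 * ((- 1 - T) * (pp x / x))) * x
        + (x\<^sup>2 - 1)\<^sup>2 * pp x) / 4 = ?f' x"
      using x0 by (simp add: field_simps power2_eq_square)
    ultimately show "(?f has_real_derivative ?f' x) (at x)" by (rule DERIV_cong)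
    show "?f' x \<le> 0" using T_le2 by simp
  qed
  then show ?thesis by simp
qed

lemma qf_nonneg: "0 < y \<Longrightarrow> 0 \<le> qf y"
proof (cases "1 \<le> y")
  case True
  then have "0 \<le> (y - 1)\<^sup>2 * (y + 1) * pp y / 2" by simp
  then show ?thesis using qf_lower[OF True] by linarith
next
  case False
  assume y: "0 < y"
  then have "0 \<le> (y\<^sup>2 - 1)\<^sup>2 * pp y * y / 4" by simp
  then show ?thesis using qf_lower_left[of y] y False by linarith
qed

lemma qf_pos: "0 < y \<Longrightarrow> y \<noteq> 1 \<Longrightarrow> 0 < qf y"
proof (cases "1 \<le> y")
  case True
  assume "0 < y" "y \<noteq> 1"
  then have "0 < (y - 1)\<^sup>2 * (y + 1) * pp y / 2" by simp
  then show ?thesis using qf_lower[OF True] by linarith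
next
  case False
  assume y: "0 < y" "y \<noteq> 1"
  then have "y\<^sup>2 \<noteq> 1" by (simp add: power2_eq_1_iff)
  then have "0 < (y\<^sup>2 - 1)\<^sup>2 * pp y * y / 4" using y by simp
  then show ?thesis using qf_lower_left[of y] y False by linarith
qed

lemma af_mono: "0 < x \<Longrightarrow> x \<le> y \<Longrightarrow> af x \<le> af y"
  by (rule nondecreasing_from_deriv[of x y af qf]) (auto intro!: af_deriv qf_nonneg)

lemma St_1 [simp]: "St 1 = 0" by (simp add: St_def)

lemma St_deriv:
  assumes "0 < y"
  shows "(St has_real_derivative qf y + (1 + T) / 4 * (y\<^sup>2 - 1)\<^sup>2 * pp y / y) (at y)"
proof -
  have "(St has_real_derivative (qf y + y * ((y\<^sup>2 - 1) * pp y) -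
      (2 * (y\<^sup>2 - 1) * (2 * y) * pp y + (y\<^sup>2 - 1)\<^sup>2 * ((- 1 - T) * (pp y / y))) / 4)) (at y)"
    unfolding St_def using assms by (auto intro!: derivative_eq_intros qf_deriv' pp_deriv simp: field_simps)
  moreover have "qf y + y * ((y\<^sup>2 - 1) * pp y) -
      (2 * (y\<^sup>2 - 1) * (2 * y) * pp y + (y\<^sup>2 - 1)\<^sup>2 * ((- 1 - T) * (pp y / y))) / 4
     = qf y + (1 + T) / 4 * (y\<^sup>2 - 1)\<^sup>2 * pp y / y"
    using assms by (simp add: field_simps power2_eq_square)
  ultimately show ?thesis by (rule DERIV_cong)
qed

text \<open>Below 1 the flux term \<open>St\<close> has the unfavourable sign, and only the
  amplitude \<open>- af y\<close> is under control. Multiplying by y^2 clears the singular factor;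
  the derivative of the resulting difference splits into a term with the sign of
  \<open>af - St\<close> and one covered by \<open>qf_lower_left\<close>.\<close>

lemma St_lower_left:
  assumes "0 < y" "y \<le> 1"
  shows "- St y \<le> - af y * (1 + (1 + T) / y\<^sup>2)"
proof -
  have d: "((\<lambda>y. af y - St y) has_real_derivative - ((1 + T) / 4 * (x\<^sup>2 - 1)\<^sup>2 * pp x / x)) (at x)"
    if "0 < x" for x
    using that by (auto intro!: derivative_eq_intros af_deriv St_deriv)
  have nn: "0 \<le> af x - St x" if "0 < x" "x \<le> 1" for x
  proof -
    have "af 1 - St 1 \<le> af x - St x"
      by (rule nonincreasing_from_deriv[OF that(2) d]) (use that T_pos in auto)
    then show ?thesis by simp
  qed
  let ?H = "\<lambda>y. - ((1 + T) * af y) - y\<^sup>2 * (af y - St y)"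
  let ?H' = "\<lambda>y. - ((1 + T) * qf y) - (2 * y * (af y - St y) + y\<^sup>2 * - ((1 + T) / 4 * (y\<^sup>2 - 1)\<^sup>2 * pp y / y))"
  have "?H 1 \<le> ?H y"
  proof (rule nonincreasing_from_deriv[OF assms(2)])
    fix x :: real assume x: "y \<le> x" "x \<le> 1"
    then have x0: "0 < x" using assms by simp
    show "(?H has_real_derivative ?H' x) (at x)"
      by (rule derivative_eq_intros refl af_deriv d x0)+ (simp add: x0)
    have "x\<^sup>2 * ((1 + T) / 4 * (x\<^sup>2 - 1)\<^sup>2 * pp x / x) = (1 + T) * ((x\<^sup>2 - 1)\<^sup>2 * pp x * x / 4)"
      using x0 by (simp add: field_simps power2_eq_square)
    also have "\<dots> \<le> (1 + T) * qf x"
      using qf_lower_left[OF x0 x(2)] T_pos by (intro mult_left_mono) auto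
    finally have "x\<^sup>2 * ((1 + T) / 4 * (x\<^sup>2 - 1)\<^sup>2 * pp x / x) \<le> (1 + T) * qf x" .
    moreover have "0 \<le> 2 * x * (af x - St x)" using nn[OF x0 x(2)] x0 by simp
    ultimately show "?H' x \<le> 0" unfolding mult_minus_right by linarith
  qed
  then have "y\<^sup>2 * (af y - St y) \<le> - ((1 + T) * af y)" by simp
  then have "af y - St y \<le> - ((1 + T) * af y) / y\<^sup>2"
    using assms by (simp add: field_simps)
  then show ?thesis by (simp add: algebra_simps)
qed

lemma St_lower_right:
  assumes "1 \<le> y" "y \<le> 3" "5 / 4 \<le> T"
  shows "(2 + T) / 6 * Fh y \<le> St y"
proof -
  let ?f = "\<lambda>y. St y - af y - (1 + T) / 6 * Fh y"
  let ?f' = "\<lambda>y. (1 + T) / 4 * (y\<^sup>2 - 1)\<^sup>2 * pp y / y -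
     (1 + T) / 6 * (pp y / y * (y - 1)\<^sup>2 * PP (y - 1))"
  have "?f 1 \<le> ?f y"
  proof (rule nondecreasing_from_deriv[OF assms(1)])
    fix x :: real assume x: "1 \<le> x" "x \<le> y"
    show "(?f has_real_derivative ?f' x) (at x)"
      using x by (auto intro!: derivative_eq_intros af_deriv Fh_deriv St_deriv)
    have "?f' x = (1 + T) * pp x / x * (x - 1)\<^sup>2 * (3 * (x+1)\<^sup>2 - 2 * PP (x-1)) / 12"
    proof -
      have "(x\<^sup>2 - 1)\<^sup>2 = (x-1)\<^sup>2 * (x+1)\<^sup>2" by (simp add: power2_eq_square algebra_simps)
      then show ?thesis using x by (simp add: field_simps)
    qed
    moreover have "3 * (x+1)\<^sup>2 - 2 * PP (x-1) = (x-1) * ((4*T - 4) + (2*T-3) * (x-1))"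
      by (simp add: PP_def power2_eq_square algebra_simps)
    moreover have "0 \<le> (4*T - 4) + (2*T-3) * (x-1)"
    proof -
      have "(4*T - 4) + (2*T-3) * (x-1) = (T - 5/4) * (4 + 2 * (x-1)) + (1 - (x-1)/2)"
        by (simp add: field_simps)
      moreover have "0 \<le> (T - 5/4) * (4 + 2 * (x-1))" using x assms by (intro mult_nonneg_nonneg) auto
      moreover have "0 \<le> 1 - (x - 1) / 2" using x assms by simp
      ultimately show ?thesis by (simp only: add_nonneg_nonneg)
    qed
    ultimately show "0 \<le> ?f' x" using x T_pos by (auto intro!: mult_nonneg_nonneg divide_nonneg_pos)
  qed
  then have "af y + (1 + T) / 6 * Fh y \<le> St y" by simp
  moreover have "(2 + T) / 6 * Fh y = Fh y / 6 + (1 + T) / 6 * Fh y" by (simp add: field_simps)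
  ultimately show ?thesis using af_lower[OF assms(1)] by linarith
qed

end

section \<open>Algebraic inequalities for the barrier\<close>

context profile begin

text \<open>Three facts suffice: the inequality at y = 3, the same inequality for the derivatives at
  3, and growth of \<open>qf\<close> minus a third of the derivative of \<open>Fh\<close> beyond 3.
  The values at 3 come from an elementary minorant of \<open>pp\<close> on [1, 3], integrated twice;
  its exponent 9/4 is 1 + T at T = 5/4.\<close>

lemma af_lower_large:
  assumes T: "5 / 4 \<le> T" and y: "3 \<le> y"
  shows "Fh y / 3 \<le> af y"
proof -
  \<comment> \<open>With this factor \<open>pp 3\<close> becomes 1 and \<open>Fh 3\<close> becomes
    32 for every T.\<close>
  define c where "c = 3 powr (1 + T)"
  have c: "0 < c" by (simp add: c_def)
  have cpp: "(9 / y\<^sup>2) * (7/5 - 3/20 * y) \<le> c * pp y" if y: "1 \<le> y" "y \<le> 3" for y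
  proof -
    have "c * pp y = (3 / y) powr (1 + T)"
      using y by (simp add: c_def pp_def powr_divide powr_minus divide_simps flip: powr_add)
    also have "(3 / y) powr (2 + 1/4) \<le> (3 / y) powr (1 + T)"
      using y T by (intro powr_mono) auto
    finally have "(3 / y) powr (2 + 1/4) \<le> c * pp y" .
    moreover have "(3 / y) powr (2 + 1/4) = 9 / y\<^sup>2 * (3 / y) powr (1/4)"
      using y by (subst powr_add) (simp add: power_divide)
    moreover have "7/5 - 3/20 * y \<le> (3 / y) powr (1/4)"
    proof (rule power_le_imp_le_base[of _ 3])
      have "((3 / y) powr (1/4)) ^ Suc 3 = 3 / y"
        using y by (simp add: powr_realpow[symmetric] powr_powr del: power_Suc)
      moreover have "(7/5 - 3/20 * y) ^ Suc 3 * y \<le> 3"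
      proof -
        \<comment> \<open>The fourth power of the linear minorant, times y, is largest at y = 28/15,
          where its value 17210368/5859375 is just below 3.\<close>
        have "(7/5 - 3/20 * y) ^ Suc 3 * y = 17210368/5859375 -
            (y - 28/15)\<^sup>2 * (65856/78125 - 49833/250000 * y + 1701/100000 * y\<^sup>2 - 81/160000 * y ^ 3)"
          by (simp add: field_simps power2_eq_square power3_eq_cube power4_eq_xxxx)
        moreover have "0 \<le> 65856/78125 - 49833/250000 * y + 1701/100000 * y\<^sup>2 - 81/160000 * y ^ 3"
        proof -
          have "y ^ 3 \<le> 27" "0 \<le> y\<^sup>2" using y power_mono[of y 3 3] by auto
          then show ?thesis using y by linarith
        qed
        then have "0 \<le> (y - 28/15)\<^sup>2 * (65856/78125 - 49833/250000 * y + 1701/100000 * y\<^sup>2 - 81/160000 * y ^ 3)"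
          by (intro mult_nonneg_nonneg) auto
        ultimately show ?thesis by linarith
      qed
      ultimately show "(7/5 - 3/20 * y) ^ Suc 3 \<le> ((3 / y) powr (1/4)) ^ Suc 3"
        using y by (simp only: pos_le_divide_eq[of y] less_le_trans[OF zero_less_one])
    qed simp
    then have "9 / y\<^sup>2 * (7/5 - 3/20 * y) \<le> 9 / y\<^sup>2 * (3 / y) powr (1/4)"
      by (intro mult_left_mono) auto
    ultimately show ?thesis by linarith
  qed
  let ?a = "7/5 :: real" and ?b = "3/20 :: real"
  have ln3: "27 / 25 \<le> ln (3::real)"
  proof -
    have "exp (27::real) = exp 1 ^ 27" by (simp flip: exp_of_nat_mult)
    also have "\<dots> \<le> (272 / 100) ^ 27" using e_less_272 by (intro power_mono) auto
    also have "\<dots> \<le> (3::real) ^ 25" by (simp add: power_divide)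
    finally have "27 \<le> ln ((3::real) ^ 25)" by (subst ln_ge_iff) auto
    then show ?thesis using ln_realpow[of "3::real" 25] by simp
  qed
  have q3: "9 * (?a * (y - 1) - ?b * (y\<^sup>2 - 1) / 2 + ?a * (1 / y - 1) + ?b * ln y) \<le> c * qf y"
    if y: "1 \<le> y" "y \<le> 3" for y
  proof -
    let ?f = "\<lambda>y. c * qf y - 9 * (?a * (y - 1) - ?b * (y\<^sup>2 - 1) / 2 + ?a * (1 / y - 1) + ?b * ln y)"
    let ?f' = "\<lambda>y. (y\<^sup>2 - 1) * (c * pp y - 9 / y\<^sup>2 * (?a - ?b * y))"
    have "?f 1 \<le> ?f y"
    proof (rule nondecreasing_from_deriv[OF y(1)])
      fix x assume x: "1 \<le> x" "x \<le> y"
      show "(?f has_real_derivative ?f' x) (at x)"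
        using x by (auto intro!: derivative_eq_intros qf_deriv' simp: field_simps power2_eq_square)
      have "0 \<le> x\<^sup>2 - 1" using x by simp
      then show "0 \<le> ?f' x" using cpp[of x] x y by (intro mult_nonneg_nonneg) auto
    qed
    then show ?thesis by simp
  qed
  have a3: "9 * (?a * (y - 1)\<^sup>2 / 2 - ?b * (y ^ 3 / 6 - y / 2 + 1 / 3) + ?a * (ln y - (y - 1)) + ?b * (y * ln y - y + 1)) \<le> c * af y"
    if y: "1 \<le> y" "y \<le> 3" for y
  proof -
    let ?f = "\<lambda>y. c * af y - 9 * (?a * (y - 1)\<^sup>2 / 2 - ?b * (y ^ 3 / 6 - y / 2 + 1 / 3) + ?a * (ln y - (y - 1)) + ?b * (y * ln y - y + 1))"
    let ?f' = "\<lambda>y. c * qf y - 9 * (?a * (y - 1) - ?b * (y\<^sup>2 - 1) / 2 + ?a * (1 / y - 1) + ?b * ln y)"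
    have "?f 1 \<le> ?f y"
    proof (rule nondecreasing_from_deriv[OF y(1)])
      fix x assume x: "1 \<le> x" "x \<le> y"
      show "(?f has_real_derivative ?f' x) (at x)"
        using x by (auto intro!: derivative_eq_intros af_deriv simp: field_simps power2_eq_square)
      show "0 \<le> ?f' x" using q3[of x] x y by simp
    qed
    then show ?thesis by simp
  qed
  have cpp3: "c * pp 3 = 1" by (simp add: c_def pp_def flip: powr_add)
  have Fh3: "c * (Fh 3 / 3) = 32 / 3" using cpp3 by (simp add: Fh_def pp_def[symmetric])
  have "32 / 3 \<le> c * af 3"
    using a3[of 3] ln3 by (simp add: field_simps)
  then have "c * (Fh 3 / 3) \<le> c * af 3" using Fh3 by simp
  then have af3: "Fh 3 / 3 \<le> af 3" by (rule mult_left_le_imp_le[OF _ c])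
  let ?D = "\<lambda>y. pp y / y * (y - 1)\<^sup>2 * PP (y - 1)"
  have "c * ?D 3 = 4 / 3 * PP 2" using cpp3 by (simp add: field_simps)
  also have "\<dots> \<le> 32" using T by (simp add: PP_def)
  finally have "c * (?D 3 / 3) \<le> 32 / 3" by simp
  also have "32 / 3 \<le> c * qf 3" using q3[of 3] ln3 by (simp add: field_simps)
  finally have qf3: "?D 3 / 3 \<le> qf 3" by (rule mult_left_le_imp_le[OF _ c])
  have V1: "0 \<le> qf z - ?D z / 3" if z: "3 \<le> z" for z
  proof -
    let ?f = "\<lambda>y. qf y - ?D y / 3"
    let ?W = "\<lambda>y. y ^ 4 - y\<^sup>2 - ((3-T)*(2-T)*y^4 - 2*(2-T)*(1-T)*y^3 + 2*T*(T+1)*y - (T+1)*(T+2)) / 3"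
    let ?f' = "\<lambda>y. pp y / y\<^sup>2 * ?W y"
    have "?f 3 \<le> ?f z"
    proof (rule nondecreasing_from_deriv[OF z])
      fix x assume x: "3 \<le> x" "x \<le> z"
      have d1: "((\<lambda>y. pp y / y) has_real_derivative (- 2 - T) * pp x / x\<^sup>2) (at x)"
        using x by (auto intro!: derivative_eq_intros pp_deriv simp: field_simps power2_eq_square)
      have d2: "((\<lambda>y. (y - 1)\<^sup>2 * PP (y - 1)) has_real_derivative
          2 * (x - 1) * PP (x - 1) + (x - 1)\<^sup>2 * ((8 - 2 * T) + (3 - T) * (2 * (x - 1)))) (at x)"
        unfolding PP_def
        by (auto intro!: derivative_eq_intros simp: algebra_simps power2_eq_square power3_eq_cube)
      have "((\<lambda>y. qf y - pp y / y * ((y - 1)\<^sup>2 * PP (y - 1)) / 3) has_real_derivative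
         (x\<^sup>2 - 1) * pp x - ((- 2 - T) * pp x / x\<^sup>2 * ((x - 1)\<^sup>2 * PP (x - 1)) +
         (2 * (x - 1) * PP (x - 1) + (x - 1)\<^sup>2 * ((8 - 2 * T) + (3 - T) * (2 * (x - 1)))) * (pp x / x)) / 3) (at x)"
        using x by (intro DERIV_diff DERIV_cdivide DERIV_mult d1 d2 qf_deriv') simp
      then have "(?f has_real_derivative
         (x\<^sup>2 - 1) * pp x - ((- 2 - T) * pp x / x\<^sup>2 * ((x - 1)\<^sup>2 * PP (x - 1)) +
         (2 * (x - 1) * PP (x - 1) + (x - 1)\<^sup>2 * ((8 - 2 * T) + (3 - T) * (2 * (x - 1)))) * (pp x / x)) / 3) (at x)"
        by (simp only: mult.assoc)
      moreover have "(x\<^sup>2 - 1) * pp x - ((- 2 - T) * pp x / x\<^sup>2 * ((x - 1)\<^sup>2 * PP (x - 1)) +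
         (2 * (x - 1) * PP (x - 1) + (x - 1)\<^sup>2 * ((8 - 2 * T) + (3 - T) * (2 * (x - 1)))) * (pp x / x)) / 3 = ?f' x"
      proof -
        have "(x\<^sup>2 - 1) * pp x - ((- 2 - T) * pp x / x\<^sup>2 * A + B * (pp x / x)) / 3
           = pp x / x\<^sup>2 * ((x\<^sup>2 - 1) * x\<^sup>2 - ((- 2 - T) * A + B * x) / 3)" for A B
          using x by (simp add: field_simps power2_eq_square)
        moreover have "(x\<^sup>2 - 1) * x\<^sup>2 - ((- 2 - T) * ((x - 1)\<^sup>2 * PP (x - 1)) +
           (2 * (x - 1) * PP (x - 1) + (x - 1)\<^sup>2 * ((8 - 2 * T) + (3 - T) * (2 * (x - 1)))) * x) / 3 = ?W x"
          by (simp add: PP_def field_simps power2_eq_square power3_eq_cube power4_eq_xxxx)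
        ultimately show ?thesis by simp
      qed
      ultimately show "(?f has_real_derivative ?f' x) (at x)" by (rule DERIV_cong)
      have "0 \<le> ?W x"
      proof -
        \<comment> \<open>For x \<ge> 3 the quartic term dominates: at most 7/16 of it is lost to (3
          - T)(2 - T) / 3, and the lower powers are absorbed through these comparisons.\<close>
        have x4: "9 * x\<^sup>2 \<le> x ^ 4" "3 * x ^ 3 \<le> x ^ 4" "27 * x \<le> x ^ 4"
          using x mult_mono[of 9 "x\<^sup>2" "x\<^sup>2" "x\<^sup>2"] power_mono[of 3 x 2] power_mono[of 3 x 3]
             mult_right_mono[of 3 x "x^3"] mult_right_mono[of 27 "x^3" x]
          by (auto simp: power2_eq_square power3_eq_cube power4_eq_xxxx)
        have "(3-T)*(2-T) \<le> (7/4)*(3/4)" using T T_le2 by (intro mult_mono) auto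
        then have "(3-T)*(2-T)*x^4 \<le> (7/4)*(3/4)*x^4" by (intro mult_right_mono) auto
        moreover have "2*(2-T)*(T-1)*x^3 \<le> 1/2 * x^3"
        proof -
          have "1/2 - 2*(2-T)*(T-1) = 2 * (T - 3/2)\<^sup>2" by (simp add: power2_eq_square field_simps)
          then have "2*(2-T)*(T-1) \<le> 1/2" using zero_le_power2[of "T - 3/2"] by linarith
          then show ?thesis using x by (intro mult_right_mono) auto
        qed
        moreover have "2*T*(T+1)*x \<le> 12 * x"
        proof -
          have "2*T*(T+1) \<le> 4 * 3" using T T_le2 by (intro mult_mono) auto
          then show ?thesis using x by (intro mult_right_mono) auto
        qed
        moreover have "0 \<le> (T+1)*(T+2)" using T by simp
        moreover have "2*(2-T)*(T-1)*x^3 = - (2*(2-T)*(1-T)*x^3)" by (simp add: algebra_simps)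
        ultimately have *: "(3-T)*(2-T)*x^4 \<le> (7/4)*(3/4)*x^4" "- (2*(2-T)*(1-T)*x^3) \<le> 1/2 * x^3"
          "2*T*(T+1)*x \<le> 12 * x" "0 \<le> (T+1)*(T+2)" by auto
        have "0 \<le> X - S - (p1 - p2 + p3 - p4) / 3"
          if "0 \<le> X" "p1 \<le> (7/4)*(3/4)*X" "- p2 \<le> 1/2 * Y" "p3 \<le> 12 * Z" "0 \<le> p4"
            "9 * S \<le> X" "3 * Y \<le> X" "27 * Z \<le> X" for p1 p2 p3 p4 X Y Z S :: real
          using that by (simp add: field_simps)
        from this[OF _ * x4] show ?thesis by simp
      qed
      then show "0 \<le> ?f' x" by (intro mult_nonneg_nonneg) auto
    qed
    then show ?thesis using qf3 by simp
  qed
  have "af 3 - Fh 3 / 3 \<le> af y - Fh y / 3"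
    by (rule nondecreasing_from_deriv[OF y, where f'="\<lambda>y. qf y - ?D y / 3"])
      (use V1 in \<open>auto intro!: derivative_eq_intros af_deriv Fh_deriv simp: field_simps\<close>)
  then show ?thesis using af3 by simp
qed

text \<open>When \<open>yF \<le> 3\<close>, the energy bound allows a depression
  \<open>- af y\<close> of size at most \<open>Fh 3 / 3\<close>. Replacing T by 1 weakens
  \<open>qf\<close> to x + 1/x - 2, whose primitive contains a logarithm; at y = 1/10 it already
  exceeds the allowed size.\<close>

lemma left_range:
  assumes T: "5 / 4 \<le> T" and y: "0 < y" and a: "- af y \<le> Fh 3 / 3"
  shows "1 / 10 < y"
proof (rule ccontr)
  assume "\<not> 1 / 10 < y"
  then have y': "y \<le> 1 / 10" by simp
  have q: "x + 1 / x - 2 \<le> qf x" if x: "0 < x" "x \<le> 1" for x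
  proof -
    have "qf 1 - (1 + 1 / 1 - 2) \<le> qf x - (x + 1 / x - 2)"
    proof (rule nonincreasing_from_deriv[OF x(2)])
      fix z assume z: "x \<le> z" "z \<le> 1"
      show "((\<lambda>x. qf x - (x + 1 / x - 2)) has_real_derivative (z\<^sup>2 - 1) * (pp z - 1 / z\<^sup>2)) (at z)"
        using x z by (auto intro!: derivative_eq_intros qf_deriv' simp: field_simps power2_eq_square)
      have "z powr (-2) \<le> pp z" unfolding pp_def
        using x z T by (intro powr_mono') auto
      then have "1 / z\<^sup>2 \<le> pp z" using x z by (simp add: powr_minus powr_realpow divide_inverse)
      moreover have "z\<^sup>2 \<le> 1" using x z by (simp add: power_le_one)
      ultimately show "(z\<^sup>2 - 1) * (pp z - 1 / z\<^sup>2) \<le> 0" by (intro mult_nonpos_nonneg) auto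
    qed
    then show ?thesis by simp
  qed
  let ?f = "\<lambda>x. - af x + ln x + 3/2 - 2 * x + x\<^sup>2 / 2"
  have "?f 1 \<le> ?f (1/10)"
  proof (rule nonincreasing_from_deriv[where a="1/10" and b=1 and f="?f" and f'="\<lambda>x. - qf x + 1 / x - 2 + x"])
    fix z :: real assume z: "1/10 \<le> z" "z \<le> 1"
    show "(?f has_real_derivative - qf z + 1 / z - 2 + z) (at z)"
      using z by (auto intro!: derivative_eq_intros af_deriv)
    show "- qf z + 1 / z - 2 + z \<le> 0" using q[of z] z by simp
  qed simp
  then have "ln 10 - 3/2 + 2/10 - 1/200 \<le> - af (1/10)" by (simp add: ln_div power2_eq_square)
  moreover have "- af (1/10) \<le> - af y" using af_mono[OF y y'] by simp
  moreover have "9 / 4 \<le> ln (10::real)"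
  proof -
    have "exp (9::real) = exp 1 ^ 9" by (simp flip: exp_of_nat_mult)
    also have "\<dots> \<le> (272 / 100) ^ 9" using e_less_272 by (intro power_mono) auto
    also have "\<dots> \<le> (10::real) ^ 4" by (simp add: power_divide)
    finally have "9 \<le> ln ((10::real) ^ 4)" by (subst ln_ge_iff) auto
    then show ?thesis using ln_realpow[of "10::real" 4] by simp
  qed
  moreover have "Fh 3 \<le> 32 / (117 / 10)"
  proof -
    have "13 / 10 \<le> (3::real) powr (1/4)"
    proof (rule power_le_imp_le_base[of _ 3])
      have "((3::real) powr (1/4)) ^ Suc 3 = 3"
        by (simp add: powr_realpow[symmetric] powr_powr del: power_Suc)
      then show "(13 / 10) ^ Suc 3 \<le> ((3::real) powr (1/4)) ^ Suc 3" by (simp add: power_divide)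
    qed simp
    then have "117 / 10 \<le> (3::real) powr (2 + 1/4)" by (subst powr_add) simp
    also have "\<dots> \<le> 3 powr (1 + T)" using T by (intro powr_mono) auto
    finally have "117 / 10 \<le> (3::real) powr (1 + T)" .
    moreover have "pp 3 = 1 / 3 powr (1 + T)" unfolding pp_def
      using powr_minus_divide[of 3 "1 + T"] by simp
    ultimately have "pp 3 \<le> 1 / (117 / 10)" by (simp only:) (intro divide_left_mono, auto)
    then show ?thesis by (simp add: Fh_def pp_def[symmetric])
  qed
  ultimately show False using a by simp
qed

lemma powr_le_linear:
  fixes p y :: real
  assumes "0 \<le> p" "p \<le> 1" "1 \<le> y"
  shows "y powr p \<le> 1 + p * (y - 1)"
proof -
  have "1 + p * (1 - 1) - 1 powr p \<le> 1 + p * (y - 1) - y powr p"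
  proof (rule nondecreasing_from_deriv[OF assms(3)])
    fix x :: real assume x: "1 \<le> x"
    show "((\<lambda>y. 1 + p * (y - 1) - y powr p) has_real_derivative p - p * x powr (p - 1)) (at x)"
      using x by (auto intro!: derivative_eq_intros)
    have "x powr (p - 1) \<le> x powr 0" using x assms by (intro powr_mono) auto
    then have "x powr (p - 1) \<le> 1" using x by simp
    then show "0 \<le> p - p * x powr (p - 1)" using assms mult_left_le by force
  qed
  then show ?thesis by simp
qed

lemma powr_ge_linear:
  fixes p y :: real
  assumes "1 \<le> p" "1 \<le> y"
  shows "1 + p * (y - 1) \<le> y powr p"
proof -
  have "1 powr p - (1 + p * (1 - 1)) \<le> y powr p - (1 + p * (y - 1))"
  proof (rule nondecreasing_from_deriv[OF assms(2)])
    fix x :: real assume x: "1 \<le> x"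
    show "((\<lambda>y. y powr p - (1 + p * (y - 1))) has_real_derivative p * x powr (p - 1) - p) (at x)"
      using x by (auto intro!: derivative_eq_intros)
    have "x powr 0 \<le> x powr (p - 1)" using x assms by (intro powr_mono) auto
    then have "1 \<le> x powr (p - 1)" using x by simp
    then show "0 \<le> p * x powr (p - 1) - p" using assms by (simp add: mult_left_mono)
  qed
  then show ?thesis by simp
qed

text \<open>T / (y^T - 1) is y times the logarithmic derivative of 1 - y^(-T). At y = 1 it expands
  as 1 / (y - 1) + (1 - T) / 2 + ...; for T < 1 these two terms are an upper bound, for T \<ge> 1
  the first alone is, by Bernoulli.\<close>

lemma powr_increment_lower:
  assumes y: "1 < y"
  shows "T / (y powr T - 1) \<le> 1 / (y - 1) + max 0 ((1 - T) / 2)"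
proof (cases "1 \<le> T")
  case True
  have "T * (y - 1) \<le> y powr T - 1" using powr_ge_linear[OF True, of y] y by simp
  moreover have "0 < T * (y - 1)" using y T_pos by simp
  ultimately have "T / (y powr T - 1) \<le> T / (T * (y - 1))" using T_pos by (intro divide_left_mono) auto
  moreover have "max 0 ((1 - T) / 2) = 0" using True by simp
  ultimately show ?thesis using T_pos by simp
next
  case False
  define e where "e = (1 - T) / 2"
  have e: "0 < e" using False by (simp add: e_def)
  let ?f = "\<lambda>y. (y powr T - 1) * (1 + e * (y - 1)) - T * (y - 1)"
  let ?f' = "\<lambda>y. T * y powr (T - 1) * (1 + e * (y - 1)) + (y powr T - 1) * e - T"
  have "?f 1 \<le> ?f y"
  proof (rule nondecreasing_from_deriv[OF less_imp_le[OF y]])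
    fix x :: real assume x: "1 \<le> x"
    show "(?f has_real_derivative ?f' x) (at x)"
      using x by (auto intro!: derivative_eq_intros)
    have p: "x powr (1 - T) \<le> 1 + (1 - T) * (x - 1)"
      using x False T_pos by (intro powr_le_linear) auto
    have xx: "x powr (T - 1) * x powr (1 - T) = 1" "x powr T * x powr (1 - T) = x"
      using x by (simp_all flip: powr_add)
    \<comment> \<open>Multiplying by x^(1 - T) leaves a single power of x, to which the concave
      Bernoulli bound applies.\<close>
    have "?f' x * x powr (1 - T) = T * (1 + e * (x-1)) + e * x - (T + e) * x powr (1 - T)"
      using xx by (simp add: algebra_simps)
    also have "\<dots> \<ge> T * (1 + e * (x-1)) + e * x - (T + e) * (1 + (1 - T) * (x - 1))"
      using p e T_pos by (intro diff_left_mono mult_left_mono) auto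
    also have "T * (1 + e * (x-1)) + e * x - (T + e) * (1 + (1 - T) * (x - 1)) = 0"
      by (simp add: e_def field_simps)
    finally have "0 \<le> ?f' x * x powr (1 - T)" .
    then show "0 \<le> ?f' x" using x by (simp add: zero_le_mult_iff)
  qed
  then have "T * (y - 1) \<le> (y powr T - 1) * (1 + e * (y - 1))" by simp
  moreover have "1 < y powr T" using y T_pos by simp
  ultimately have "T / (y powr T - 1) \<le> (1 + e * (y - 1)) / (y - 1)"
    using y by (simp only: pos_divide_le_eq diff_gt_0_iff_gt times_divide_eq_left pos_le_divide_eq) (simp only: mult.commute)
  also have "\<dots> = 1 / (y - 1) + e" using y by (simp add: field_simps)
  finally show ?thesis using e by (simp add: e_def)
qed

text \<open>The ratio of the two sides is controlled by \<open>Fh\<^bsup>3/8\<^esup>\<close>, which grows at most by \<open>2\<^bsup>3/8\<^esup> \<le> 13/10\<close> as \<open>Fh y \<le> 2 Fh yF\<close>.\<close>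
lemma window_weight:
  assumes T: "T \<le> 5 / 4" and yF: "1 < yF" "yF \<le> y" and a: "af y \<le> Fh yF / 3"
  shows "(1 - y powr (- T)) * (y / yF) powr (3 / 10 * T) \<le> 13 / 10 * (1 - yF powr (- T))"
proof -
  let ?X = "\<lambda>y. ln (1 - y powr (- T)) + 3 / 10 * T * ln y"
  let ?f = "\<lambda>y. 3 / 8 * ln (Fh y) - ?X y"
  let ?f' = "\<lambda>y. 1 / y * (3 / 8 * (PP (y - 1) / ((y - 1) * (y + 1))) - (T / (y powr T - 1) + 3 / 10 * T))"
  have lt1: "y powr (- T) < 1" if "1 < y" for y
    using that T_pos by (simp add: powr_minus field_simps)
  have "?f yF \<le> ?f y"
  proof (rule nondecreasing_from_deriv[OF yF(2)])
    fix x assume x: "yF \<le> x" "x \<le> y"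
    then have x1: "1 < x" using yF by simp
    have xT: "1 < x powr T" using x1 T_pos by simp
    have "(?f has_real_derivative 3 / 8 * ((pp x / x * (x - 1)\<^sup>2 * PP (x - 1)) / Fh x)
       - ((- (- T * x powr (- T - 1))) / (1 - x powr (- T)) + 3 / 10 * T * (1 / x))) (at x)"
      using x1 lt1[OF x1] Fh_pos[OF x1]
      by (auto intro!: derivative_eq_intros Fh_deriv simp: field_simps)
    moreover have "(pp x / x * (x - 1)\<^sup>2 * PP (x - 1)) / Fh x = 1 / x * (PP (x - 1) / ((x - 1) * (x + 1)))"
    proof -
      have "p / x * d\<^sup>2 * P / (d ^ 3 * e * p) = 1 / x * (P / (d * e))" if "p \<noteq> 0" "d \<noteq> 0" for p d e P :: real
        using that by (simp add: power2_eq_square power3_eq_cube)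
      from this[of "pp x" "x - 1"] show ?thesis
        unfolding Fh_def pp_def[symmetric] using x1 pp_pos[of x] by (metis less_numeral_extra(3) less_trans zero_less_one diff_gt_0_iff_gt)
    qed
    moreover have "(- (- T * x powr (- T - 1))) / (1 - x powr (- T)) = 1 / x * (T / (x powr T - 1))"
      using x1 xT by (simp add: powr_diff powr_minus field_simps)
    moreover have "3 / 8 * (1 / x * p) - (1 / x * q + 3 / 10 * T * (1 / x)) =
        1 / x * (3 / 8 * p - (q + 3 / 10 * T))" for p q :: real
      using x1 by (simp add: field_simps)
    ultimately show "(?f has_real_derivative ?f' x) (at x)" by (simp only:)
    \<comment> \<open>The logarithmic derivative of \<open>Fh\<close> up to the factor 1/x. Since
      \<open>Fh\<close> has a triple zero at 1, the exponent 3/8 turns 3 / (x - 1) into 9/8 of the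
      singular term to be covered; the bounded terms cover the rest.\<close>
    have "PP (x - 1) / ((x - 1) * (x + 1)) = 3 * (1 / (x - 1)) + (2 - T) + x / (x + 1)"
      using x1 by (simp add: PP_def field_simps power2_eq_square)
    moreover have "1 / 2 \<le> x / (x + 1)" using x1 by (simp add: field_simps)
    moreover have "0 \<le> 1 / (x - 1)" using x1 by simp
    moreover have "T / (x powr T - 1) \<le> 1 / (x - 1) + max 0 ((1 - T) / 2)"
      by (rule powr_increment_lower[OF x1])
    moreover have "r + 3 / 10 * T \<le> 3 / 8 * Q"
        if "Q = 3 * u + (2 - T) + w" "1 / 2 \<le> w" "0 \<le> u" "r \<le> u + max 0 ((1 - T) / 2)" for r Q u w :: real
        using that T by (cases "1 \<le> T") (simp_all add: field_simps)
    ultimately have "T / (x powr T - 1) + 3 / 10 * T \<le> 3 / 8 * (PP (x - 1) / ((x - 1) * (x + 1)))"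
      by blast
    then show "0 \<le> ?f' x" using x1 by simp
  qed
  moreover have "ln (Fh y) - ln (Fh yF) \<le> ln 2"
  proof -
    have "Fh y \<le> 2 * Fh yF" using af_lower[of y] a yF by simp
    then have "ln (Fh y) \<le> ln (2 * Fh yF)" using Fh_pos[of y] yF by simp
    then show ?thesis using Fh_pos[of yF] yF by (simp add: ln_mult)
  qed
  moreover have "3 / 8 * ln 2 \<le> ln (13 / 10 :: real)"
  proof -
    have "ln ((2::real) ^ 3) \<le> ln ((13 / 10) ^ 8)" by (simp add: power_divide)
    also have "\<dots> = 8 * ln (13 / 10)" by (subst ln_realpow) auto
    finally have "ln ((2::real) ^ 3) \<le> 8 * ln (13 / 10)" .
    moreover have "ln ((2::real) ^ 3) = 3 * ln 2" by (subst ln_realpow) auto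
    ultimately show ?thesis by simp
  qed
  ultimately have X: "?X y \<le> ?X yF + ln (13 / 10)" by simp
  have pos: "0 < 1 - y powr (- T)" "0 < 1 - yF powr (- T)" using lt1[of y] lt1[of yF] yF by auto
  have "ln ((1 - y powr (- T)) * (y / yF) powr (3 / 10 * T)) = ?X y - 3 / 10 * T * ln yF"
  proof -
    have "0 < (y / yF) powr (3 / 10 * T)" using yF by simp
    then have "ln ((1 - y powr (- T)) * (y / yF) powr (3 / 10 * T)) =
        ln (1 - y powr (- T)) + 3 / 10 * T * ln (y / yF)"
      using pos(1) yF by (subst ln_mult_pos) (auto simp: ln_powr)
    moreover have "ln (y / yF) = ln y - ln yF" using yF by (simp add: ln_div)
    ultimately show ?thesis by (simp only: right_diff_distrib add_diff_eq)
  qed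
  also have "\<dots> \<le> ln (13 / 10) + ln (1 - yF powr (- T))" using X by simp
  also have "\<dots> = ln (13 / 10 * (1 - yF powr (- T)))" using pos by (subst ln_mult_pos) auto
  finally show ?thesis using pos yF by (subst (asm) ln_le_cancel_iff) auto
qed

text \<open>The bound (2 / T - 1) / 4 is (\<gamma> - 1) / 4, the coefficient of the coupling that
  the weight consumes; b = 3/20 meets it exactly for T \<le> 5/4. For larger T and
  \<open>yF \<ge> 3\<close>, \<open>af_lower_large\<close> leaves only y = \<open>yF\<close>, so b =
  0 will do. The bound 1/2 keeps the weight below 2 at the end.\<close>

lemma weight_exists:
  assumes yF: "1 < yF" and c: "T \<le> 5 / 4 \<or> 3 \<le> yF"
  shows "\<exists>b\<ge>0. b \<le> (2 / T - 1) / 4 \<and> b \<le> 1 / 2 \<and> (\<forall>y\<ge>yF. af y \<le> Fh yF / 3 \<longrightarrow>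
    (1 - y powr (- T)) * (y / yF) powr (2 * b * T) \<le> (1 + 2 * b) * (1 - yF powr (- T)))"
proof (cases "T \<le> 5 / 4")
  case True
  have "3 / 20 \<le> (2 / T - 1) / 4" using True T_pos by (simp add: field_simps)
  then show ?thesis using window_weight[OF True yF] by (intro exI[of _ "3/20"]) auto
next
  case False
  then have 3: "3 \<le> yF" using c by simp
  have "y = yF" if "yF \<le> y" "af y \<le> Fh yF / 3" for y
    using af_lower_large[of y] that False 3 Fh_mono_iff[of y yF] by auto
  moreover have "0 \<le> (2 / T - 1) / 4" using T_pos T_le2 by (simp add: field_simps)
  moreover have "(1 - yF powr (- T)) * (yF / yF) powr (2 * 0 * T) \<le> (1 + 2 * 0) * (1 - yF powr (- T))"
    using yF by simp
  moreover have "(0::real) \<le> 1 / 2" by simp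
  ultimately show ?thesis by (metis order_refl)
qed

text \<open>\<open>zt\<close> is the cube root of \<open>Fh\<close>. As a function of \<open>zt\<close>, \<open>- y\<^bsup>-T\<^esup>\<close> is concave on \<open>y \<ge> 1\<close>, and \<open>3 dl yF / zt yF\<close> is its slope
  at \<open>yF\<close>.\<close>
definition zt :: "real \<Rightarrow> real" where
  "zt y = (y - 1) * ((y + 1) powr (1/3) * y powr (- (1 + T) / 3))"

definition JJ :: "real \<Rightarrow> real" where
  "JJ y = (2 - T) + (1 + T) / y + (y - 1) / (y + 1)"

text \<open>The derivative of \<open>zt\<close> up to the factor y^(-1-T) / 3. The expanded sum,
  rather than the product in \<open>kk_alt\<close>, makes each summand visibly increasing for T
  \<ge> 5/4.\<close>

definition kk :: "real \<Rightarrow> real" where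
  "kk y = (y + 1) powr (1/3) * (y powr (2/3 * (1 + T)) * (2 - T)
     + y powr ((2 * T - 1) / 3) * (1 + T) + y powr (2/3 * (1 + T)) * ((y - 1) / (y + 1)))"

definition dl :: "real \<Rightarrow> real" where
  "dl y = T * y powr (- T) * (y - 1) / (y * JJ y)"

lemma zt_cube:
  assumes "1 \<le> y"
  shows "zt y ^ 3 = Fh y"
proof -
  have *: "(y powr e) ^ 3 = y powr (3 * e)" if "0 < y" for y e :: real
    using that powr_realpow[of "y powr e" 3] by (simp add: powr_powr mult.commute)
  have "3 * (- (1 + T) / 3) = - 1 - T" by simp
  then have "(y powr (- (1 + T) / 3)) ^ 3 = pp y"
    using *[of y "- (1 + T) / 3"] assms by (simp only: pp_def)
  moreover have "((y + 1) powr (1/3)) ^ 3 = y + 1"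
    using *[of "y + 1" "1/3"] assms by simp
  ultimately show ?thesis unfolding zt_def Fh_def pp_def[symmetric] power_mult_distrib by simp
qed

lemma JJ_pos: "1 \<le> y \<Longrightarrow> 0 < JJ y"
  unfolding JJ_def using T_pos T_le2 by (intro add_nonneg_pos add_pos_nonneg divide_nonneg_pos divide_pos_pos) auto

lemma kk_alt: "1 \<le> y \<Longrightarrow> kk y = (y + 1) powr (1/3) * y powr (2/3 * (1 + T)) * JJ y"
proof -
  assume y: "1 \<le> y"
  have "y powr ((2 * T - 1) / 3) = y powr (2/3 * (1 + T) - 1)" by (simp add: field_simps)
  also have "\<dots> = y powr (2/3 * (1 + T)) / y" using y by (subst powr_diff) simp
  finally show ?thesis by (simp add: kk_def JJ_def field_simps)
qed

lemma zt_deriv: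
  assumes y: "1 \<le> y"
  shows "(zt has_real_derivative kk y / 3 * y powr (- 1 - T)) (at y)"
proof -
  let ?A = "(y + 1) powr (1/3)" and ?B = "y powr (- (1 + T) / 3)"
  have A: "(y + 1) powr (1/3 - 1) = ?A / (y + 1)" using y by (subst powr_diff) simp
  have B: "y powr (- (1 + T) / 3 - 1) = ?B / y" using y by (subst powr_diff) simp
  have dA: "((\<lambda>y. (y + 1) powr (1/3)) has_real_derivative 1/3 * (?A / (y + 1))) (at y)"
    using y unfolding A[symmetric] by (auto intro!: derivative_eq_intros)
  have dB: "((\<lambda>y. y powr (- (1 + T) / 3)) has_real_derivative - (1 + T) / 3 * (?B / y)) (at y)"
    using y unfolding B[symmetric] by (intro has_real_derivative_powr) simp
  have "(zt has_real_derivative 1 * (?A * ?B) + (1/3 * (?A / (y + 1)) * ?B + (- (1 + T) / 3 * (?B / y)) * ?A) * (y - 1)) (at y)"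
    unfolding zt_def by (rule DERIV_mult DERIV_cong[OF DERIV_mult[OF dA dB]] refl | (auto intro!: derivative_eq_intros)[1])+
  moreover have "1 * (?A * ?B) + (1/3 * (?A / (y + 1)) * ?B + (- (1 + T) / 3 * (?B / y)) * ?A) * (y - 1)
     = ?A * ?B * JJ y / 3"
  proof -
    have "1 * p + (1/3 * (A / (y + 1)) * B + (- (1 + T) / 3 * (B / y)) * A) * (y - 1) = p * JJ y / 3"
      if "p = A * B" "y \<noteq> 0" "y + 1 \<noteq> 0" for A B p
      unfolding JJ_def that(1) using that(2,3) by (simp add: divide_simps) (simp add: algebra_simps)
    from this[OF refl] show ?thesis using y by simp
  qed
  moreover have "?A * ?B * JJ y / 3 = kk y / 3 * y powr (- 1 - T)"
  proof -
    have "2/3 * (1 + T) + (- 1 - T) = - (1 + T) / 3" by (simp add: field_simps)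
    then have "?B = y powr (2/3 * (1 + T)) * y powr (- 1 - T)"
      by (simp only: powr_add[symmetric])
    then show ?thesis unfolding kk_alt[OF y] by simp
  qed
  ultimately show ?thesis by (metis (no_types, lifting))
qed

lemma kk_mono: "1 \<le> x \<Longrightarrow> x \<le> y \<Longrightarrow> 5 / 4 \<le> T \<Longrightarrow> kk x \<le> kk y"
  unfolding kk_def using T_le2
  by (intro mult_mono add_mono powr_mono2 add_nonneg_nonneg mult_nonneg_nonneg)
    (auto simp: field_simps)

text \<open>Slope matching: by \<open>zt_deriv\<close>, -y^(-T) has slope 3 T / \<open>kk y\<close>
  as a function of \<open>zt\<close>, and this equals \<open>3 * dl y / zt y\<close>.\<close>

lemma dl_kk: "1 < y \<Longrightarrow> dl y * kk y / zt y = T"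
proof -
  assume y: "1 < y"
  let ?A = "(y + 1) powr (1/3)"
  have "y powr (2/3 * (1 + T)) * y powr (- T) = y powr (- (1 + T) / 3) * y"
  proof -
    have "2/3 * (1 + T) + - T = - (1 + T) / 3 + 1" by (simp add: field_simps)
    then have "y powr (2/3 * (1 + T)) * y powr (- T) = y powr (- (1 + T) / 3 + 1)"
      by (simp only: powr_add[symmetric])
    then show ?thesis using y by (simp only: powr_add) simp
  qed
  moreover have "?A \<noteq> 0" "JJ y \<noteq> 0" using y JJ_pos[of y] by auto
  ultimately show ?thesis using y
    by (simp add: dl_def kk_alt zt_def field_simps)
qed

lemma dl_pos: "1 < y \<Longrightarrow> 0 < dl y"
  unfolding dl_def using T_pos JJ_pos[of y] by (intro divide_pos_pos mult_pos_pos) auto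

lemma zt_pos: "1 < y \<Longrightarrow> 0 < zt y" by (simp add: zt_def)

text \<open>Concavity is \<open>kk_mono\<close>: as \<open>kk\<close> increases, the slope 3 T /
  \<open>kk\<close> falls.\<close>

lemma tangent:
  assumes T: "5 / 4 \<le> T" and yF: "1 < yF" and y: "1 \<le> y"
  shows "yF powr (- T) - y powr (- T) \<le> 3 * dl yF * (zt y / zt yF - 1)"
proof -
  let ?f = "\<lambda>y. 3 * dl yF * (zt y / zt yF - 1) - (yF powr (- T) - y powr (- T))"
  let ?f' = "\<lambda>y. y powr (- 1 - T) * (dl yF * kk y / zt yF - T)"
  have z: "0 < zt yF" by (rule zt_pos[OF yF])
  have d: "(?f has_real_derivative ?f' x) (at x)" if x: "1 \<le> x" for x
  proof -
    have "((\<lambda>x. x powr (- T)) has_real_derivative - T * x powr (- T - 1)) (at x)"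
      using x by (intro has_real_derivative_powr) simp
    moreover have "- T - 1 = - 1 - T" by simp
    ultimately have "((\<lambda>x. x powr (- T)) has_real_derivative - T * x powr (- 1 - T)) (at x)"
      by (simp only:)
    then have "(?f has_real_derivative 3 * dl yF * (kk x / 3 * x powr (- 1 - T) / zt yF - 0) - (0 - - T * x powr (- 1 - T))) (at x)"
      by (intro DERIV_diff DERIV_cmult DERIV_cdivide zt_deriv DERIV_const x)
    then show ?thesis by (rule DERIV_cong) (simp add: field_simps)
  qed
  have e: "dl yF * kk yF / zt yF = T" by (rule dl_kk[OF yF])
  have "?f yF \<le> ?f y"
  proof (cases "yF \<le> y")
    case True
    show ?thesis
    proof (rule nondecreasing_from_deriv[OF True d])
      fix x assume x: "yF \<le> x"
      have "dl yF * kk yF / zt yF \<le> dl yF * kk x / zt yF"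
        using kk_mono[of yF x] x yF T z dl_pos[OF yF] by (intro divide_right_mono mult_left_mono) auto
      then show "0 \<le> ?f' x" using e by simp
    qed (use yF in auto)
  next
    case False
    then have "y \<le> yF" by simp
    then show ?thesis
    proof (rule nonincreasing_from_deriv[OF _ d])
      fix x assume x: "y \<le> x" "x \<le> yF"
      have "dl yF * kk x / zt yF \<le> dl yF * kk yF / zt yF"
        using kk_mono[of x yF] x y yF T z dl_pos[OF yF] by (intro divide_right_mono mult_left_mono) auto
      then show "?f' x \<le> 0" using e by (simp add: mult_nonneg_nonpos)
    qed (use y in auto)
  qed
  moreover have "?f yF = 0" using z by simp
  ultimately have "0 \<le> ?f y" by (simp only:)
  then show ?thesis by linarith
qed

text \<open>4/25 is the constant of \<open>power5_8_ineq\<close>, which handles y < 1. In a = yF - 1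
  and s = 2 - T, with yF^s replaced by its Bernoulli bound, the claim becomes a polynomial
  inequality on 0 < a \<le> 2, 0 \<le> s \<le> 3/4.\<close>

lemma dl_le:
  assumes T: "5 / 4 \<le> T" and yF: "1 < yF" "yF \<le> 3"
  shows "2 * (1 + T) / (3 * T) * dl yF \<le> 4 / 25"
proof -
  define a s where "a = yF - 1" and "s = 2 - T"
  have a: "0 < a" "a \<le> 2" and s: "0 \<le> s" "s \<le> 3 / 4" using T T_le2 yF by (auto simp: a_def s_def)
  have yFa: "yF = 1 + a" and Ts: "T = 2 - s" by (auto simp: a_def s_def)
  have r: "yF powr (- T) \<le> (1 + s * a) / yF\<^sup>2"
  proof -
    have "yF powr (s - 2) = yF powr s / yF\<^sup>2" using yF by (simp add: powr_diff)
    moreover have "- T = s - 2" by (simp add: s_def)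
    ultimately have "yF powr (- T) = yF powr s / yF\<^sup>2" by (simp only:)
    also have "\<dots> \<le> (1 + s * a) / yF\<^sup>2"
      using powr_le_linear[of s yF] s yF by (intro divide_right_mono) (auto simp: a_def)
    finally show ?thesis .
  qed
  have PJ: "PP a = yF * JJ yF * (a + 2)"
  proof -
    have "yF * ((2 - T) + (1 + T) / yF + a / (a + 2)) * (a + 2)
      = (2 - T) * yF * (a + 2) + (1 + T) * (a + 2) + yF * a"
    proof -
      have "(1 + T) / yF * yF = 1 + T" "a / (a + 2) * (a + 2) = a" using a yF by auto
      moreover have "yF * ((2 - T) + r1 + r2) * (a + 2) =
          (2 - T) * yF * (a + 2) + (r1 * yF) * (a + 2) + yF * (r2 * (a + 2))" for r1 r2
        by (simp add: algebra_simps)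
      ultimately show ?thesis by (simp only:)
    qed
    also have "\<dots> = PP a" by (simp add: PP_def yFa algebra_simps power2_eq_square)
    finally show ?thesis by (simp add: JJ_def a_def add.commute)
  qed
  have P: "0 < PP a" using PP_ge[of a] a by simp
  have "dl yF = T * (a * (a + 2) / PP a) * yF powr (- T)"
  proof -
    have "a * (a + 2) / (yF * JJ yF * (a + 2)) = a / (yF * JJ yF)" using a by simp
    then show ?thesis unfolding dl_def PJ by (simp add: a_def)
  qed
  then have "2 * (1 + T) / (3 * T) * dl yF = 2 * (1 + T) / 3 * (a * (a + 2) / PP a) * yF powr (- T)"
    using T_pos by simp
  also have "\<dots> \<le> 2 * (1 + T) / 3 * (a * (a + 2) / PP a) * ((1 + s * a) / yF\<^sup>2)"
    using r a P T_pos by (intro mult_left_mono) auto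
  also have "\<dots> = (50 * (1 + T) * a * (a + 2) * (1 + s * a)) / (75 * (yF\<^sup>2 * PP a))"
    using P yF by (simp add: divide_simps) (simp add: algebra_simps)
  also have "\<dots> \<le> 4 / 25"
  proof -
    define A B C where "A = 72 - 108 * a + 30 * a\<^sup>2 + 72 * a ^ 3 + 12 * a ^ 4"
      and "B = 12 * a ^ 4 - 102 * a ^ 3 - 190 * a\<^sup>2 + 124 * a" and "C = 50 * a ^ 3 + 100 * a\<^sup>2"
    have "12 * (yF\<^sup>2 * PP a) - 50 * (1 + T) * a * (a + 2) * (1 + s * a) = A + B * s + C * s\<^sup>2"
    proof -
      have "PP a = 6 + (4 + 2 * s) * a + (1 + s) * a\<^sup>2" "1 + T = 3 - s"
        by (simp_all add: PP_def s_def algebra_simps)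
      then show ?thesis
        by (simp only: A_def B_def C_def yFa)
          (simp add: algebra_simps power2_eq_square power3_eq_cube power4_eq_xxxx)
    qed
    \<comment> \<open>Replacing s^2 by its tangent at 1/2 makes the polynomial affine in s, so it is
      enough to check s = 0 and s = 3/4. The powers of a are then mostly bounded by tangents as
      well.\<close>
    moreover have "C * (s - 1 / 4) \<le> C * s\<^sup>2"
    proof (rule mult_left_mono)
      have "0 \<le> (s - 1/2)\<^sup>2" by simp
      then show "s - 1 / 4 \<le> s\<^sup>2" by (simp add: power2_eq_square algebra_simps)
      show "0 \<le> C" using a by (simp add: C_def)
    qed
    moreover have "0 \<le> A + B * s + C * (s - 1 / 4)"
    proof -
      have t1: "27/16 * a - 27/32 \<le> a ^ 3"
      proof -
        have "a ^ 3 - (27/16 * a - 27/32) = (a - 3/4)\<^sup>2 * (a + 3/2)"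
          by (simp add: power2_eq_square power3_eq_cube field_simps)
        moreover have "0 \<le> (a - 3/4)\<^sup>2 * (a + 3/2)" using a by simp
        ultimately show ?thesis by linarith
      qed
      have t2: "3 * a - 2 \<le> a ^ 3"
      proof -
        have "a ^ 3 - (3 * a - 2) = (a - 1)\<^sup>2 * (a + 2)"
          by (simp add: power2_eq_square power3_eq_cube algebra_simps)
        moreover have "0 \<le> (a - 1)\<^sup>2 * (a + 2)" using a by simp
        ultimately show ?thesis by linarith
      qed
      have t3: "2 * a\<^sup>2 - 1 \<le> a ^ 4"
      proof -
        have "a ^ 4 - (2 * a\<^sup>2 - 1) = (a\<^sup>2 - 1)\<^sup>2"
          by (simp add: power2_eq_square power4_eq_xxxx algebra_simps)
        then show ?thesis using zero_le_power2[of "a\<^sup>2 - 1"] by linarith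
      qed
      have t4: "a\<^sup>2 \<le> 2 * a" using a by (simp add: power2_eq_square)
      have p1: "0 \<le> A - C / 4"
      proof -
        have "0 \<le> 5 * (a - 76/100)\<^sup>2" "0 \<le> a ^ 4" by auto
        then have "152/20 * a - 2888/1000 \<le> 5 * a\<^sup>2" by (simp add: power2_eq_square algebra_simps)
        moreover have "A - C / 4 = 72 - 108 * a + 5 * a\<^sup>2 + 119 / 2 * a ^ 3 + 12 * a ^ 4"
          by (simp add: A_def C_def field_simps)
        moreover have "0 \<le> 72 - 108 * a + 5 * X + 119 / 2 * Y + 12 * Z"
          if "152/20 * a - 2888/1000 \<le> 5 * X" "27/16 * a - 27/32 \<le> Y" "0 \<le> Z" for X Y Z :: real
          using that a by (simp add: field_simps)
        ultimately show ?thesis using t1 \<open>0 \<le> a ^ 4\<close> by simp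
      qed
      have p2: "0 \<le> A + C / 2 + 3 / 4 * B"
      proof -
        have "A + C / 2 + 3 / 4 * B = 72 - 15 * a - 125/2 * a\<^sup>2 + 41/2 * a ^ 3 + 21 * a ^ 4"
          by (simp add: A_def B_def C_def field_simps)
        moreover have "0 \<le> 72 - 15 * a - 125/2 * X + 41/2 * Y + 21 * Z"
          if "X \<le> 2 * a" "3 * a - 2 \<le> Y" "2 * X - 1 \<le> Z" for X Y Z :: real
          using that a by (simp add: field_simps)
        ultimately show ?thesis using t2 t3 t4 by simp
      qed
      have "A + B * s + C * (s - 1 / 4) = (1 - 4/3 * s) * (A - C / 4) + 4/3 * s * (A + C / 2 + 3 / 4 * B)"
        by (simp add: field_simps)
      moreover have "0 \<le> (1 - 4/3 * s) * (A - C / 4)" "0 \<le> 4/3 * s * (A + C / 2 + 3 / 4 * B)"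
        using mult_nonneg_nonneg[OF _ p1, of "1 - 4/3 * s"] mult_nonneg_nonneg[OF _ p2, of "4/3 * s"] s
        by simp_all
      ultimately show ?thesis by linarith
    qed
    ultimately have "50 * (1 + T) * a * (a + 2) * (1 + s * a) \<le> 12 * (yF\<^sup>2 * PP a)" by linarith
    moreover have "0 < 75 * (yF\<^sup>2 * PP a)" using P yF by simp
    ultimately show ?thesis by (subst pos_divide_le_eq) (simp_all add: mult_ac)
  qed
  finally show ?thesis .
qed

text \<open>Here e is the ratio \<open>zt y / zt yF\<close> of cube roots, n the fraction of energy
  ahead, and the bounds on e^3 come from the two one-sided energy bounds. The left side adds the
  loss 3 (e - 1) of the tangent bound to the losses from potential and coupling; the right side
  stems from the energy flux. The cubic is replaced by its tangents.\<close>

lemma cubic_potential_ineq: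
  fixes e n b :: real
  assumes e: "0 \<le> e" and n: "0 \<le> n" "n \<le> 3 / 4" and en: "e ^ 3 \<le> 4 * n" "e ^ 3 \<le> 4 * (1 - n)"
    and b: "0 \<le> b" "b \<le> 3 / 20"
  shows "3 * (e - 1) + ((1 - 4/3 * n) + b * max 0 ((1 - 4/3 * n) - max 0 (1 - 4/3 * (1 - n))))
    \<le> 2 / 3 * (1 + 2 * b) * e ^ 3"
proof -
  have amgm: "3 * a\<^sup>2 * e - 2 * a ^ 3 \<le> e ^ 3" if "0 \<le> a" for a
  proof -
    have "e ^ 3 - (3 * a\<^sup>2 * e - 2 * a ^ 3) = (e - a)\<^sup>2 * (e + 2 * a)"
      by (simp add: power2_eq_square power3_eq_cube algebra_simps)
    moreover have "0 \<le> (e - a)\<^sup>2 * (e + 2 * a)" using that e by simp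
    ultimately show ?thesis by linarith
  qed
  have e3: "0 \<le> e ^ 3" using e by simp
  have be: "0 \<le> b * e ^ 3" using b e3 by simp
  show ?thesis
  proof (cases "n \<le> 1 / 2")
    case True
    have "b * max 0 ((1 - 4/3 * n) - max 0 (1 - 4/3 * (1 - n))) \<le> b * (4/3 * (1 - 2 * n))"
      using True b by (intro mult_left_mono) (auto simp: max_def field_simps)
    also have "\<dots> \<le> b * (4/3 * (1 - e ^ 3 / 2))" using en b by (intro mult_left_mono) auto
    finally have 1: "b * max 0 ((1 - 4/3 * n) - max 0 (1 - 4/3 * (1 - n))) \<le> b * (4/3) - 2/3 * (b * e ^ 3)"
      by (simp add: algebra_simps)
    have "4/3 * (b * (1 - 3/2 * e ^ 3)) \<le> e ^ 3 - 3 * e + 2"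
    proof (cases "1 - 3/2 * e ^ 3 \<le> 0")
      case True
      then have "b * (1 - 3/2 * e ^ 3) \<le> 0" using b by (simp add: mult_nonneg_nonpos)
      then show ?thesis using amgm[of 1] by simp
    next
      case False
      then have "b * (1 - 3/2 * e ^ 3) \<le> 3/20 * (1 - 3/2 * e ^ 3)" using b by (intro mult_right_mono) auto
      \<comment> \<open>Tangent at 22/25, close to the minimizer 1 / sqrt(13/10) of 13/10 e^3 - 3 e
        + 9/5, which is what remains for b = 3/20.\<close>
      moreover have "1452/625 * e - 21296/15625 \<le> e ^ 3"
        using amgm[of "22/25"] e by (simp add: power2_eq_square power3_eq_cube)
      ultimately show ?thesis using e by simp
    qed
    then have 2: "4/3 * b - 2 * (b * e ^ 3) \<le> e ^ 3 - 3 * e + 2" by (simp add: algebra_simps)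
    have "2 / 3 * (1 + 2 * b) * e ^ 3 = 2/3 * e ^ 3 + 4/3 * (b * e ^ 3)" by (simp add: algebra_simps)
    then show ?thesis using 1 2 en(1) by simp
  next
    case False
    then have "max 0 ((1 - 4/3 * n) - max 0 (1 - 4/3 * (1 - n))) = 0" by auto
    \<comment> \<open>Tangent at 49/40, close to sqrt(3/2), where 3 e - 2/3 e^3 is largest; for n >
      1/2 the potential contributes less than 1/3.\<close>
    moreover have "3 * e - 8/3 \<le> 2/3 * e ^ 3"
      using amgm[of "49/40"] e by (simp add: power2_eq_square power3_eq_cube)
    moreover have "2 / 3 * (1 + 2 * b) * e ^ 3 = 2/3 * e ^ 3 + 4/3 * (b * e ^ 3)" by (simp add: algebra_simps)
    ultimately show ?thesis using False be by simp
  qed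
qed

text \<open>With z = y^(-1/4) this compares y^(-2) - 1 with y^(-5/4) - 1 for 1/10 \<le> y \<le> 1.
  After division by z - 1 every power is compared with z^4; 89/50 is an upper bound for
  10^(1/4).\<close>

lemma power5_8_ineq:
  fixes z :: real
  assumes z: "1 \<le> z" "z ^ 4 \<le> 10"
  shows "4 / 25 * (z ^ 8 - 1) \<le> z ^ 5 - 1"
proof -
  have z2: "z \<le> 89 / 50"
  proof (rule power_le_imp_le_base[of _ 3])
    show "z ^ Suc 3 \<le> (89/50) ^ Suc 3" using z by (simp add: power_divide)
  qed simp
  have z4: "0 \<le> z ^ 4" by simp
  have b: "50/89 * z ^ 4 \<le> z ^ 3" "(50/89)\<^sup>2 * z ^ 4 \<le> z\<^sup>2" "(50/89)^3 * z ^ 4 \<le> z" "(50/89)^4 * z ^ 4 \<le> 1"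
  proof -
    have "50/89 * z \<le> 1" "0 \<le> 50/89 * z" using z z2 by auto
    then have "z ^ 3 * (50/89 * z) ^ 1 \<le> z ^ 3 * 1" "z ^ 2 * (50/89 * z) ^ 2 \<le> z ^ 2 * 1"
      "z * (50/89 * z) ^ 3 \<le> z * 1" "(50/89 * z) ^ 4 \<le> 1"
      using z by (intro mult_left_mono power_le_one; simp)+
    then show "50/89 * z ^ 4 \<le> z ^ 3" "(50/89)\<^sup>2 * z ^ 4 \<le> z\<^sup>2" "(50/89)^3 * z ^ 4 \<le> z" "(50/89)^4 * z ^ 4 \<le> 1"
      by (simp_all add: power_mult_distrib power2_eq_square power3_eq_cube power4_eq_xxxx mult_ac)
  qed
  have u: "z ^ 5 \<le> 89/50 * z ^ 4" "z ^ 6 \<le> (89/50)\<^sup>2 * z ^ 4" "z ^ 7 \<le> (89/50)^3 * z ^ 4"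
  proof -
    have "z ^ k * z ^ 4 \<le> (89/50) ^ k * z ^ 4" for k
      using z z2 by (intro mult_right_mono power_mono) auto
    from this[of 1] this[of 2] this[of 3]
    show "z ^ 5 \<le> 89/50 * z ^ 4" "z ^ 6 \<le> (89/50)\<^sup>2 * z ^ 4" "z ^ 7 \<le> (89/50)^3 * z ^ 4"
      using power_add[of z 1 4] power_add[of z 2 4] power_add[of z 3 4] by simp_all
  qed
  have "0 \<le> 21/25 * (1 + z + z\<^sup>2 + z ^ 3 + z ^ 4) - 4/25 * (z ^ 5 + z ^ 6 + z ^ 7)"
  proof -
    have "21/25 * ((50/89)^4 * X + (50/89)^3 * X + (50/89)\<^sup>2 * X + 50/89 * X + X)
      - 4/25 * (89/50 * X + (89/50)\<^sup>2 * X + (89/50)^3 * X) \<ge> 0" if "0 \<le> X" for X :: real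
      using that by (simp add: power_divide)
    from this[OF z4] show ?thesis using b u by argo
  qed
  then have "0 \<le> (z - 1) * (21/25 * (1 + z + z\<^sup>2 + z ^ 3 + z ^ 4) - 4/25 * (z ^ 5 + z ^ 6 + z ^ 7))"
    using z by (intro mult_nonneg_nonneg) auto
  also have "\<dots> = (z ^ 5 - 1) - 4 / 25 * (z ^ 8 - 1)"
    by (simp add: field_simps eval_nat_numeral)
  finally show ?thesis by simp
qed

text \<open>The balance behind the potential barrier. On the left: the loss in 1/h when h exceeds H,
  the shift of Z_j by the potential, and the coupling, with coefficient b. On the right: the energy
  flux that drives the potential. For y \<ge> 1 the tangent bound and the cubic inequality combine;
  for y < 1 the flux has the wrong sign, and y^(-T) pays for it.\<close>

lemma barrier_ineq:
  assumes T: "5 / 4 \<le> T" and yF: "1 < yF" "yF \<le> 3" and y: "0 < y"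
    and n: "0 \<le> n" "n \<le> 3 / 4"
    and t: "\<bar>af y\<bar> \<le> 2 / 3 * Fh yF * n" "\<bar>af y\<bar> \<le> 2 / 3 * Fh yF * (1 - n)"
  defines "b \<equiv> (2 / T - 1) / 4"
  shows "1 / 10 < y"
    "yF powr (- T) - y powr (- T)
      + dl yF * ((1 - 4/3 * n) + b * max 0 ((1 - 4/3 * n) - max 0 (1 - 4/3 * (1 - n))))
      \<le> dl yF * (2 / T) * St y / Fh yF"
proof -
  have F: "0 < Fh yF" by (rule Fh_pos[OF yF(1)])
  have FF: "Fh yF \<le> Fh 3" using yF Fh_mono_iff[of yF 3] by simp
  have t3: "\<bar>af y\<bar> \<le> Fh yF / 3"
  proof -
    have "2 / 3 * Fh yF * n + 2 / 3 * Fh yF * (1 - n) = 2 / 3 * Fh yF" by (simp add: field_simps)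
    then show ?thesis using t by linarith
  qed
  show y10: "1 / 10 < y" using t3 FF by (intro left_range[OF T y]) linarith
  have b: "0 \<le> b" "b \<le> 3 / 20" using T T_le2 unfolding b_def by (auto simp: field_simps)
  have d: "0 < dl yF" by (rule dl_pos[OF yF(1)])
  let ?q = "(1 - 4/3 * n) + b * max 0 ((1 - 4/3 * n) - max 0 (1 - 4/3 * (1 - n)))"
  show "yF powr (- T) - y powr (- T) + dl yF * ?q \<le> dl yF * (2 / T) * St y / Fh yF"
  proof (cases "1 \<le> y")
    case True
    define e where "e = zt y / zt yF"
    have e0: "0 \<le> e" using True yF zt_pos[of yF] by (simp add: e_def zt_def)
    have e3: "e ^ 3 = Fh y / Fh yF" using True yF by (simp add: e_def power_divide zt_cube)
    have "Fh y / 6 \<le> 2 / 3 * Fh yF * n" "Fh y / 6 \<le> 2 / 3 * Fh yF * (1 - n)"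
      using af_lower[OF True] t by linarith+
    then have "Fh y \<le> Fh yF * (4 * n)" "Fh y \<le> Fh yF * (4 * (1 - n))" by (simp_all add: algebra_simps)
    then have en: "e ^ 3 \<le> 4 * n" "e ^ 3 \<le> 4 * (1 - n)" unfolding e3 using F by (simp_all add: field_simps)
    have y3: "y \<le> 3"
    proof (rule ccontr)
      assume "\<not> y \<le> 3"
      then have "Fh y / 3 \<le> Fh yF / 3" using af_lower_large[OF T, of y] t3 by linarith
      then show False using \<open>\<not> y \<le> 3\<close> Fh_mono_iff[of y yF] yF by simp
    qed
    have "yF powr (- T) - y powr (- T) + dl yF * ?q \<le> dl yF * (3 * (e - 1) + ?q)"
      using tangent[OF T yF(1) True] by (simp add: e_def algebra_simps)
    also have "\<dots> \<le> dl yF * (2 / 3 * (1 + 2 * b) * e ^ 3)"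
      using cubic_potential_ineq[OF e0 n en b] d by (intro mult_left_mono) auto
    \<comment> \<open>For this b the constant is (2 + T) / (3 T), which is 2 / T times the constant
      of \<open>St_lower_right\<close>.\<close>
    also have "2 / 3 * (1 + 2 * b) * e ^ 3 = 2 / T * ((2 + T) / 6 * Fh y) / Fh yF"
      unfolding e3 b_def using T F by (simp add: field_simps)
    also have "dl yF * \<dots> \<le> dl yF * (2 / T * St y / Fh yF)"
      using St_lower_right[OF True y3 T] T F d
      by (intro mult_left_mono divide_right_mono) auto
    finally show ?thesis by (simp add: mult.assoc)
  next
    case False
    then have y1: "y \<le> 1" by simp
    define k where "k = 2 * (1 + T) / (3 * T)"
    have kd: "k * dl yF \<le> 4 / 25" using dl_le[OF T yF] by (simp add: k_def)
    have k0: "0 < k" using T by (simp add: k_def)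
    have q: "?q \<le> 1 + b"
    proof -
      have "max 0 ((1 - 4/3 * n) - max 0 (1 - 4/3 * (1 - n))) \<le> 1" using n by auto
      then have "b * max 0 ((1 - 4/3 * n) - max 0 (1 - 4/3 * (1 - n))) \<le> b * 1"
        using b by (intro mult_left_mono) auto
      then show ?thesis using n by simp
    qed
    have S: "- (2 / T) * St y / Fh yF \<le> 2 / (3 * T) + k / y\<^sup>2"
    proof -
      have "- St y \<le> Fh yF / 3 * (1 + (1 + T) / y\<^sup>2)"
      proof -
        have "- St y \<le> - af y * (1 + (1 + T) / y\<^sup>2)" by (rule St_lower_left[OF y y1])
        also have "\<dots> \<le> Fh yF / 3 * (1 + (1 + T) / y\<^sup>2)"
          using t3 T by (intro mult_right_mono) (auto intro!: add_nonneg_nonneg)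
        finally show ?thesis .
      qed
      then have "2 / T * - St y / Fh yF \<le> 2 / T * (Fh yF / 3 * (1 + (1 + T) / y\<^sup>2)) / Fh yF"
        using T F by (intro divide_right_mono mult_left_mono) auto
      also have "\<dots> = 2 / (3 * T) + k / y\<^sup>2" using F T y by (simp add: k_def field_simps)
      finally show ?thesis by simp
    qed
    define z where "z = y powr (- 1 / 4)"
    have z4: "z ^ 4 = 1 / y" "z ^ 5 = y powr (- 5 / 4)" "z ^ 8 = 1 / y\<^sup>2"
    proof -
      have zk: "z ^ m = y powr (- (real m / 4))" for m
        using y powr_realpow[of z m] by (simp add: z_def powr_powr)
      show "z ^ 5 = y powr (- 5 / 4)" using zk[of 5] by simp
      show "z ^ 4 = 1 / y" using zk[of 4] y by (simp add: powr_minus_divide)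
      show "z ^ 8 = 1 / y\<^sup>2" using zk[of 8] y by (simp add: powr_minus_divide)
    qed
    have z1: "1 \<le> z" unfolding z_def using y y1 powr_mono'[of "-1/4" 0 y] by simp
    have "4 / 25 * (1 / y\<^sup>2 - 1) \<le> y powr (- 5 / 4) - 1"
      using power5_8_ineq[OF z1] z4 y10 y by (simp add: field_simps)
    moreover have "y powr (- 5 / 4) \<le> y powr (- T)"
      using y y1 T by (intro powr_mono') auto
    moreover have "k * dl yF * (1 / y\<^sup>2 - 1) \<le> 4 / 25 * (1 / y\<^sup>2 - 1)"
      using kd y y1 by (intro mult_right_mono) (auto simp: power_le_one)
    ultimately have A: "k * dl yF * (1 / y\<^sup>2 - 1) \<le> y powr (- T) - 1" by linarith
    have B: "3 * dl yF \<le> 1 - yF powr (- T)"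
      using tangent[OF T yF(1), of 1] by (simp add: zt_def)
    \<comment> \<open>The part proportional to 1/y^2 - 1 is absorbed in A. The remaining constants
      multiply \<open>dl yF\<close>, and B leaves room for a total of 3.\<close>
    have C: "1 + b + 2 / (3 * T) + k \<le> 3"
    proof -
      have "1 / T \<le> 4 / 5" using T by (simp add: field_simps)
      moreover have "b = (2 * (1 / T) - 1) / 4" "2 / (3 * T) = 2 / 3 * (1 / T)" "k = 2 / 3 * (1 / T) + 2 / 3"
        using T by (auto simp: b_def k_def field_simps)
      ultimately show ?thesis by simp
    qed
    have "dl yF * (1 + b + 2 / (3 * T) + k) \<le> dl yF * 3" using C d by (intro mult_left_mono) auto
    moreover have "dl yF * ?q \<le> dl yF * (1 + b)" using q d by (intro mult_left_mono) auto
    moreover have "dl yF * (- (2 / T) * St y / Fh yF) \<le> dl yF * (2 / (3 * T) + k / y\<^sup>2)"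
      using S d by (intro mult_left_mono) auto
    ultimately show ?thesis using A B by (simp add: algebra_simps)
  qed
qed

lemma dl_le_third: "5 / 4 \<le> T \<Longrightarrow> 1 < yF \<Longrightarrow> 3 * dl yF \<le> 1 - yF powr (- T)"
  using tangent[of yF 1] by (simp add: zt_def)

end

section \<open>Derivatives along a moving field\<close>

abbreviation strip :: "real \<Rightarrow> (real \<times> real) set" where
  "strip Tm \<equiv> {0..<Tm} \<times> UNIV"

abbreviation cont2 :: "real \<Rightarrow> (real \<Rightarrow> real \<Rightarrow> real) \<Rightarrow> bool" where
  "cont2 Tm f \<equiv> continuous_on (strip Tm) (\<lambda>p. f (fst p) (snd p))"

section \<open>Calculus of C^1 functions on a strip\<close>

lemma C1_with_cont:
  assumes "C1_with S f ft fx"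
  shows "continuous_on S (\<lambda>p. f (fst p) (snd p))"
    "continuous_on S (\<lambda>p. ft (fst p) (snd p))" "continuous_on S (\<lambda>p. fx (fst p) (snd p))"
proof -
  show "continuous_on S (\<lambda>p. f (fst p) (snd p))"
    by (rule has_derivative_continuous_on) (use assms in \<open>auto simp: C1_with_def\<close>)
qed (use assms in \<open>auto simp: C1_with_def\<close>)

lemma C1_with_dx:
  assumes C: "C1_with (strip Tm) f ft fx" and t: "0 \<le> t" "t < Tm"
  shows "((\<lambda>x. f t x) has_real_derivative fx t x) (at x)"
proof -
  have 1: "((\<lambda>q. f (fst q) (snd q)) has_derivative (\<lambda>d. ft t x * fst d + fx t x * snd d))
    (at (t, x) within (\<lambda>x. (t, x)) ` UNIV)"
    by (rule has_derivative_subset) (use assms in \<open>auto simp: C1_with_def\<close>)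
  have 2: "((\<lambda>x. (t, x)) has_derivative (\<lambda>d. (0, d))) (at x within UNIV)"
    by (auto intro!: derivative_eq_intros)
  have "((\<lambda>x. f t x) has_derivative (\<lambda>d. fx t x * d)) (at x)"
    using has_derivative_in_compose[OF 2 1] by simp
  then show ?thesis by (simp add: has_field_derivative_def)
qed

lemma C1_with_dt:
  assumes C: "C1_with (strip Tm) f ft fx" and t: "0 \<le> t" "t < Tm"
  shows "((\<lambda>t. f t x) has_real_derivative ft t x) (at t within {0..<Tm})"
proof -
  have 1: "((\<lambda>q. f (fst q) (snd q)) has_derivative (\<lambda>d. ft t x * fst d + fx t x * snd d))
    (at (t, x) within (\<lambda>t. (t, x)) ` {0..<Tm})"
    by (rule has_derivative_subset) (use assms in \<open>auto simp: C1_with_def\<close>)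
  have 2: "((\<lambda>t. (t, x)) has_derivative (\<lambda>d. (d, 0))) (at t within {0..<Tm})"
    by (auto intro!: derivative_eq_intros)
  have "((\<lambda>t. f t x) has_derivative (\<lambda>d. ft t x * d)) (at t within {0..<Tm})"
    using has_derivative_in_compose[OF 2 1] by simp
  then show ?thesis by (simp add: has_field_derivative_def)
qed

lemma C1_with_mult:
  assumes "C1_with S f ft fx" "C1_with S g gt gx"
  shows "C1_with S (\<lambda>t x. f t x * g t x) (\<lambda>t x. ft t x * g t x + f t x * gt t x)
    (\<lambda>t x. fx t x * g t x + f t x * gx t x)"
  unfolding C1_with_def
proof (intro conjI ballI)
  fix p assume p: "p \<in> S"
  have "((\<lambda>q. f (fst q) (snd q) * g (fst q) (snd q)) has_derivative
     (\<lambda>d. f (fst p) (snd p) * (gt (fst p) (snd p) * fst d + gx (fst p) (snd p) * snd d) +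
       (ft (fst p) (snd p) * fst d + fx (fst p) (snd p) * snd d) * g (fst p) (snd p))) (at p within S)"
    by (rule has_derivative_mult) (use assms p in \<open>auto simp: C1_with_def\<close>)
  then show "((\<lambda>q. f (fst q) (snd q) * g (fst q) (snd q)) has_derivative
     (\<lambda>d. (ft (fst p) (snd p) * g (fst p) (snd p) + f (fst p) (snd p) * gt (fst p) (snd p)) * fst d +
       (fx (fst p) (snd p) * g (fst p) (snd p) + f (fst p) (snd p) * gx (fst p) (snd p)) * snd d)) (at p within S)"
    by (rule has_derivative_eq_rhs) (auto simp: algebra_simps)
qed (auto intro!: continuous_intros C1_with_cont[OF assms(1)] C1_with_cont[OF assms(2)])

lemma C1_with_add:
  assumes "C1_with S f ft fx" "C1_with S g gt gx"
  shows "C1_with S (\<lambda>t x. f t x + g t x) (\<lambda>t x. ft t x + gt t x) (\<lambda>t x. fx t x + gx t x)"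
  unfolding C1_with_def
proof (intro conjI ballI)
  fix p assume p: "p \<in> S"
  have "((\<lambda>q. f (fst q) (snd q) + g (fst q) (snd q)) has_derivative
     (\<lambda>d. (ft (fst p) (snd p) * fst d + fx (fst p) (snd p) * snd d) +
       (gt (fst p) (snd p) * fst d + gx (fst p) (snd p) * snd d))) (at p within S)"
    by (rule has_derivative_add) (use assms p in \<open>auto simp: C1_with_def\<close>)
  then show "((\<lambda>q. f (fst q) (snd q) + g (fst q) (snd q)) has_derivative
     (\<lambda>d. (ft (fst p) (snd p) + gt (fst p) (snd p)) * fst d +
       (fx (fst p) (snd p) + gx (fst p) (snd p)) * snd d)) (at p within S)"
    by (rule has_derivative_eq_rhs) (auto simp: algebra_simps)
qed (auto intro!: continuous_intros C1_with_cont[OF assms(1)] C1_with_cont[OF assms(2)])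

lemma C1_with_compose:
  assumes f: "C1_with S f ft fx"
    and g: "\<And>z. z \<in> D \<Longrightarrow> (g has_real_derivative g' z) (at z)" and g': "continuous_on D g'"
    and D: "\<And>p. p \<in> S \<Longrightarrow> f (fst p) (snd p) \<in> D"
  shows "C1_with S (\<lambda>t x. g (f t x)) (\<lambda>t x. g' (f t x) * ft t x) (\<lambda>t x. g' (f t x) * fx t x)"
  unfolding C1_with_def
proof (intro conjI ballI)
  have c: "continuous_on S (\<lambda>p. g' (f (fst p) (snd p)))"
    by (rule continuous_on_compose2[OF g' C1_with_cont(1)[OF f]]) (use D in auto)
  then show "continuous_on S (\<lambda>p. g' (f (fst p) (snd p)) * ft (fst p) (snd p))"
    "continuous_on S (\<lambda>p. g' (f (fst p) (snd p)) * fx (fst p) (snd p))"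
    by (auto intro!: continuous_intros C1_with_cont[OF f])
  fix p assume p: "p \<in> S"
  have "((\<lambda>q. f (fst q) (snd q)) has_derivative
     (\<lambda>d. ft (fst p) (snd p) * fst d + fx (fst p) (snd p) * snd d)) (at p within S)"
    using f p by (auto simp: C1_with_def)
  moreover have "(g has_derivative (\<lambda>z. g' (f (fst p) (snd p)) * z)) (at (f (fst p) (snd p)))"
    using g[OF D[OF p]] by (simp add: has_field_derivative_def)
  ultimately have "((\<lambda>q. g (f (fst q) (snd q))) has_derivative
     (\<lambda>d. g' (f (fst p) (snd p)) * (ft (fst p) (snd p) * fst d + fx (fst p) (snd p) * snd d))) (at p within S)"
    by (rule has_derivative_compose)
  then show "((\<lambda>q. g (f (fst q) (snd q))) has_derivative
     (\<lambda>d. g' (f (fst p) (snd p)) * ft (fst p) (snd p) * fst d + g' (f (fst p) (snd p)) * fx (fst p) (snd p) * snd d)) (at p within S)"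
    by (rule has_derivative_eq_rhs) (auto simp: algebra_simps)
qed

lemma C1_with_const: "C1_with S (\<lambda>t x. k) (\<lambda>t x. 0) (\<lambda>t x. 0)"
  by (auto simp: C1_with_def intro!: derivative_eq_intros)

lemma C1_with_cmult:
  "C1_with S f ft fx \<Longrightarrow> C1_with S (\<lambda>t x. k * f t x) (\<lambda>t x. k * ft t x) (\<lambda>t x. k * fx t x)"
  using C1_with_mult[OF C1_with_const[of S k]] by simp

lemma C1_with_time: "C1_with S (\<lambda>t x. t) (\<lambda>t x. 1) (\<lambda>t x. 0)"
  by (auto simp: C1_with_def intro!: derivative_eq_intros)

lemma C1_with_shift:
  assumes "C1_with (strip Tm) f ft fx"
  shows "C1_with (strip Tm) (\<lambda>t x. f t (x + b)) (\<lambda>t x. ft t (x + b)) (\<lambda>t x. fx t (x + b))"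
proof -
  have s: "continuous_on (strip Tm) (\<lambda>p. (fst p, snd p + b))" by (intro continuous_intros)
  have c: "continuous_on (strip Tm) (\<lambda>p. g (fst p) (snd p + b))" if "cont2 Tm g" for g
    using continuous_on_compose2[OF that s] by (simp add: image_subset_iff)
  show ?thesis unfolding C1_with_def
  proof (intro conjI ballI c C1_with_cont[OF assms])
    fix p assume p: "p \<in> strip Tm"
    let ?s = "\<lambda>p. (fst p, snd p + b) :: real \<times> real"
    have 1: "((\<lambda>q. f (fst q) (snd q)) has_derivative
       (\<lambda>d. ft (fst p) (snd p + b) * fst d + fx (fst p) (snd p + b) * snd d)) (at (?s p) within ?s ` strip Tm)"
      by (rule has_derivative_subset[where s="strip Tm"]) (use assms p in \<open>auto simp: C1_with_def\<close>)
    have 2: "(?s has_derivative (\<lambda>d. d)) (at p within strip Tm)"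
      by (auto intro!: derivative_eq_intros)
    show "((\<lambda>q. f (fst q) (snd q + b)) has_derivative
       (\<lambda>d. ft (fst p) (snd p + b) * fst d + fx (fst p) (snd p + b) * snd d)) (at p within strip Tm)"
      using has_derivative_in_compose[OF 2 1] by simp
  qed
qed

lemma cont2_bounded:
  assumes "cont2 Tm f" "t1 < Tm"
  shows "\<exists>M>0. \<forall>t\<in>{0..t1}. \<forall>x\<in>{-L..L}. \<bar>f t x\<bar> \<le> M"
proof -
  have "compact ((\<lambda>p. f (fst p) (snd p)) ` ({0..t1} \<times> {-L..L}))"
    by (intro compact_continuous_image continuous_on_subset[OF assms(1)] compact_Times) (use assms in auto)
  then obtain M where M: "M > 0" "\<forall>z\<in>(\<lambda>p. f (fst p) (snd p)) ` ({0..t1} \<times> {-L..L}). \<bar>z\<bar> \<le> M"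
    using compact_imp_bounded bounded_pos by (metis real_norm_def)
  then show ?thesis by (intro exI[of _ M]) force
qed

text \<open>\<open>tder Tm c Y F\<close>: \<open>Y\<close> has derivative \<open>F\<close> along the field \<open>\<partial>\<^sub>t + c \<partial>\<^sub>x\<close>, in the sense of locally
  uniform approximation by \<open>C\<^sup>1\<close> functions.  This applies to the merely continuous functions \<open>Z\<^sub>j\<close>
  and avoids characteristic curves.\<close>
definition tder :: "real \<Rightarrow> (real \<Rightarrow> real \<Rightarrow> real) \<Rightarrow> (real \<Rightarrow> real \<Rightarrow> real) \<Rightarrow> (real \<Rightarrow> real \<Rightarrow> real) \<Rightarrow> bool" where
  "tder Tm c Y F \<longleftrightarrow> (\<forall>t1 L e. t1 < Tm \<longrightarrow> 0 < e \<longrightarrow> (\<exists>W Wt Wx. C1_with (strip Tm) W Wt Wx \<and>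
     (\<forall>t\<in>{0..t1}. \<forall>x\<in>{-L..L}. \<bar>W t x - Y t x\<bar> < e \<and> \<bar>Wt t x + c t x * Wx t x - F t x\<bar> < e)))"

lemma tder_add_C1:
  assumes Y: "tder Tm c Y F" and A: "C1_with (strip Tm) A At Ax"
  shows "tder Tm c (\<lambda>t x. Y t x + A t x) (\<lambda>t x. F t x + (At t x + c t x * Ax t x))"
  unfolding tder_def
proof (intro allI impI)
  fix t1 L e :: real assume "t1 < Tm" "0 < e"
  then obtain W Wt Wx where W: "C1_with (strip Tm) W Wt Wx"
    "\<forall>t\<in>{0..t1}. \<forall>x\<in>{-L..L}. \<bar>W t x - Y t x\<bar> < e \<and> \<bar>Wt t x + c t x * Wx t x - F t x\<bar> < e"
    using Y unfolding tder_def by blast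
  show "\<exists>W Wt Wx. C1_with (strip Tm) W Wt Wx \<and>
     (\<forall>t\<in>{0..t1}. \<forall>x\<in>{-L..L}. \<bar>W t x - (Y t x + A t x)\<bar> < e \<and>
        \<bar>Wt t x + c t x * Wx t x - (F t x + (At t x + c t x * Ax t x))\<bar> < e)"
    by (rule exI, rule exI, rule exI, rule conjI[OF C1_with_add[OF W(1) A]])
      (use W(2) in \<open>simp add: algebra_simps\<close>)
qed

lemma tder_mult_C1:
  assumes Y: "tder Tm c Y F" and A: "C1_with (strip Tm) A At Ax" and c: "cont2 Tm c"
  shows "tder Tm c (\<lambda>t x. A t x * Y t x) (\<lambda>t x. A t x * F t x + (At t x + c t x * Ax t x) * Y t x)"
  unfolding tder_def
proof (intro allI impI)
  fix t1 L e :: real assume t1: "t1 < Tm" and e: "0 < e"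
  obtain M where M: "0 < M" "\<forall>t\<in>{0..t1}. \<forall>x\<in>{-L..L}. \<bar>A t x\<bar> \<le> M"
    using cont2_bounded[OF C1_with_cont(1)[OF A] t1] by blast
  have "cont2 Tm (\<lambda>t x. At t x + c t x * Ax t x)"
    by (intro continuous_intros C1_with_cont[OF A] c)
  from cont2_bounded[OF this t1] obtain K where
    K: "0 < K" "\<forall>t\<in>{0..t1}. \<forall>x\<in>{-L..L}. \<bar>At t x + c t x * Ax t x\<bar> \<le> K" by blast
  define d where "d = e / (M + K)"
  have d: "0 < d" using e M K by (simp add: d_def)
  obtain W Wt Wx where W: "C1_with (strip Tm) W Wt Wx"
    "\<forall>t\<in>{0..t1}. \<forall>x\<in>{-L..L}. \<bar>W t x - Y t x\<bar> < d \<and> \<bar>Wt t x + c t x * Wx t x - F t x\<bar> < d"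
    using Y t1 d unfolding tder_def by blast
  show "\<exists>W Wt Wx. C1_with (strip Tm) W Wt Wx \<and>
     (\<forall>t\<in>{0..t1}. \<forall>x\<in>{-L..L}. \<bar>W t x - A t x * Y t x\<bar> < e \<and>
        \<bar>Wt t x + c t x * Wx t x - (A t x * F t x + (At t x + c t x * Ax t x) * Y t x)\<bar> < e)"
  proof (rule exI, rule exI, rule exI, rule conjI[OF C1_with_mult[OF A W(1)]], intro ballI)
    fix t x assume tx: "t \<in> {0..t1}" "x \<in> {-L..L}"
    let ?D = "At t x + c t x * Ax t x"
    have "(M + K) * d = e" using M K by (simp add: d_def)
    then have MK: "M * d + K * d = e" by (simp only: distrib_right)
    have 1: "\<bar>W t x - Y t x\<bar> < d" "\<bar>Wt t x + c t x * Wx t x - F t x\<bar> < d" using W tx by auto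
    have 2: "\<bar>A t x\<bar> * \<bar>W t x - Y t x\<bar> \<le> M * \<bar>W t x - Y t x\<bar>" using M tx by (intro mult_right_mono) auto
    have 3: "\<bar>A t x\<bar> * \<bar>Wt t x + c t x * Wx t x - F t x\<bar> \<le> M * \<bar>Wt t x + c t x * Wx t x - F t x\<bar>"
      using M tx by (intro mult_right_mono) auto
    have 4: "\<bar>?D\<bar> * \<bar>W t x - Y t x\<bar> \<le> K * \<bar>W t x - Y t x\<bar>" using K tx by (intro mult_right_mono) auto
    have 5: "M * \<bar>W t x - Y t x\<bar> < M * d" "K * \<bar>W t x - Y t x\<bar> < K * d"
      "M * \<bar>Wt t x + c t x * Wx t x - F t x\<bar> < M * d" using 1 M K by (auto intro!: mult_strict_left_mono)
    have "0 < K * d" using K d by simp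
    have "\<bar>A t x * W t x - A t x * Y t x\<bar> = \<bar>A t x\<bar> * \<bar>W t x - Y t x\<bar>"
      by (simp add: right_diff_distrib flip: abs_mult)
    then have "\<bar>A t x * W t x - A t x * Y t x\<bar> < e" using 2 5 MK \<open>0 < K * d\<close> by linarith
    moreover have "At t x * W t x + A t x * Wt t x + c t x * (Ax t x * W t x + A t x * Wx t x) - (A t x * F t x + ?D * Y t x)
       = A t x * (Wt t x + c t x * Wx t x - F t x) + ?D * (W t x - Y t x)"
      by (simp add: algebra_simps)
    moreover have "\<bar>A t x * (Wt t x + c t x * Wx t x - F t x) + ?D * (W t x - Y t x)\<bar>
       \<le> \<bar>A t x\<bar> * \<bar>Wt t x + c t x * Wx t x - F t x\<bar> + \<bar>?D\<bar> * \<bar>W t x - Y t x\<bar>"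
      by (metis abs_mult abs_triangle_ineq)
    ultimately show "\<bar>A t x * W t x - A t x * Y t x\<bar> < e \<and>
      \<bar>At t x * W t x + A t x * Wt t x + c t x * (Ax t x * W t x + A t x * Wx t x) - (A t x * F t x + ?D * Y t x)\<bar> < e"
      using 3 4 5 MK by linarith
  qed
qed

lemma tder_cong:
  assumes "tder Tm c Y F" "\<And>t x. 0 \<le> t \<Longrightarrow> t < Tm \<Longrightarrow> F t x = F' t x"
    "\<And>t x. 0 \<le> t \<Longrightarrow> t < Tm \<Longrightarrow> Y t x = Y' t x"
  shows "tder Tm c Y' F'"
  unfolding tder_def
proof (intro allI impI)
  fix t1 L e :: real assume t1: "t1 < Tm" and e: "0 < e"
  obtain W Wt Wx where W: "C1_with (strip Tm) W Wt Wx"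
    "\<forall>t\<in>{0..t1}. \<forall>x\<in>{-L..L}. \<bar>W t x - Y t x\<bar> < e \<and> \<bar>Wt t x + c t x * Wx t x - F t x\<bar> < e"
    using assms(1) t1 e unfolding tder_def by blast
  then show "\<exists>W Wt Wx. C1_with (strip Tm) W Wt Wx \<and>
     (\<forall>t\<in>{0..t1}. \<forall>x\<in>{-L..L}. \<bar>W t x - Y' t x\<bar> < e \<and> \<bar>Wt t x + c t x * Wx t x - F' t x\<bar> < e)"
    using assms(2,3) t1 by (intro exI[of _ W] exI[of _ Wt] exI[of _ Wx]) auto
qed

lemma difference_quotient_uniform:
  assumes C: "C1_with (strip Tm) f ft fx" and t1: "t1 < Tm" and e: "0 < e"
  shows "\<exists>d>0. \<forall>b. 0 < b \<longrightarrow> b < d \<longrightarrow> (\<forall>t\<in>{0..t1}. \<forall>x\<in>{-L..L}.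
     \<bar>(f t (x + b) - f t x) / b - fx t x\<bar> < e \<and> \<bar>fx t (x + b) - fx t x\<bar> < e)"
proof -
  let ?K = "{0..t1} \<times> {-(L+1)..L+1}"
  have "uniformly_continuous_on ?K (\<lambda>p. fx (fst p) (snd p))"
    by (intro compact_uniformly_continuous continuous_on_subset[OF C1_with_cont(3)[OF C]] compact_Times)
      (use t1 in auto)
  then obtain d where d: "0 < d" "\<And>p q. p \<in> ?K \<Longrightarrow> q \<in> ?K \<Longrightarrow> dist q p < d \<Longrightarrow>
      dist (fx (fst q) (snd q)) (fx (fst p) (snd p)) < e"
    unfolding uniformly_continuous_on_def using e by metis
  have main: "\<bar>fx t (x + s) - fx t x\<bar> < e" if "0 \<le> s" "s < min d 1" "t \<in> {0..t1}" "x \<in> {-L..L}" for s t x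
    using d(2)[of "(t, x)" "(t, x + s)"] that by (auto simp: dist_Pair_Pair dist_real_def)
  show ?thesis
  proof (intro exI[of _ "min d 1"] conjI allI impI ballI)
    fix b t x assume b: "0 < b" "b < min d 1" and tx: "t \<in> {0..t1}" "x \<in> {-L..L}"
    show "\<bar>fx t (x + b) - fx t x\<bar> < e" using main b tx by simp
    have "\<exists>z. x < z \<and> z < x + b \<and> f t (x + b) - f t x = (x + b - x) * fx t z"
      by (rule MVT2) (use b tx t1 C1_with_dx[OF C] in auto)
    then obtain z where z: "x < z" "z < x + b" "f t (x + b) - f t x = b * fx t z" by auto
    then have "(f t (x + b) - f t x) / b = fx t (x + (z - x))" using b by simp
    then show "\<bar>(f t (x + b) - f t x) / b - fx t x\<bar> < e" using main[of "z - x" t x] z b tx by simp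
  qed (use d in auto)
qed

text \<open>The functions have only one derivative, so the equation cannot be differentiated in x.
  Difference quotients in x are C^1, and both they and their derivatives along the field converge
  locally uniformly.\<close>

lemma tder_space_derivative:
  assumes r: "C1_with (strip Tm) r rt rx" and v: "C1_with (strip Tm) v vt vx"
    and c: "C1_with (strip Tm) c ct cx"
    and eq: "\<And>t x. 0 \<le> t \<Longrightarrow> t < Tm \<Longrightarrow> rt t x + c t x * rx t x = v t x"
  shows "tder Tm c rx (\<lambda>t x. vx t x - cx t x * rx t x)"
  unfolding tder_def
proof (intro allI impI)
  fix t1 L e :: real assume t1: "t1 < Tm" and e: "0 < e"
  obtain M where M: "0 < M" "\<forall>t\<in>{0..t1}. \<forall>x\<in>{-L..L}. \<bar>rx t x\<bar> \<le> M"
    using cont2_bounded[OF C1_with_cont(3)[OF r] t1] by blast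
  obtain K where K: "0 < K" "\<forall>t\<in>{0..t1}. \<forall>x\<in>{-L..L}. \<bar>cx t x\<bar> \<le> K"
    using cont2_bounded[OF C1_with_cont(3)[OF c] t1] by blast
  define d where "d = min 1 (e / (M + K + 3))"
  have d: "0 < d" "d \<le> 1" using e M K by (auto simp: d_def)
  have "d \<le> e / (M + K + 3)" by (simp add: d_def)
  then have d3': "(M + K + 3) * d \<le> e" using M K by (simp add: pos_le_divide_eq mult.commute)
  obtain d1 where d1: "0 < d1" "\<And>b t x. 0 < b \<Longrightarrow> b < d1 \<Longrightarrow> t \<in> {0..t1} \<Longrightarrow> x \<in> {-L..L} \<Longrightarrow>
     \<bar>(r t (x + b) - r t x) / b - rx t x\<bar> < d \<and> \<bar>rx t (x + b) - rx t x\<bar> < d"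
    using difference_quotient_uniform[OF r t1 d(1), of L] by blast
  obtain d2 where d2: "0 < d2" "\<And>b t x. 0 < b \<Longrightarrow> b < d2 \<Longrightarrow> t \<in> {0..t1} \<Longrightarrow> x \<in> {-L..L} \<Longrightarrow>
     \<bar>(v t (x + b) - v t x) / b - vx t x\<bar> < d \<and> \<bar>vx t (x + b) - vx t x\<bar> < d"
    using difference_quotient_uniform[OF v t1 d(1), of L] by blast
  obtain d3 where d3: "0 < d3" "\<And>b t x. 0 < b \<Longrightarrow> b < d3 \<Longrightarrow> t \<in> {0..t1} \<Longrightarrow> x \<in> {-L..L} \<Longrightarrow>
     \<bar>(c t (x + b) - c t x) / b - cx t x\<bar> < d \<and> \<bar>cx t (x + b) - cx t x\<bar> < d"
    using difference_quotient_uniform[OF c t1 d(1), of L] by blast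
  define b where "b = min d1 (min d2 d3) / 2"
  have b: "0 < b" "b < d1" "b < d2" "b < d3" using d1 d2 d3 by (auto simp: b_def min_def)
  have C: "C1_with (strip Tm) (\<lambda>t x. 1 / b * (r t (x + b) + - 1 * r t x))
     (\<lambda>t x. 1 / b * (rt t (x + b) + - 1 * rt t x)) (\<lambda>t x. 1 / b * (rx t (x + b) + - 1 * rx t x))"
    by (intro C1_with_cmult C1_with_add C1_with_shift r)
  show "\<exists>W Wt Wx. C1_with (strip Tm) W Wt Wx \<and>
     (\<forall>t\<in>{0..t1}. \<forall>x\<in>{-L..L}. \<bar>W t x - rx t x\<bar> < e \<and>
       \<bar>Wt t x + c t x * Wx t x - (vx t x - cx t x * rx t x)\<bar> < e)"
  proof (rule exI, rule exI, rule exI, rule conjI[OF C], intro ballI)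
    fix t x assume tx: "t \<in> {0..t1}" "x \<in> {-L..L}"
    define C where "C = (c t (x + b) - c t x) / b"
    define V where "V = (v t (x + b) - v t x) / b"
    define R where "R = rx t (x + b)"
    have e1: "rt t (x + b) = v t (x + b) - c t (x + b) * R" "rt t x = v t x - c t x * rx t x"
      using eq[of t "x + b"] eq[of t x] tx t1 by (auto simp: R_def)
    have "1 / b * (rt t (x + b) + - 1 * rt t x) + c t x * (1 / b * (rx t (x + b) + - 1 * rx t x)) = V - C * R"
      unfolding e1 using b by (simp add: V_def C_def R_def field_simps)
    moreover have "V - C * R - (vx t x - cx t x * rx t x)
       = (V - vx t x) - (C - cx t x) * R - cx t x * (R - rx t x)" by (simp add: algebra_simps)
    moreover have "\<bar>(C - cx t x) * R\<bar> \<le> d * (M + 1)"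
    proof -
      have "\<bar>R\<bar> \<le> M + 1" using M d1(2)[OF b(1,2) tx] tx d by (force simp: R_def)
      moreover have "\<bar>C - cx t x\<bar> \<le> d" using d3(2)[OF b(1,4) tx] by (simp add: C_def)
      ultimately show ?thesis unfolding abs_mult using d by (intro mult_mono) auto
    qed
    moreover have "\<bar>cx t x * (R - rx t x)\<bar> \<le> K * d"
      unfolding abs_mult using K tx d1(2)[OF b(1,2) tx] by (intro mult_mono) (auto simp: R_def)
    moreover have "\<bar>V - vx t x\<bar> < d" using d2(2)[OF b(1,3) tx] by (simp add: V_def)
    moreover have "d + d * (M + 1) + K * d < e"
      using d d3' by (simp add: algebra_simps)
    moreover have "d < e"
    proof -
      have "1 * d < (M + K + 3) * d" using d M K by (intro mult_strict_right_mono) auto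
      then show ?thesis using d3' by simp
    qed
    moreover have "\<bar>1 / b * (r t (x + b) + - 1 * r t x) - rx t x\<bar> < d" using d1(2)[OF b(1,2) tx] by simp
    ultimately show "\<bar>1 / b * (r t (x + b) + - 1 * r t x) - rx t x\<bar> < e \<and>
       \<bar>1 / b * (rt t (x + b) + - 1 * rt t x) + c t x * (1 / b * (rx t (x + b) + - 1 * rx t x)) -
         (vx t x - cx t x * rx t x)\<bar> < e"
      by linarith
  qed
qed

text \<open>The penalty A (x - x0)^2 + \<epsilon>/4 t is so small that W plus penalty still
  decreases along the field. Its minimum over the box therefore lies on a lateral side or at the
  final time, where the penalty itself is the gain. The constant A lets the drift of the quadratic
  term cost at most \<epsilon>/2.\<close>

lemma local_descent:
  fixes W Wt Wx c :: "real \<Rightarrow> real \<Rightarrow> real"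
  assumes pos: "0 < \<delta>" "0 < \<rho>" "0 < C" "0 < \<epsilon>"
    and cont: "continuous_on ({0..\<delta>} \<times> {x0-\<rho>..x0+\<rho>}) (\<lambda>p. W (fst p) (snd p))"
    and dx: "\<And>t x. 0 \<le> t \<Longrightarrow> t < \<delta> \<Longrightarrow> \<bar>x - x0\<bar> < \<rho> \<Longrightarrow> ((\<lambda>x. W t x) has_real_derivative Wx t x) (at x)"
    and dt: "\<And>t x. 0 \<le> t \<Longrightarrow> t < \<delta> \<Longrightarrow> \<bar>x - x0\<bar> < \<rho> \<Longrightarrow> ((\<lambda>t. W t x) has_real_derivative Wt t x) (at t within {t..\<delta>})"
    and le: "\<And>t x. 0 \<le> t \<Longrightarrow> t < \<delta> \<Longrightarrow> \<bar>x - x0\<bar> < \<rho> \<Longrightarrow> Wt t x + c t x * Wx t x \<le> - \<epsilon>"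
    and C: "\<And>t x. 0 \<le> t \<Longrightarrow> t < \<delta> \<Longrightarrow> \<bar>x - x0\<bar> < \<rho> \<Longrightarrow> \<bar>c t x\<bar> \<le> C"
  shows "\<exists>t\<in>{0..\<delta>}. \<exists>x\<in>{x0-\<rho>..x0+\<rho>}. W t x \<le> W 0 x0 - min (\<epsilon> / 4 * \<delta>) (\<epsilon> / (4 * C) * \<rho>)"
proof -
  define A where "A = \<epsilon> / (4 * C * \<rho>)"
  have A: "0 < A" "2 * A * \<rho> * C = \<epsilon> / 2" "A * \<rho>\<^sup>2 = \<epsilon> / (4 * C) * \<rho>"
    using pos by (auto simp: A_def power2_eq_square)
  let ?\<psi> = "\<lambda>t x. W t x + A * (x - x0)\<^sup>2 + \<epsilon> / 4 * t"
  have "\<exists>p\<in>{0..\<delta>} \<times> {x0-\<rho>..x0+\<rho>}. \<forall>q\<in>{0..\<delta>} \<times> {x0-\<rho>..x0+\<rho>}. ?\<psi> (fst p) (snd p) \<le> ?\<psi> (fst q) (snd q)"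
    by (rule continuous_attains_inf) (use pos in \<open>auto intro!: compact_Times continuous_intros cont\<close>)
  then obtain t x where tx: "t \<in> {0..\<delta>}" "x \<in> {x0-\<rho>..x0+\<rho>}"
    and min: "\<And>t' x'. t' \<in> {0..\<delta>} \<Longrightarrow> x' \<in> {x0-\<rho>..x0+\<rho>} \<Longrightarrow> ?\<psi> t x \<le> ?\<psi> t' x'"
    by (metis (no_types, lifting) SigmaE SigmaI fst_conv snd_conv)
  have base: "?\<psi> t x \<le> W 0 x0" using min[of 0 x0] pos by simp
  have nn: "0 \<le> A * (x - x0)\<^sup>2" "0 \<le> \<epsilon> / 4 * t" using A pos tx by auto
  have mc: "min (\<epsilon> / 4 * \<delta>) (\<epsilon> / (4 * C) * \<rho>) \<le> \<epsilon> / 4 * \<delta>"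
    "min (\<epsilon> / 4 * \<delta>) (\<epsilon> / (4 * C) * \<rho>) \<le> \<epsilon> / (4 * C) * \<rho>" by simp_all
  have "W t x \<le> W 0 x0 - min (\<epsilon> / 4 * \<delta>) (\<epsilon> / (4 * C) * \<rho>)"
  proof (cases "t = \<delta> \<or> \<bar>x - x0\<bar> = \<rho>")
    case True
    then show ?thesis
    proof
      assume "t = \<delta>"
      then have "\<epsilon> / 4 * t = \<epsilon> / 4 * \<delta>" by simp
      then show ?thesis using base nn mc by linarith
    next
      assume "\<bar>x - x0\<bar> = \<rho>"
      then have "A * (x - x0)\<^sup>2 = \<epsilon> / (4 * C) * \<rho>" using A(3) by (metis power2_abs)
      then show ?thesis using base nn mc by linarith
    qed
  next
    case False
    then have i: "0 \<le> t" "t < \<delta>" "\<bar>x - x0\<bar> < \<rho>" using tx by auto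
    have "((\<lambda>x. ?\<psi> t x) has_real_derivative Wx t x + A * (2 * (x - x0))) (at x)"
      using dx[OF i] by (auto intro!: derivative_eq_intros)
    moreover have "\<forall>x'. \<bar>x - x'\<bar> < \<rho> - \<bar>x - x0\<bar> \<longrightarrow> ?\<psi> t x \<le> ?\<psi> t x'"
      using tx(1) by (intro allI impI min) (auto simp: abs_if split: if_splits)
    ultimately have "Wx t x + A * (2 * (x - x0)) = 0"
      using i by (intro DERIV_local_min[of "\<lambda>x. ?\<psi> t x" _ x "\<rho> - \<bar>x - x0\<bar>"]) auto
    then have wx: "Wx t x = - (2 * A * (x - x0))" by (simp add: algebra_simps)
    have d: "((\<lambda>t. ?\<psi> t x) has_real_derivative Wt t x + \<epsilon> / 4) (at t within {t..\<delta>})"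
      using dt[OF i] by (auto intro!: derivative_eq_intros)
    \<comment> \<open>Only the forward time derivative is used, so a minimum at t = 0 is excluded as
      well.\<close>
    have wt: "0 \<le> Wt t x + \<epsilon> / 4"
    proof (rule ccontr)
      assume "\<not> 0 \<le> Wt t x + \<epsilon> / 4"
      then obtain k where k: "0 < k" "\<And>s. 0 < s \<Longrightarrow> t + s \<in> {t..\<delta>} \<Longrightarrow> s < k \<Longrightarrow> ?\<psi> (t + s) x < ?\<psi> t x"
        using has_real_derivative_neg_dec_right[OF d] by force
      define s where "s = min k (\<delta> - t) / 2"
      have "0 < s" "s < k" "t + s \<in> {t..\<delta>}" using k i by (auto simp: s_def min_def field_simps)
      then have "?\<psi> (t + s) x < ?\<psi> t x" using k by blast
      moreover have "t + s \<in> {0..\<delta>}" using \<open>t + s \<in> {t..\<delta>}\<close> i by auto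
      ultimately show False using min[of "t + s" x] tx by force
    qed
    have "c t x * Wx t x \<ge> - (2 * A * \<rho> * C)"
    proof -
      have "\<bar>c t x * Wx t x\<bar> \<le> C * (2 * A * \<rho>)"
        unfolding abs_mult wx using C[OF i] A(1) i pos by (intro mult_mono) (auto simp: abs_mult)
      then show ?thesis by (simp add: mult_ac abs_le_iff)
    qed
    then show ?thesis using le[OF i] wt A(2) pos(4) by linarith
  qed
  then show ?thesis using tx by blast
qed

lemma neighbourhood_box:
  assumes c: "cont2 Tm c" and F: "cont2 Tm F" and t0: "0 \<le> t0" "t0 < Tm" and neg: "F t0 x0 < 0" and r: "0 < r"
  shows "\<exists>\<rho> C. 0 < \<rho> \<and> 0 < C \<and> \<rho> < r \<and> t0 + \<rho> < Tm \<and>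
    (\<forall>t\<in>{0..<Tm}. \<forall>x. \<bar>t - t0\<bar> \<le> \<rho> \<longrightarrow> \<bar>x - x0\<bar> \<le> \<rho> \<longrightarrow> F t x \<le> F t0 x0 / 2 \<and> \<bar>c t x\<bar> \<le> C)"
proof -
  have p: "(t0, x0) \<in> strip Tm" using t0 by auto
  obtain d1 where d1: "0 < d1" "\<And>q. q \<in> strip Tm \<Longrightarrow> dist q (t0, x0) < d1 \<Longrightarrow>
      dist (F (fst q) (snd q)) (F t0 x0) < - F t0 x0 / 2"
    using F p neg unfolding continuous_on_iff by (metis divide_pos_pos fst_conv neg_0_less_iff_less snd_conv zero_less_numeral)
  obtain d2 where d2: "0 < d2" "\<And>q. q \<in> strip Tm \<Longrightarrow> dist q (t0, x0) < d2 \<Longrightarrow>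
      dist (c (fst q) (snd q)) (c t0 x0) < 1"
    using c p unfolding continuous_on_iff by (metis fst_conv snd_conv zero_less_one)
  define \<rho> where "\<rho> = min (min d1 d2 / 3) (min r (Tm - t0) / 2)"
  have \<rho>: "0 < \<rho>" "3 * \<rho> \<le> d1" "3 * \<rho> \<le> d2" "\<rho> < r" "t0 + \<rho> < Tm" using d1 d2 r t0 by (auto simp: \<rho>_def min_def field_simps)
  have "F t x \<le> F t0 x0 / 2 \<and> \<bar>c t x\<bar> \<le> \<bar>c t0 x0\<bar> + 1"
    if "t \<in> {0..<Tm}" "\<bar>t - t0\<bar> \<le> \<rho>" "\<bar>x - x0\<bar> \<le> \<rho>" for t x
  proof -
    have "dist (t, x) (t0, x0) \<le> \<bar>t - t0\<bar> + \<bar>x - x0\<bar>"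
      unfolding dist_Pair_Pair dist_real_def by (rule order_trans[OF sqrt_sum_squares_le_sum_abs]) simp
    then have "dist (t, x) (t0, x0) < 3 * \<rho>" using that \<rho>(1) by linarith
    then show ?thesis using d1(2)[of "(t, x)"] d2(2)[of "(t, x)"] that \<rho> by (auto simp: dist_real_def)
  qed
  then show ?thesis using \<rho> by (intro exI[of _ \<rho>] exI[of _ "\<bar>c t0 x0\<bar> + 1"]) auto
qed

text \<open>The gain \<kappa> of \<open>local_descent\<close> is fixed before the C^1 approximation
  W is chosen within \<kappa>/3 of Y. The smaller value occurs strictly later because (t0, x0) is
  already a spatial minimum.\<close>

lemma tder_descent:
  assumes Y: "tder Tm c Y F" and c: "cont2 Tm c" and F: "cont2 Tm F"
    and t0: "0 \<le> t0" "t0 < Tm" and min: "\<And>x. Y t0 x0 \<le> Y t0 x" and neg: "F t0 x0 < 0" and r: "0 < r"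
  shows "\<exists>t x. t0 < t \<and> t < t0 + r \<and> t < Tm \<and> Y t x < Y t0 x0"
proof -
  obtain \<rho> C where \<rho>: "0 < \<rho>" "0 < C" "\<rho> < r" "t0 + \<rho> < Tm"
    and box: "\<And>t x. t \<in> {0..<Tm} \<Longrightarrow> \<bar>t - t0\<bar> \<le> \<rho> \<Longrightarrow> \<bar>x - x0\<bar> \<le> \<rho> \<Longrightarrow> F t x \<le> F t0 x0 / 2 \<and> \<bar>c t x\<bar> \<le> C"
    using neighbourhood_box[OF c F t0 neg r] by blast
  define \<epsilon> where "\<epsilon> = - F t0 x0 / 4"
  define \<kappa> where "\<kappa> = min (\<epsilon> / 4 * \<rho>) (\<epsilon> / (4 * C) * \<rho>)"
  have e: "0 < \<epsilon>" using neg by (simp add: \<epsilon>_def)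
  then have k: "0 < \<kappa>" using \<rho> by (simp add: \<kappa>_def)
  then have ek: "0 < min \<epsilon> (\<kappa> / 3)" using e by simp
  obtain W Wt Wx where W: "C1_with (strip Tm) W Wt Wx"
    and W2: "\<forall>t\<in>{0..t0 + \<rho>}. \<forall>x\<in>{-(\<bar>x0\<bar> + \<rho>)..\<bar>x0\<bar> + \<rho>}. \<bar>W t x - Y t x\<bar> < min \<epsilon> (\<kappa> / 3) \<and> \<bar>Wt t x + c t x * Wx t x - F t x\<bar> < min \<epsilon> (\<kappa> / 3)"
    using Y[unfolded tder_def, rule_format, OF \<rho>(4) ek, of "\<bar>x0\<bar> + \<rho>"] by blast
  have near: "\<bar>W t x - Y t x\<bar> < \<kappa> / 3" "\<bar>Wt t x + c t x * Wx t x - F t x\<bar> < \<epsilon>"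
    if "t \<in> {0..t0+\<rho>}" "\<bar>x - x0\<bar> \<le> \<rho>" for t x
  proof -
    have "x \<in> {-(\<bar>x0\<bar> + \<rho>)..\<bar>x0\<bar> + \<rho>}" using that by auto
    then show "\<bar>W t x - Y t x\<bar> < \<kappa> / 3" "\<bar>Wt t x + c t x * Wx t x - F t x\<bar> < \<epsilon>" using W2 that by auto
  qed
  have "\<exists>t\<in>{0..\<rho>}. \<exists>x\<in>{x0-\<rho>..x0+\<rho>}. W (t0 + t) x \<le> W (t0 + 0) x0 - min (\<epsilon> / 4 * \<rho>) (\<epsilon> / (4 * C) * \<rho>)"
  proof (rule local_descent[where Wt="\<lambda>t. Wt (t0 + t)" and Wx="\<lambda>t. Wx (t0 + t)" and c="\<lambda>t. c (t0 + t)", OF \<rho>(1,1,2) e])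
    have "continuous_on ({0..\<rho>} \<times> {x0-\<rho>..x0+\<rho>}) (\<lambda>p. (t0 + fst p, snd p))" by (intro continuous_intros)
    moreover have "(\<lambda>p. (t0 + fst p, snd p)) ` ({0..\<rho>} \<times> {x0-\<rho>..x0+\<rho>}) \<subseteq> strip Tm" using t0 \<rho> by auto
    ultimately show "continuous_on ({0..\<rho>} \<times> {x0-\<rho>..x0+\<rho>}) (\<lambda>p. W (t0 + fst p) (snd p))"
      using continuous_on_compose2[OF C1_with_cont(1)[OF W]] by fastforce
    fix t x assume tx: "0 \<le> t" "t < \<rho>" "\<bar>x - x0\<bar> < \<rho>"
    show "((\<lambda>x. W (t0 + t) x) has_real_derivative Wx (t0 + t) x) (at x)"
      using tx t0 \<rho> by (intro C1_with_dx[OF W]) auto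
    have 1: "((\<lambda>t. W t x) has_real_derivative Wt (t0 + t) x) (at (t0 + t) within (\<lambda>s. t0 + s) ` {t..\<rho>})"
      by (rule DERIV_subset[OF C1_with_dt[OF W]]) (use tx t0 \<rho> in auto)
    have 2: "((\<lambda>s. t0 + s) has_real_derivative 1) (at t within {t..\<rho>})"
      by (auto intro!: derivative_eq_intros)
    show "((\<lambda>t. W (t0 + t) x) has_real_derivative Wt (t0 + t) x) (at t within {t..\<rho>})"
      using DERIV_image_chain[OF 1 2] by (simp add: o_def)
    have "F (t0 + t) x \<le> F t0 x0 / 2 \<and> \<bar>c (t0 + t) x\<bar> \<le> C" using box[of "t0 + t" x] tx t0 \<rho> by auto
    then show "\<bar>c (t0 + t) x\<bar> \<le> C" "Wt (t0 + t) x + c (t0 + t) x * Wx (t0 + t) x \<le> - \<epsilon>"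
      using near(2)[of "t0 + t" x] tx t0 by (auto simp: \<epsilon>_def)
  qed
  then obtain t x where tx: "t \<in> {0..\<rho>}" "x \<in> {x0-\<rho>..x0+\<rho>}" "W (t0 + t) x \<le> W t0 x0 - \<kappa>"
    by (auto simp: \<kappa>_def)
  have "\<bar>x - x0\<bar> \<le> \<rho>" using tx by auto
  then have "\<bar>W (t0 + t) x - Y (t0 + t) x\<bar> < \<kappa> / 3" "\<bar>W t0 x0 - Y t0 x0\<bar> < \<kappa> / 3"
    using near(1)[of "t0 + t" x] near(1)[of t0 x0] tx t0 \<rho> by auto
  then have lt: "Y (t0 + t) x < Y t0 x0" using tx(3) k unfolding abs_less_iff by linarith
  then have "t \<noteq> 0" using min[of x] by auto
  then show ?thesis using lt tx \<rho> by (intro exI[of _ "t0 + t"] exI[of _ x]) auto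
qed

text \<open>\<open>local_descent\<close> applied to -W with time reversed. The backward form suits
  maxima over [0, t], which may sit at the final time.\<close>

lemma tder_ascent_backward:
  assumes Y: "tder Tm c Y F" and c: "cont2 Tm c" and F: "cont2 Tm F"
    and t0: "0 < t0" "t0 < Tm" and max: "\<And>x. Y t0 x \<le> Y t0 x0" and neg: "F t0 x0 < 0"
  shows "\<exists>t x. 0 \<le> t \<and> t < t0 \<and> Y t0 x0 < Y t x"
proof -
  have t0': "0 \<le> t0" using t0 by simp
  obtain \<rho> C where \<rho>: "0 < \<rho>" "0 < C" "\<rho> < t0" "t0 + \<rho> < Tm"
    and box: "\<And>t x. t \<in> {0..<Tm} \<Longrightarrow> \<bar>t - t0\<bar> \<le> \<rho> \<Longrightarrow> \<bar>x - x0\<bar> \<le> \<rho> \<Longrightarrow> F t x \<le> F t0 x0 / 2 \<and> \<bar>c t x\<bar> \<le> C"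
    using neighbourhood_box[OF c F t0' t0(2) neg t0(1)] by blast
  define \<epsilon> where "\<epsilon> = - F t0 x0 / 4"
  define \<kappa> where "\<kappa> = min (\<epsilon> / 4 * \<rho>) (\<epsilon> / (4 * C) * \<rho>)"
  have e: "0 < \<epsilon>" using neg by (simp add: \<epsilon>_def)
  then have k: "0 < \<kappa>" using \<rho> by (simp add: \<kappa>_def)
  then have ek: "0 < min \<epsilon> (\<kappa> / 3)" using e by simp
  obtain W Wt Wx where W: "C1_with (strip Tm) W Wt Wx"
    and W2: "\<forall>t\<in>{0..t0 + \<rho>}. \<forall>x\<in>{-(\<bar>x0\<bar> + \<rho>)..\<bar>x0\<bar> + \<rho>}. \<bar>W t x - Y t x\<bar> < min \<epsilon> (\<kappa> / 3) \<and> \<bar>Wt t x + c t x * Wx t x - F t x\<bar> < min \<epsilon> (\<kappa> / 3)"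
    using Y[unfolded tder_def, rule_format, OF \<rho>(4) ek, of "\<bar>x0\<bar> + \<rho>"] by blast
  have near: "\<bar>W t x - Y t x\<bar> < \<kappa> / 3" "\<bar>Wt t x + c t x * Wx t x - F t x\<bar> < \<epsilon>"
    if "t \<in> {0..t0+\<rho>}" "\<bar>x - x0\<bar> \<le> \<rho>" for t x
  proof -
    have "x \<in> {-(\<bar>x0\<bar> + \<rho>)..\<bar>x0\<bar> + \<rho>}" using that by auto
    then show "\<bar>W t x - Y t x\<bar> < \<kappa> / 3" "\<bar>Wt t x + c t x * Wx t x - F t x\<bar> < \<epsilon>" using W2 that by auto
  qed
  have "\<exists>t\<in>{0..\<rho>}. \<exists>x\<in>{x0-\<rho>..x0+\<rho>}. - W (t0 - t) x \<le> - W (t0 - 0) x0 - min (\<epsilon> / 4 * \<rho>) (\<epsilon> / (4 * C) * \<rho>)"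
  proof (rule local_descent[where Wt="\<lambda>t. Wt (t0 - t)" and Wx="\<lambda>t x. - Wx (t0 - t) x" and c="\<lambda>t x. - c (t0 - t) x", OF \<rho>(1,1,2) e])
    have "continuous_on ({0..\<rho>} \<times> {x0-\<rho>..x0+\<rho>}) (\<lambda>p. (t0 - fst p, snd p))" by (intro continuous_intros)
    moreover have "(\<lambda>p. (t0 - fst p, snd p)) ` ({0..\<rho>} \<times> {x0-\<rho>..x0+\<rho>}) \<subseteq> strip Tm" using t0 \<rho> by auto
    ultimately have "continuous_on ({0..\<rho>} \<times> {x0-\<rho>..x0+\<rho>}) (\<lambda>p. W (t0 - fst p) (snd p))"
      using continuous_on_compose2[OF C1_with_cont(1)[OF W]] by fastforce
    then show "continuous_on ({0..\<rho>} \<times> {x0-\<rho>..x0+\<rho>}) (\<lambda>p. - W (t0 - fst p) (snd p))"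
      by (intro continuous_intros)
    fix t x assume tx: "0 \<le> t" "t < \<rho>" "\<bar>x - x0\<bar> < \<rho>"
    show "((\<lambda>x. - W (t0 - t) x) has_real_derivative - Wx (t0 - t) x) (at x)"
      using tx t0 \<rho> by (intro DERIV_minus C1_with_dx[OF W]) auto
    have 1: "((\<lambda>t. W t x) has_real_derivative Wt (t0 - t) x) (at (t0 - t) within (\<lambda>s. t0 - s) ` {t..\<rho>})"
      by (rule DERIV_subset[OF C1_with_dt[OF W]]) (use tx t0 \<rho> in auto)
    have 2: "((\<lambda>s. t0 - s) has_real_derivative - 1) (at t within {t..\<rho>})"
      by (auto intro!: derivative_eq_intros)
    have "((\<lambda>t. W (t0 - t) x) has_real_derivative Wt (t0 - t) x * - 1) (at t within {t..\<rho>})"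
      using DERIV_image_chain[OF 1 2] by (simp add: o_def)
    from DERIV_minus[OF this]
    show "((\<lambda>t. - W (t0 - t) x) has_real_derivative Wt (t0 - t) x) (at t within {t..\<rho>})" by simp
    have "F (t0 - t) x \<le> F t0 x0 / 2 \<and> \<bar>c (t0 - t) x\<bar> \<le> C" using box[of "t0 - t" x] tx t0 \<rho> by auto
    then show "\<bar>- c (t0 - t) x\<bar> \<le> C" "Wt (t0 - t) x + - c (t0 - t) x * - Wx (t0 - t) x \<le> - \<epsilon>"
      using near(2)[of "t0 - t" x] tx t0 \<rho> by (auto simp: \<epsilon>_def)
  qed
  then obtain t x where tx: "t \<in> {0..\<rho>}" "x \<in> {x0-\<rho>..x0+\<rho>}" "- W (t0 - t) x \<le> - W t0 x0 - \<kappa>"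
    by (auto simp: \<kappa>_def)
  have "\<bar>x - x0\<bar> \<le> \<rho>" using tx by auto
  then have "\<bar>W (t0 - t) x - Y (t0 - t) x\<bar> < \<kappa> / 3" "\<bar>W t0 x0 - Y t0 x0\<bar> < \<kappa> / 3"
    using near(1)[of "t0 - t" x] near(1)[of t0 x0] tx t0 \<rho> by auto
  then have lt: "Y t0 x0 < Y (t0 - t) x" using tx(3) k unfolding abs_less_iff by linarith
  then have "t \<noteq> 0" using max[of x] by auto
  then show ?thesis using lt tx \<rho> by (intro exI[of _ "t0 - t"] exI[of _ x]) auto
qed

section \<open>Energy of solutions with trivial far field\<close>

lemma C1_with_cont_x:
  assumes "C1_with (strip Tm) f ft fx" "0 \<le> t" "t < Tm"
  shows "continuous_on A (f t)"
  by (rule DERIV_continuous_on, rule DERIV_subset, rule C1_with_dx[OF assms]) simp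

lemma C1_with_integral_deriv:
  assumes C: "C1_with (strip Tm) f ft fx" and t: "0 \<le> t" "t < Tm"
  shows "((\<lambda>t. integral {a..b} (f t)) has_real_derivative integral {a..b} (ft t)) (at t within {0..<Tm})"
proof -
  have "((\<lambda>t. integral (cbox a b) (f t)) has_real_derivative integral (cbox a b) (ft t)) (at t within {0..<Tm})"
  proof (rule leibniz_rule_field_derivative)
    show "f t integrable_on cbox a b" if "t \<in> {0..<Tm}" for t
      using that by (intro integrable_continuous C1_with_cont_x[OF C]) auto
    show "continuous_on ({0..<Tm} \<times> cbox a b) (\<lambda>(t, x). ft t x)"
      unfolding split_beta by (rule continuous_on_subset[OF C1_with_cont(2)[OF C]]) auto
  qed (use t C1_with_dt[OF C] in auto)
  then show ?thesis by simp
qed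

lemma cont2_x: "cont2 Tm f \<Longrightarrow> 0 \<le> t \<Longrightarrow> t < Tm \<Longrightarrow> continuous_on A (f t)"
  by (rule continuous_on_compose2[where g="\<lambda>p. f (fst p) (snd p)" and f="\<lambda>x. (t, x)" and t="strip Tm", simplified])
    (auto intro!: continuous_intros)

section \<open>The potential in the variable h^(\<gamma>/2)\<close>

definition qfun :: "real \<Rightarrow> real \<Rightarrow> real" where
  "qfun g y = g\<^sup>2 / 2 * Qpot g (y powr (2 / g))"

lemma Qpot_prim1: "Qpot g r = 1 / g * prim1 (\<lambda>s. s powr (g - 2) - s powr (-2)) r"
  by (simp add: Qpot_def prim1_def)

lemma Qpot_deriv:
  assumes "0 < r"
  shows "(Qpot g has_real_derivative (r powr (g - 2) - r powr (-2)) / g) (at r)"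
proof -
  have "continuous_on {0<..} (\<lambda>s::real. s powr (g - 2) - s powr (-2))"
    by (intro continuous_intros) auto
  from DERIV_cmult[OF prim1_deriv[OF this assms], of "1 / g"] show ?thesis
    by (simp add: Qpot_prim1[abs_def])
qed

lemma profile_gamma:
  assumes g: "1 \<le> g"
  shows "profile (2 / g) (qfun g) (prim1 (qfun g))"
proof -
  have d: "(qfun g has_real_derivative (y\<^sup>2 - 1) * y powr (- 1 - 2 / g)) (at y)" if y: "0 < y" for y
  proof -
    let ?r = "y powr (2 / g)"
    have "((\<lambda>y. y powr (2 / g)) has_real_derivative 2 / g * y powr (2 / g - 1)) (at y)"
      using y by (rule has_real_derivative_powr)
    from DERIV_chain2[OF Qpot_deriv this, of g] y
    have "((\<lambda>y. Qpot g (y powr (2 / g))) has_real_derivative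
       (?r powr (g - 2) - ?r powr (-2)) / g * (2 / g * y powr (2 / g - 1))) (at y)" by simp
    from DERIV_cmult[OF this, of "g\<^sup>2 / 2"]
    have "(qfun g has_real_derivative g\<^sup>2 / 2 * ((?r powr (g - 2) - ?r powr (-2)) / g * (2 / g * y powr (2 / g - 1)))) (at y)"
      by (simp add: qfun_def[abs_def])
    moreover have "g\<^sup>2 / 2 * ((?r powr (g - 2) - ?r powr (-2)) / g * (2 / g * y powr (2 / g - 1)))
      = ?r powr (g - 2) * y powr (2 / g - 1) - ?r powr (-2) * y powr (2 / g - 1)"
      using g by (simp add: power2_eq_square field_simps)
    moreover have "?r powr (g - 2) * y powr (2 / g - 1) = y\<^sup>2 * y powr (- 1 - 2 / g)"
    proof -
      have "2 / g * (g - 2) + (2 / g - 1) = 2 + (- 1 - 2 / g)" using g by (simp add: field_simps)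
      then have "?r powr (g - 2) * y powr (2 / g - 1) = y powr (2 + (- 1 - 2 / g))"
        by (simp only: powr_powr powr_add[symmetric])
      then show ?thesis using y by (simp only: powr_add) simp
    qed
    moreover have "?r powr (-2) * y powr (2 / g - 1) = y powr (- 1 - 2 / g)"
    proof -
      have "2 / g * (-2) + (2 / g - 1) = - 1 - 2 / g" using g by (simp add: field_simps)
      then show ?thesis by (simp only: powr_powr powr_add[symmetric])
    qed
    ultimately show ?thesis by (simp only: left_diff_distrib mult_1)
  qed
  show ?thesis
  proof
    show "0 < 2 / g" "2 / g \<le> 2" using g by (auto simp: field_simps)
    show "qfun g 1 = 0" by (simp add: qfun_def Qpot_prim1)
    have "continuous_on {0<..} (qfun g)" by (rule DERIV_continuous_on, rule DERIV_subset, rule d) auto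
    then show "\<And>y. 0 < y \<Longrightarrow> (prim1 (qfun g) has_real_derivative qfun g y) (at y)"
      by (rule prim1_deriv)
  qed (use d in auto)
qed

section \<open>The system, its energy density and the flux\<close>

locale flow =
  fixes g Tm R :: real and h u v ht hx ut ux vt vx :: "real \<Rightarrow> real \<Rightarrow> real"
  assumes g1: "1 \<le> g" and Tm_pos: "0 < Tm"
    and hC: "C1_with (strip Tm) h ht hx" and uC: "C1_with (strip Tm) u ut ux" and vC: "C1_with (strip Tm) v vt vx"
    and h_pos: "\<And>t x. 0 \<le> t \<Longrightarrow> t < Tm \<Longrightarrow> 0 < h t x"
    and eq_h: "\<And>t x. 0 \<le> t \<Longrightarrow> t < Tm \<Longrightarrow> ht t x = - (h t x)\<^sup>2 * ux t x"
    and eq_u: "\<And>t x. 0 \<le> t \<Longrightarrow> t < Tm \<Longrightarrow> ut t x = v t x - h t x powr (g - 1) * hx t x"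
    and eq_v: "\<And>t x. 0 \<le> t \<Longrightarrow> t < Tm \<Longrightarrow> vt t x = - u t x"
    and R_pos: "0 < R"
    and init: "\<And>x. R \<le> \<bar>x\<bar> \<Longrightarrow> h 0 x = 1 \<and> u 0 x = 0 \<and> v 0 x = 0"
begin

sublocale profile "2 / g" "qfun g" "prim1 (qfun g)"
  by (rule profile_gamma[OF g1])

definition yy :: "real \<Rightarrow> real \<Rightarrow> real" where "yy t x = h t x powr (g / 2)"
definition cc :: "real \<Rightarrow> real \<Rightarrow> real" where "cc t x = h t x powr ((g + 1) / 2)"
definition PR :: "real \<Rightarrow> real \<Rightarrow> real" where "PR t x = (h t x powr g - 1) / g"
definition en :: "real \<Rightarrow> real \<Rightarrow> real" where
  "en t x = (1/2) * ((u t x)\<^sup>2 + (v t x)\<^sup>2) + Qpot g (h t x)"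

lemma h_powr_C1: "C1_with (strip Tm) (\<lambda>t x. h t x powr a)
    (\<lambda>t x. a * h t x powr (a - 1) * ht t x) (\<lambda>t x. a * h t x powr (a - 1) * hx t x)"
  by (rule C1_with_compose[OF hC, where D="{0<..}" and g="\<lambda>z. z powr a"])
    (auto intro!: has_real_derivative_powr continuous_intros h_pos)

lemma yy_pos: "0 \<le> t \<Longrightarrow> t < Tm \<Longrightarrow> 0 < yy t x" by (simp add: yy_def order_less_imp_not_eq2[OF h_pos])
lemma yy_powr: "0 \<le> t \<Longrightarrow> t < Tm \<Longrightarrow> yy t x powr (2 / g) = h t x"
  using g1 h_pos[of t x] by (simp add: yy_def powr_powr)
lemma yy_sq: "0 \<le> t \<Longrightarrow> t < Tm \<Longrightarrow> (yy t x)\<^sup>2 = h t x powr g"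
  by (simp add: yy_def power2_eq_square flip: powr_add)
lemma cc_alt: "0 \<le> t \<Longrightarrow> t < Tm \<Longrightarrow> cc t x = sqrt (h t x) * yy t x"
  using h_pos[of t x] by (simp add: cc_def yy_def powr_half_sqrt[symmetric] add_divide_distrib flip: powr_add) (simp add: add.commute)
lemma PR_alt: "0 \<le> t \<Longrightarrow> t < Tm \<Longrightarrow> PR t x = ((yy t x)\<^sup>2 - 1) / g" by (simp add: PR_def yy_sq)
lemma Qpot_alt: "0 \<le> t \<Longrightarrow> t < Tm \<Longrightarrow> Qpot g (h t x) = 2 / g\<^sup>2 * qfun g (yy t x)"
  using g1 by (simp add: qfun_def yy_powr)
lemma Qpot_nonneg: "0 \<le> t \<Longrightarrow> t < Tm \<Longrightarrow> 0 \<le> Qpot g (h t x)"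
  by (simp add: Qpot_alt qf_nonneg[OF yy_pos])
lemma en_nonneg: "0 \<le> t \<Longrightarrow> t < Tm \<Longrightarrow> 0 \<le> en t x"
  unfolding en_def using Qpot_nonneg[of t x] by simp

lemma en_zero_iff:
  assumes t: "0 \<le> t" "t < Tm"
  shows "en t x = 0 \<longleftrightarrow> h t x = 1 \<and> u t x = 0 \<and> v t x = 0"
proof
  assume e: "en t x = 0"
  have Q: "0 \<le> Qpot g (h t x)" by (rule Qpot_nonneg[OF t])
  have s: "0 \<le> (u t x)\<^sup>2 + (v t x)\<^sup>2" by simp
  have "2 * en t x = ((u t x)\<^sup>2 + (v t x)\<^sup>2) + 2 * Qpot g (h t x)" by (simp add: en_def)
  then have "(u t x)\<^sup>2 + (v t x)\<^sup>2 \<le> 0" "Qpot g (h t x) = 0" using e Q s by linarith+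
  then have uv: "u t x = 0 \<and> v t x = 0" by (simp add: sum_power2_le_zero_iff)
  have "qfun g (yy t x) = 0" using \<open>Qpot g (h t x) = 0\<close> g1 Qpot_alt[OF t, of x] by simp
  then have "yy t x = 1" using qf_pos[OF yy_pos[OF t]] by fastforce
  then show "h t x = 1 \<and> u t x = 0 \<and> v t x = 0" using uv yy_powr[OF t, of x] by simp
next
  assume "h t x = 1 \<and> u t x = 0 \<and> v t x = 0"
  then show "en t x = 0" by (simp add: en_def Qpot_prim1)
qed

definition flux_x :: "real \<Rightarrow> real \<Rightarrow> real" where
  "flux_x t x = ux t x * PR t x + u t x * (h t x powr (g - 1) * hx t x)"

lemma PR_C1: "C1_with (strip Tm) PR (\<lambda>t x. h t x powr (g - 1) * ht t x) (\<lambda>t x. h t x powr (g - 1) * hx t x)"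
proof -
  have "C1_with (strip Tm) (\<lambda>t x. 1 / g * (h t x powr g + - 1))
     (\<lambda>t x. 1 / g * (g * h t x powr (g - 1) * ht t x + 0)) (\<lambda>t x. 1 / g * (g * h t x powr (g - 1) * hx t x + 0))"
    by (intro C1_with_cmult C1_with_add h_powr_C1 C1_with_const)
  moreover have "(\<lambda>t x. 1 / g * (h t x powr g + - 1)) = PR" by (auto simp: PR_def fun_eq_iff)
  ultimately show ?thesis using g1 by simp
qed

lemma uPR_C1: "C1_with (strip Tm) (\<lambda>t x. u t x * PR t x)
    (\<lambda>t x. ut t x * PR t x + u t x * (h t x powr (g - 1) * ht t x)) flux_x"
  unfolding flux_x_def[abs_def] by (rule C1_with_mult[OF uC PR_C1])

lemma en_C1_raw: "C1_with (strip Tm) en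
    (\<lambda>t x. 1/2 * ((ut t x * u t x + u t x * ut t x) + (vt t x * v t x + v t x * vt t x))
      + (h t x powr (g - 2) - h t x powr (-2)) / g * ht t x)
    (\<lambda>t x. 1/2 * ((ux t x * u t x + u t x * ux t x) + (vx t x * v t x + v t x * vx t x))
      + (h t x powr (g - 2) - h t x powr (-2)) / g * hx t x)"
proof -
  have Q: "C1_with (strip Tm) (\<lambda>t x. Qpot g (h t x)) (\<lambda>t x. (h t x powr (g - 2) - h t x powr (-2)) / g * ht t x)
     (\<lambda>t x. (h t x powr (g - 2) - h t x powr (-2)) / g * hx t x)"
    by (rule C1_with_compose[OF hC, where D="{0<..}" and g="Qpot g"])
      (use g1 in \<open>auto intro!: Qpot_deriv continuous_intros h_pos\<close>)
  show ?thesis unfolding en_def[abs_def] power2_eq_square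
    by (intro C1_with_add C1_with_cmult C1_with_mult uC vC Q)
qed

definition en_x :: "real \<Rightarrow> real \<Rightarrow> real" where
  "en_x t x = u t x * ux t x + v t x * vx t x + (h t x powr (g - 2) - h t x powr (-2)) / g * hx t x"

lemma C1_with_cong:
  assumes "C1_with (strip Tm) f ft fx"
    "\<And>t x. 0 \<le> t \<Longrightarrow> t < Tm \<Longrightarrow> ft t x = ft' t x" "\<And>t x. 0 \<le> t \<Longrightarrow> t < Tm \<Longrightarrow> fx t x = fx' t x"
  shows "C1_with (strip Tm) f ft' fx'"
proof -
  have "continuous_on (strip Tm) (\<lambda>p. ft' (fst p) (snd p))"
    by (rule continuous_on_eq[OF C1_with_cont(2)[OF assms(1)]]) (use assms(2) in auto)
  moreover have "continuous_on (strip Tm) (\<lambda>p. fx' (fst p) (snd p))"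
    by (rule continuous_on_eq[OF C1_with_cont(3)[OF assms(1)]]) (use assms(3) in auto)
  ultimately show ?thesis using assms unfolding C1_with_def by auto
qed

lemma en_C1: "C1_with (strip Tm) en (\<lambda>t x. - flux_x t x) en_x"
proof (rule C1_with_cong[OF en_C1_raw])
  fix t x assume t: "0 \<le> t" "t < Tm"
  note hp = h_pos[OF t, of x]
  have 1: "h t x powr (g - 2) * (h t x)\<^sup>2 = h t x powr g" "h t x powr (-2) * (h t x)\<^sup>2 = 1"
    using hp by (simp_all add: powr_diff powr_minus)
  have "(h t x powr (g - 2) - h t x powr (-2)) / g * ht t x = - PR t x * ux t x"
    unfolding eq_h[OF t] PR_def using 1 by (simp add: algebra_simps diff_divide_distrib)
  then show "1/2 * ((ut t x * u t x + u t x * ut t x) + (vt t x * v t x + v t x * vt t x))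
      + (h t x powr (g - 2) - h t x powr (-2)) / g * ht t x = - flux_x t x"
    unfolding eq_u[OF t] eq_v[OF t] flux_x_def by (simp add: algebra_simps)
qed (simp add: en_x_def algebra_simps)

text \<open>A flux of at most twice the density gives propagation speed at most 2 as long as
  \<open>yy\<close> stays below sqrt 2.\<close>

lemma pressure_bound:
  assumes t: "0 \<le> t" "t < Tm" and y: "yy t x \<le> sqrt 2"
  shows "\<bar>u t x * PR t x\<bar> \<le> 2 * en t x"
proof -
  have main: "(y\<^sup>2 - 1)\<^sup>2 \<le> 16 * qfun g y" if y: "0 < y" "y \<le> sqrt 2" for y
  proof -
    let ?f = "\<lambda>y. 16 * qfun g y - (y\<^sup>2 - 1)\<^sup>2" and ?f' = "\<lambda>y. (y\<^sup>2 - 1) * (16 * pp y - 4 * y)"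
    have d: "(?f has_real_derivative ?f' x) (at x)" if "0 < x" for x
      using that by (auto intro!: derivative_eq_intros qf_deriv' simp: algebra_simps power2_eq_square)
    have pos: "0 \<le> 16 * pp x - 4 * x" if x: "0 < x" "x \<le> sqrt 2" for x
    proof (cases "x \<le> 1")
      case True
      have "x powr 0 \<le> pp x" unfolding pp_def using x True g1 by (intro powr_mono') (auto simp: field_simps)
      then show ?thesis using True x by simp
    next
      case False
      \<comment> \<open>T = 2 is the worst exponent right of 1, and 1 / x^3 \<ge> x / 4 means x^4
        \<le> 4; hence the bound sqrt 2.\<close>
      have "x powr (- 1 - 2) \<le> pp x" unfolding pp_def using False T_le2 by (intro powr_mono) auto
      moreover have "x powr (- 1 - 2) = 1 / x ^ 3" using x by (simp add: powr_minus_divide)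
      moreover have "x\<^sup>2 \<le> 2" using x power_mono[of x "sqrt 2" 2] by simp
      then have "x\<^sup>2 * x\<^sup>2 \<le> 2 * 2" by (intro mult_mono) auto
      then have "x / 4 \<le> 1 / x ^ 3" using x by (simp add: field_simps power2_eq_square power3_eq_cube)
      ultimately show ?thesis by simp
    qed
    have "?f 1 \<le> ?f y"
    proof (cases "1 \<le> y")
      case True
      then show ?thesis
      proof (rule nondecreasing_from_deriv[OF _ d])
        fix x assume "1 \<le> x" "x \<le> y"
        then show "0 \<le> ?f' x" using pos[of x] y by (intro mult_nonneg_nonneg) auto
      qed auto
    next
      case False
      then have "y \<le> 1" by simp
      then show ?thesis
      proof (rule nonincreasing_from_deriv[OF _ d])
        fix x assume x: "y \<le> x" "x \<le> 1"
        moreover have "x \<le> sqrt 2" using x by (meson order_trans real_sqrt_ge_one one_le_numeral)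
        ultimately show "?f' x \<le> 0" using pos[of x] y by (intro mult_nonpos_nonneg) (auto simp: power_le_one)
      qed (use y in auto)
    qed
    then show ?thesis by simp
  qed
  have "(PR t x)\<^sup>2 \<le> 8 * Qpot g (h t x)"
    using main[OF yy_pos[OF t] y] g1 unfolding PR_alt[OF t] Qpot_alt[OF t]
    by (simp add: power_divide divide_right_mono)
  moreover have "\<bar>u t x * PR t x\<bar> \<le> (u t x)\<^sup>2 + (PR t x)\<^sup>2 / 4"
  proof -
    have "0 \<le> (\<bar>u t x\<bar> - \<bar>PR t x\<bar> / 2)\<^sup>2" by simp
    then show ?thesis by (simp add: power2_diff abs_mult power_divide)
  qed
  moreover have "2 * en t x = (u t x)\<^sup>2 + (v t x)\<^sup>2 + 2 * Qpot g (h t x)" by (simp add: en_def)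
  ultimately show ?thesis using zero_le_power2[of "v t x"] by linarith
qed

text \<open>The energy is weighted by the square of the positive part of (r - 2t)^2 - (y - x0)^2.
  This weight is C^1 and vanishes outside the cone, so the weighted energy can be differentiated
  over a fixed interval; the shrinking of the cone at speed 2 outweighs the flux.\<close>

lemma cone_trivial_if_small:
  assumes r: "0 < r" and in0: "\<And>y. \<bar>y - x0\<bar> \<le> r \<Longrightarrow> en 0 y = 0"
    and t1: "t1 \<le> Tm" "2 * t1 \<le> r"
    and small: "\<And>t y. 0 \<le> t \<Longrightarrow> t < t1 \<Longrightarrow> \<bar>y - x0\<bar> \<le> r - 2 * t \<Longrightarrow> yy t y \<le> sqrt 2"
    and t: "0 \<le> t" "t < t1" and y: "\<bar>y - x0\<bar> < r - 2 * t"
  shows "en t y = 0"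
proof -
  let ?m = "\<lambda>t y. (r - 2 * t)\<^sup>2 - (y - x0)\<^sup>2"
  let ?w = "\<lambda>z::real. (max 0 z)\<^sup>2" and ?w' = "\<lambda>z::real. 2 * max 0 z"
  have w': "(?w has_real_derivative ?w' z) (at z)" for z
  proof (cases "z = 0")
    case True
    have "((\<lambda>h. (max 0 h)\<^sup>2 / h) \<longlongrightarrow> 0) (at (0::real))"
    proof (rule Lim_null_comparison[where g="\<lambda>h. \<bar>h\<bar>"])
      show "\<forall>\<^sub>F h in at (0::real). norm ((max 0 h)\<^sup>2 / h) \<le> \<bar>h\<bar>"
        by (intro always_eventually allI) (auto simp: max_def power2_eq_square)
      show "((\<lambda>h. \<bar>h\<bar>) \<longlongrightarrow> 0) (at (0::real))" by (intro tendsto_rabs_zero tendsto_ident_at)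
    qed
    then show ?thesis unfolding True DERIV_def by simp
  next
    case False
    consider "0 < z" | "z < 0" using False by linarith
    then show ?thesis
    proof cases
      case 1
      have "((\<lambda>z. z\<^sup>2) has_real_derivative ?w' z) (at z)" using 1 by (auto intro!: derivative_eq_intros)
      then show ?thesis
        by (rule has_field_derivative_transform_within_open[where S="{0<..}"]) (use 1 in auto)
    next
      case 2
      have "((\<lambda>z. 0) has_real_derivative ?w' z) (at z)" using 2 by auto
      then show ?thesis
        by (rule has_field_derivative_transform_within_open[where S="{..<0}"]) (use 2 in auto)
    qed
  qed
  have mC: "C1_with (strip Tm) ?m (\<lambda>t y. - 4 * (r - 2 * t)) (\<lambda>t y. - 2 * (y - x0))"
    unfolding C1_with_def
    by (intro conjI ballI) (auto intro!: continuous_intros derivative_eq_intros simp: algebra_simps)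
  have \<chi>C: "C1_with (strip Tm) (\<lambda>t y. ?w (?m t y)) (\<lambda>t y. ?w' (?m t y) * (- 4 * (r - 2 * t))) (\<lambda>t y. ?w' (?m t y) * (- 2 * (y - x0)))"
    by (rule C1_with_compose[OF mC, where D=UNIV and g="?w"]) (auto intro!: w' continuous_intros)
  let ?I = "\<lambda>t. integral {x0-r..x0+r} (\<lambda>y. en t y * ?w (?m t y))"
  let ?D = "\<lambda>t y. - flux_x t y * ?w (?m t y) + en t y * (?w' (?m t y) * (- 4 * (r - 2 * t)))"
  note prodC = C1_with_mult[OF en_C1 \<chi>C]
  have dI: "(?I has_real_derivative integral {x0-r..x0+r} (?D t)) (at t within {0..<Tm})" if "0 \<le> t" "t < Tm" for t
    using C1_with_integral_deriv[OF prodC that] by simp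
  have neg: "integral {x0-r..x0+r} (?D t) \<le> 0" if t: "0 \<le> t" "t < t1" for t
  proof -
    have tT: "t < Tm" using t t1 by simp
    let ?B = "\<lambda>y. flux_x t y * ?w (?m t y) + u t y * PR t y * (?w' (?m t y) * (- 2 * (y - x0)))"
    have "(?B has_integral (u t (x0+r) * PR t (x0+r) * ?w (?m t (x0+r)) - u t (x0-r) * PR t (x0-r) * ?w (?m t (x0-r)))) {x0-r..x0+r}"
    proof (rule fundamental_theorem_of_calculus)
      fix y assume "y \<in> {x0-r..x0+r}"
      have "((\<lambda>y. u t y * PR t y * ?w (?m t y)) has_real_derivative ?B y) (at y within {x0-r..x0+r})"
        by (rule DERIV_subset[OF C1_with_dx[OF C1_with_mult[OF uPR_C1 \<chi>C] t(1) tT]]) simp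
      then show "((\<lambda>y. u t y * PR t y * ?w (?m t y)) has_vector_derivative ?B y) (at y within {x0-r..x0+r})"
        unfolding has_real_derivative_iff_has_vector_derivative .
    qed (use r in simp)
    moreover have "?m t (x0+r) \<le> 0" "?m t (x0-r) \<le> 0"
      using t t1 by (auto intro!: power_mono simp: field_simps)
    ultimately have B: "(?B has_integral 0) {x0-r..x0+r}" by simp
    have "?D t integrable_on {x0-r..x0+r}"
      using cont2_x[OF C1_with_cont(2)[OF prodC] t(1) tT] by (intro integrable_continuous_real) simp
    \<comment> \<open>Adding the x-derivative of flux times weight, whose integral is zero, reduces
      the sign of the integral to a pointwise statement.\<close>
    from has_integral_add[OF integrable_integral[OF this] B] has_integral_0
    have "integral {x0-r..x0+r} (?D t) + 0 \<le> 0"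
    proof (rule has_integral_le)
      fix y assume "y \<in> {x0-r..x0+r}"
      have "?D t y + ?B y = ?w' (?m t y) * (- 4 * (r - 2 * t) * en t y - 2 * (y - x0) * (u t y * PR t y))"
        by (simp add: algebra_simps)
      also have "\<dots> \<le> 0"
      proof (cases "?m t y \<le> 0")
        case False
        have rt: "0 \<le> r - 2 * t" using t t1 by simp
        have "(y - x0)\<^sup>2 \<le> (r - 2 * t)\<^sup>2" using False by simp
        then have ya: "\<bar>y - x0\<bar> \<le> r - 2 * t" using rt abs_le_square_iff[of "y - x0" "r - 2 * t"] by simp
        have "\<bar>2 * (y - x0) * (u t y * PR t y)\<bar> \<le> 2 * (r - 2 * t) * (2 * en t y)"
          unfolding abs_mult[of "2 * (y - x0)"] using ya pressure_bound[OF t(1) tT small[OF t ya]] rt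
          by (intro mult_mono) auto
        then have "- 4 * (r - 2 * t) * en t y - 2 * (y - x0) * (u t y * PR t y) \<le> 0"
          by (simp add: abs_le_iff algebra_simps)
        then show ?thesis by (intro mult_nonneg_nonpos) auto
      qed simp
      finally show "?D t y + ?B y \<le> 0" .
    qed
    then show ?thesis by simp
  qed
  have "?I t \<le> ?I 0"
  proof (rule DERIV_nonpos_imp_decreasing_open[OF t(1)])
    show "\<exists>d. (?I has_real_derivative d) (at s) \<and> d \<le> 0" if "0 < s" "s < t" for s
      using dI[of s] neg[of s] that t t1 at_within_interior[of s "{0..<Tm}"] by (intro exI[of _ "integral {x0-r..x0+r} (?D s)"]) auto
    show "continuous_on {0..t} ?I"
      by (rule DERIV_continuous_on[where D="\<lambda>s. integral {x0-r..x0+r} (?D s)"], rule DERIV_subset[OF dI])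
        (use t t1 in auto)
  qed
  also have "?I 0 = integral {x0-r..x0+r} (\<lambda>y. 0)"
    by (rule integral_cong) (use in0 in \<open>auto simp: abs_if\<close>)
  finally have I0: "?I t \<le> 0" by simp
  have tT: "t < Tm" using t t1 by simp
  have cont: "continuous_on {x0-r..x0+r} (\<lambda>y. en t y * ?w (?m t y))"
    by (rule C1_with_cont_x[OF prodC t(1) tT])
  have nn: "0 \<le> en t z * ?w (?m t z)" for z using en_nonneg[OF t(1) tT] by simp
  have "?I t = 0" using I0 nn by (intro antisym integral_nonneg integrable_continuous_real cont) auto
  then have "((\<lambda>y. en t y * ?w (?m t y)) has_integral 0) (cbox (x0-r) (x0+r))"
    using integrable_integral[OF integrable_continuous_real[OF cont]] by simp
  moreover have "y \<in> cbox (x0-r) (x0+r)" using y t by (auto simp: abs_if split: if_splits)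
  ultimately have "en t y * ?w (?m t y) = 0"
    using has_integral_0_cbox_imp_0[of "x0-r" "x0+r" "\<lambda>y. en t y * ?w (?m t y)" y] cont nn r by simp
  moreover have "0 < ?m t y"
    using y abs_le_square_iff[of "r - 2 * t" "y - x0"] t1 t by (auto simp: not_le[symmetric])
  ultimately show ?thesis by simp
qed

end

section \<open>Finite speed of propagation, vorticity, and the transport equations\<close>

context flow begin

lemma yy_C1: "C1_with (strip Tm) yy (\<lambda>t x. g / 2 * h t x powr (g / 2 - 1) * ht t x) (\<lambda>t x. g / 2 * h t x powr (g / 2 - 1) * hx t x)"
  unfolding yy_def[abs_def] by (rule h_powr_C1)

text \<open>Continuity argument: before the first time at which \<open>yy\<close> reaches sqrt 2 in
  the cone, the solution is trivial along the line through that point, so \<open>yy\<close> is still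
  1 there, a contradiction.\<close>

lemma en_trivial_outside:
  assumes t: "0 \<le> t" "t < Tm" and x: "R + 2 * t < \<bar>x\<bar>"
  shows "en t x = 0"
proof -
  define r where "r = \<bar>x\<bar> - R"
  define t1 where "t1 = (t + min Tm (r / 2)) / 2"
  have r: "2 * t < r" "0 < r" using x t by (auto simp: r_def)
  have t1: "t < t1" "t1 < Tm" "2 * t1 < r" using t r by (auto simp: t1_def min_def field_simps)
  have in0: "en 0 y = 0" if "\<bar>y - x\<bar> \<le> r" for y
    using init[of y] that Tm_pos by (subst en_zero_iff) (auto simp: r_def)
  let ?B = "{0..t1} \<times> {x - r..x + r}"
  let ?f = "\<lambda>p. min (yy (fst p) (snd p) - sqrt 2) (r - 2 * fst p - \<bar>snd p - x\<bar>)"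
  define K where "K = ?B \<inter> ?f -` {0..}"
  have yc: "continuous_on ?B (\<lambda>p. yy (fst p) (snd p))"
    by (rule continuous_on_subset[OF C1_with_cont(1)[OF yy_C1]]) (use t1 in auto)
  have "K = {}"
  proof (rule ccontr)
    assume ne: "K \<noteq> {}"
    have "closed K" unfolding K_def
      by (intro continuous_closed_preimage continuous_intros yc closed_Times)
    then have "compact (?B \<inter> K)" by (intro compact_Int_closed compact_Times) auto
    moreover have "?B \<inter> K = K" by (auto simp: K_def)
    ultimately have "compact K" by simp
    moreover have "continuous_on K fst" by (intro continuous_intros)
    ultimately obtain p where p: "p \<in> K" "\<And>q. q \<in> K \<Longrightarrow> fst p \<le> fst q"
      using continuous_attains_inf[of K fst] ne by blast
    obtain s1 y1 where sy: "p = (s1, y1)" by (cases p)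
    have s1: "0 \<le> s1" "s1 \<le> t1" "\<bar>y1 - x\<bar> \<le> r - 2 * s1" "sqrt 2 \<le> yy s1 y1"
      using p(1) by (auto simp: K_def sy)
    have small: "yy s y \<le> sqrt 2" if "0 \<le> s" "s < s1" "\<bar>y - x\<bar> \<le> r - 2 * s" for s y
    proof (rule ccontr)
      assume "\<not> yy s y \<le> sqrt 2"
      then have "(s, y) \<in> K" using that s1 by (auto simp: K_def abs_if split: if_splits)
      then show False using p(2) that by (force simp: sy)
    qed
    have one: "yy s y1 = 1" if "s \<in> {0..<s1}" for s
    proof -
      have "en s y1 = 0"
        by (rule cone_trivial_if_small[OF r(2) in0 _ _ small]) (use that s1 t1 in auto)
      then show ?thesis using en_zero_iff[of s y1] that s1 t1 by (simp add: yy_def)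
    qed
    have "yy 0 y1 = 1"
    proof -
      have "en 0 y1 = 0" by (rule in0) (use s1 in auto)
      then show ?thesis using en_zero_iff[of 0 y1] Tm_pos by (simp add: yy_def)
    qed
    then have "s1 \<noteq> 0" using s1(4) by auto
    then have cl: "closure {0..<s1} = {0..s1}" using s1 by simp
    have "continuous_on (closure {0..<s1}) (\<lambda>s. yy s y1)"
      unfolding cl by (rule DERIV_continuous_on, rule DERIV_subset, rule C1_with_dt[OF yy_C1]) (use s1 t1 in auto)
    from continuous_constant_on_closure[OF this one, of s1] have "yy s1 y1 = 1" using cl s1 by auto
    then show False using s1(4) by auto
  qed
  have small: "yy s y \<le> sqrt 2" if "0 \<le> s" "s < t1" "\<bar>y - x\<bar> \<le> r - 2 * s" for s y
  proof (rule ccontr)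
    assume "\<not> yy s y \<le> sqrt 2"
    then have "(s, y) \<in> K" using that by (auto simp: K_def abs_if split: if_splits)
    then show False using \<open>K = {}\<close> by simp
  qed
  show ?thesis
    by (rule cone_trivial_if_small[OF r(2) in0 _ _ small t(1) t1(1)]) (use t1 r in auto)
qed

text \<open>The additional 1 keeps |x| \<ge> \<open>LL\<close> inside the open region of the trivial
  state, so x-derivatives vanish there too.\<close>

definition LL :: real where "LL = R + 2 * Tm + 1"

lemma en_out: "0 \<le> t \<Longrightarrow> t < Tm \<Longrightarrow> LL - 1 \<le> \<bar>x\<bar> \<Longrightarrow> en t x = 0"
  by (rule en_trivial_outside) (auto simp: LL_def)

lemma trivial_out:
  assumes "0 \<le> t" "t < Tm" "LL - 1 \<le> \<bar>x\<bar>"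
  shows "h t x = 1" "u t x = 0" "v t x = 0"
  using en_out[OF assms] en_zero_iff[OF assms(1,2)] by auto

lemma locally_constant_dx:
  assumes C: "C1_with (strip Tm) f ft fx" and t: "0 \<le> t" "t < Tm" and x: "LL \<le> \<bar>x\<bar>"
    and k: "\<And>y. LL - 1 \<le> \<bar>y\<bar> \<Longrightarrow> f t y = k"
  shows "fx t x = 0"
proof -
  have "((\<lambda>y. k) has_real_derivative fx t x) (at x)"
    by (rule has_field_derivative_transform_within[OF C1_with_dx[OF C t], of 1])
      (use x k in \<open>auto simp: dist_real_def abs_if split: if_splits\<close>)
  then show ?thesis using DERIV_const[of k "at x"] by (rule DERIV_unique)
qed

lemma dx_out:
  assumes "0 \<le> t" "t < Tm" "LL \<le> \<bar>x\<bar>"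
  shows "hx t x = 0" "ux t x = 0" "vx t x = 0"
  using locally_constant_dx[OF hC assms, of 1] locally_constant_dx[OF uC assms, of 0]
    locally_constant_dx[OF vC assms, of 0] trivial_out[OF assms(1,2)] by auto

definition om :: "real \<Rightarrow> real" where "om x = 1 / h 0 x + vx 0 x"

lemma vorticity:
  assumes t: "0 \<le> t" "t < Tm"
  shows "1 / h t x + vx t x = om x"
proof -
  define a b where "a = x - 1" and "b = x + 1"
  have iC: "C1_with (strip Tm) (\<lambda>t x. h t x powr (-1)) ux (\<lambda>t x. - 1 * h t x powr (- 1 - 1) * hx t x)"
  proof (rule C1_with_cong[OF h_powr_C1])
    fix s y assume s: "0 \<le> s" "s < Tm"
    have "h s y powr (- 1 - 1) * (h s y)\<^sup>2 = 1" using h_pos[OF s, of y] by (simp add: powr_minus)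
    then show "- 1 * h s y powr (- 1 - 1) * ht s y = ux s y"
      unfolding eq_h[OF s] by (simp add: mult.assoc[symmetric])
  qed simp
  let ?K = "\<lambda>s y. integral {a..y} (\<lambda>z. h s z powr (-1))"
  have key: "v t y - v t a + ?K t y = v 0 y - v 0 a + ?K 0 y" if y: "a \<le> y" for y
  proof -
    have "((\<lambda>s. v s y - v s a + ?K s y) has_real_derivative 0) (at s within {0..<Tm})" if "s \<in> {0..<Tm}" for s
    proof -
      have s: "0 \<le> s" "s < Tm" using that by auto
      have "((\<lambda>z. ux s z) has_integral (u s y - u s a)) {a..y}"
      proof (rule fundamental_theorem_of_calculus[OF y])
        fix z
        have "(u s has_real_derivative ux s z) (at z within {a..y})"
          by (rule DERIV_subset[OF C1_with_dx[OF uC s]]) simp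
        then show "(u s has_vector_derivative ux s z) (at z within {a..y})"
          unfolding has_real_derivative_iff_has_vector_derivative .
      qed
      then have I: "integral {a..y} (ux s) = u s y - u s a" by (rule integral_unique)
      have "((\<lambda>s. v s y - v s a + ?K s y) has_real_derivative vt s y - vt s a + integral {a..y} (ux s)) (at s within {0..<Tm})"
        by (intro DERIV_add DERIV_diff C1_with_dt[OF vC s] C1_with_integral_deriv[OF iC s])
      then show ?thesis unfolding I eq_v[OF s] by simp
    qed
    then obtain c where "\<And>s. s \<in> {0..<Tm} \<Longrightarrow> v s y - v s a + ?K s y = c"
      using has_field_derivative_zero_constant[of "{0..<Tm}" "\<lambda>s. v s y - v s a + ?K s y"] by auto
    then show ?thesis using t Tm_pos by simp
  qed
  have d: "((\<lambda>y. v s y - v s a + ?K s y) has_real_derivative vx s x + h s x powr (-1)) (at x within {a..b})"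
    if s: "0 \<le> s" "s < Tm" for s
  proof -
    have 1: "((\<lambda>y. ?K s y) has_real_derivative h s x powr (-1)) (at x within {a..b})"
      by (rule integral_has_real_derivative[OF C1_with_cont_x[OF iC s]]) (auto simp: a_def b_def)
    have "((\<lambda>y. v s y - v s a + ?K s y) has_real_derivative (vx s x - 0) + h s x powr (-1)) (at x within {a..b})"
      by (intro DERIV_add DERIV_diff 1 DERIV_const DERIV_subset[OF C1_with_dx[OF vC s]]) simp
    then show ?thesis by simp
  qed
  have "((\<lambda>y. v t y - v t a + ?K t y) has_real_derivative vx 0 x + h 0 x powr (-1)) (at x within {a..b})"
    by (rule has_field_derivative_transform_within[OF d[of 0] zero_less_one])
      (use key Tm_pos in \<open>auto simp: a_def b_def\<close>)
  moreover have "(\<lambda>y. v t y - v t a + ?K t y) = (\<lambda>y. v t y - v t a + ?K t y)" ..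
  moreover have "at x within {a..b} = at x" by (rule at_within_interior) (auto simp: a_def b_def)
  ultimately have "vx t x + h t x powr (-1) = vx 0 x + h 0 x powr (-1)"
    using d[OF t] by (metis DERIV_unique)
  then show ?thesis using h_pos[OF t, of x] h_pos[of 0 x] Tm_pos
    by (simp add: om_def powr_minus_divide)
qed

text \<open>For x < -LL the integral over the empty interval is 0, which is the energy to the left
  of x since the state is trivial there.\<close>

definition NL :: "real \<Rightarrow> real \<Rightarrow> real" where "NL t x = integral {-LL..x} (en t)"

lemma LL_pos: "1 < LL" using R_pos Tm_pos by (simp add: LL_def)

lemma en_cont_x: "0 \<le> t \<Longrightarrow> t < Tm \<Longrightarrow> continuous_on A (en t)"
  by (rule C1_with_cont_x[OF en_C1])

lemma en_int: "0 \<le> t \<Longrightarrow> t < Tm \<Longrightarrow> en t integrable_on {a..b}"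
  by (intro integrable_continuous_real en_cont_x)

lemma NL_left: "0 \<le> t \<Longrightarrow> t < Tm \<Longrightarrow> x \<le> - LL + 1 \<Longrightarrow> NL t x = 0"
proof -
  assume *: "0 \<le> t" "t < Tm" "x \<le> - LL + 1"
  have "NL t x = integral {-LL..x} (\<lambda>_. 0)" unfolding NL_def
    by (rule integral_cong) (use * en_out[OF *(1,2)] LL_pos in auto)
  then show ?thesis by simp
qed

lemma NL_dx:
  assumes t: "0 \<le> t" "t < Tm"
  shows "(NL t has_real_derivative en t x) (at x)"
proof (cases "- LL < x")
  case True
  have "(NL t has_real_derivative en t x) (at x within {-LL..x+1})"
    unfolding NL_def[abs_def] by (rule integral_has_real_derivative[OF en_cont_x[OF t]]) (use True in auto)
  moreover have "at x within {-LL..x+1} = at x" by (rule at_within_interior) (use True in auto)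
  ultimately show ?thesis by simp
next
  case False
  have "en t x = 0" by (rule en_out[OF t]) (use False LL_pos in auto)
  then have "((\<lambda>y. 0) has_real_derivative en t x) (at x)" by simp
  then show ?thesis
    by (rule has_field_derivative_transform_within[where d=1])
      (use False NL_left[OF t] in \<open>auto simp: dist_real_def abs_if split: if_splits\<close>)
qed

lemma NL_dt:
  assumes t: "0 \<le> t" "t < Tm"
  shows "((\<lambda>t. NL t x) has_real_derivative - (u t x * PR t x)) (at t within {0..<Tm})"
proof (cases "- LL \<le> x")
  case True
  have "((\<lambda>z. - flux_x t z) has_integral (- (u t x * PR t x) - - (u t (-LL) * PR t (-LL)))) {-LL..x}"
  proof (rule fundamental_theorem_of_calculus[OF True])
    fix z
    have "((\<lambda>z. - (u t z * PR t z)) has_real_derivative - flux_x t z) (at z within {-LL..x})"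
      by (rule DERIV_minus[OF DERIV_subset[OF C1_with_dx[OF uPR_C1 t]]]) simp
    then show "((\<lambda>z. - (u t z * PR t z)) has_vector_derivative - flux_x t z) (at z within {-LL..x})"
      unfolding has_real_derivative_iff_has_vector_derivative .
  qed
  moreover have "u t (-LL) = 0" by (rule trivial_out(2)[OF t]) (use LL_pos in auto)
  ultimately have "((\<lambda>z. - flux_x t z) has_integral - (u t x * PR t x)) {-LL..x}" by simp
  then have "integral {-LL..x} (\<lambda>z. - flux_x t z) = - (u t x * PR t x)" by (rule integral_unique)
  then show ?thesis using C1_with_integral_deriv[OF en_C1 t, of "-LL" x] by (simp add: NL_def)
next
  case False
  have "u t x = 0" by (rule trivial_out(2)[OF t]) (use False LL_pos in auto)
  then have "((\<lambda>t. 0) has_real_derivative - (u t x * PR t x)) (at t within {0..<Tm})" by simp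
  then show ?thesis
    by (rule has_field_derivative_transform_within[where d=1]) (use False NL_left t in auto)
qed

lemma NL_C1: "C1_with (strip Tm) NL (\<lambda>t x. - (u t x * PR t x)) en"
  unfolding C1_with_def
proof (intro conjI ballI)
  show "cont2 Tm en" by (rule C1_with_cont(1)[OF en_C1])
  show "cont2 Tm (\<lambda>t x. - (u t x * PR t x))" by (intro continuous_intros C1_with_cont(1)[OF uPR_C1])
  fix p assume p: "p \<in> strip Tm"
  then obtain t x where tx: "p = (t, x)" "0 \<le> t" "t < Tm" by auto
  have "((\<lambda>(t, x). NL t x) has_derivative
     (\<lambda>(dt, dx). (- (u t x * PR t x)) * dt + blinfun_mult_right (en t x) dx)) (at (t, x) within {0..<Tm} \<times> UNIV)"
  proof (rule has_derivative_partialsI)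
    show "((\<lambda>t. NL t x) has_derivative (\<lambda>d. - (u t x * PR t x) * d)) (at t within {0..<Tm})"
      using NL_dt[OF tx(2,3), of x] unfolding has_field_derivative_def .
    show "((\<lambda>y. NL s y) has_derivative blinfun_apply (blinfun_mult_right (en s y))) (at y within UNIV)"
      if "s \<in> {0..<Tm}" for s y
      using NL_dx[of s y] that by (simp add: has_field_derivative_def)
    have "continuous_on (strip Tm) (\<lambda>p. blinfun_mult_right (en (fst p) (snd p)))"
      by (intro continuous_intros C1_with_cont(1)[OF en_C1])
    then show "continuous (at (t, x) within {0..<Tm} \<times> UNIV) (\<lambda>(s, y). blinfun_mult_right (en s y))"
      using p unfolding split_beta by (auto simp: continuous_on_eq_continuous_within tx)
  qed auto
  then show "((\<lambda>q. NL (fst q) (snd q)) has_derivative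
     (\<lambda>d. - (u (fst p) (snd p) * PR (fst p) (snd p)) * fst d + en (fst p) (snd p) * snd d)) (at p within strip Tm)"
    unfolding tx(1) case_prod_beta' by simp
qed

definition EE :: real where "EE = integral {-LL..LL} (en 0)"

lemma NL_right: "0 \<le> t \<Longrightarrow> t < Tm \<Longrightarrow> LL \<le> x \<Longrightarrow> NL t x = EE"
proof -
  assume *: "0 \<le> t" "t < Tm" "LL \<le> x"
  have "((\<lambda>s. NL s LL) has_real_derivative 0) (at s within {0..<Tm})" if "s \<in> {0..<Tm}" for s
    using NL_dt[of s LL] trivial_out(2)[of s LL] that LL_pos by simp
  then obtain c where c: "\<And>s. s \<in> {0..<Tm} \<Longrightarrow> NL s LL = c"
    using has_field_derivative_zero_constant[of "{0..<Tm}" "\<lambda>s. NL s LL"] by auto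
  have "NL t LL = EE" using c[of t] c[of 0] * Tm_pos by (simp add: NL_def EE_def)
  moreover have "integral {-LL..LL} (en t) + integral {LL..x} (en t) = integral {-LL..x} (en t)"
    by (rule Henstock_Kurzweil_Integration.integral_combine) (use * LL_pos en_int in auto)
  moreover have "integral {LL..x} (en t) = integral {LL..x} (\<lambda>_. 0)"
    by (rule integral_cong) (use * en_out in auto)
  ultimately show ?thesis by (simp add: NL_def)
qed

lemma NL_mono: "0 \<le> t \<Longrightarrow> t < Tm \<Longrightarrow> x \<le> y \<Longrightarrow> NL t x \<le> NL t y"
  by (rule nondecreasing_from_deriv[of x y "NL t" "en t"]) (auto intro: NL_dx en_nonneg)

lemma NL_range: "0 \<le> t \<Longrightarrow> t < Tm \<Longrightarrow> 0 \<le> NL t x \<and> NL t x \<le> EE"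
  using NL_mono[of t "min x (-LL)" x] NL_mono[of t x "max x LL"] NL_left[of t "min x (-LL)"] NL_right[of t "max x LL"] by auto

lemma energy_eq: "energy g h u v 0 = EE"
proof -
  have "en 0 = (\<lambda>x. if x \<in> {-LL..LL} then en 0 x else 0)"
    using en_out[of 0] Tm_pos by (auto simp: fun_eq_iff abs_if)
  then have "integral UNIV (en 0) = integral {-LL..LL} (en 0)"
    using Henstock_Kurzweil_Integration.integral_restrict_UNIV[of "{-LL..LL}" "en 0"] by simp
  then show ?thesis unfolding energy_def EE_def en_def[abs_def] .
qed

text \<open>\<open>ZZ (- 1)\<close> and \<open>ZZ 1\<close> are \<open>Z\<^sub>1\<close> and \<open>Z\<^sub>2\<close>.\<close>
definition ZZ :: "real \<Rightarrow> real \<Rightarrow> real \<Rightarrow> real" where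
  "ZZ s t x = sqrt (h t x) * (ux t x + s * h t x powr ((g - 3) / 2) * hx t x)"

definition FZ :: "real \<Rightarrow> real \<Rightarrow> real \<Rightarrow> real" where
  "FZ s t x = sqrt (h t x) * (om x - 1 / h t x - (g + 1) / 4 * (ZZ s t x)\<^sup>2 + (g - 1) / 4 * ZZ s t x * ZZ (- s) t x)"

lemma sqrt_h_C1: "C1_with (strip Tm) (\<lambda>t x. sqrt (h t x))
    (\<lambda>t x. inverse (sqrt (h t x)) / 2 * ht t x) (\<lambda>t x. inverse (sqrt (h t x)) / 2 * hx t x)"
  by (rule C1_with_compose[OF hC, where D="{0<..}" and g=sqrt])
    (auto intro!: DERIV_real_sqrt continuous_intros h_pos)

lemma cc_C1: "C1_with (strip Tm) (\<lambda>t x. s * cc t x)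
    (\<lambda>t x. s * ((g + 1) / 2 * h t x powr ((g + 1) / 2 - 1) * ht t x))
    (\<lambda>t x. s * ((g + 1) / 2 * h t x powr ((g + 1) / 2 - 1) * hx t x))"
  unfolding cc_def[abs_def] by (intro C1_with_cmult h_powr_C1)

text \<open>u + s \<phi>(h) is a Riemann invariant, transported with source v. Its x-derivative
  times sqrt h is \<open>ZZ s\<close>, and the source v_x becomes \<omega>_0 - 1/h by
  \<open>vorticity\<close>.\<close>

lemma Z_transport:
  assumes s: "s * s = 1"
  shows "tder Tm (\<lambda>t x. s * cc t x) (ZZ s) (FZ s)"
proof -
  define \<phi> where "\<phi> = prim1 (\<lambda>z. z powr ((g - 3) / 2))"
  have \<phi>d: "(\<phi> has_real_derivative z powr ((g - 3) / 2)) (at z)" if "0 < z" for z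
    unfolding \<phi>_def by (rule prim1_deriv[OF _ that]) (auto intro!: continuous_intros)
  have \<phi>C: "C1_with (strip Tm) (\<lambda>t x. \<phi> (h t x)) (\<lambda>t x. h t x powr ((g - 3) / 2) * ht t x) (\<lambda>t x. h t x powr ((g - 3) / 2) * hx t x)"
    by (rule C1_with_compose[OF hC, where D="{0<..}"]) (auto intro!: \<phi>d continuous_intros h_pos)
  let ?a = "\<lambda>t x. h t x powr ((g - 3) / 2)"
  let ?rx = "\<lambda>t x. ux t x + s * (?a t x * hx t x)"
  have rC: "C1_with (strip Tm) (\<lambda>t x. u t x + s * \<phi> (h t x)) (\<lambda>t x. ut t x + s * (?a t x * ht t x)) ?rx"
    by (intro C1_with_add C1_with_cmult uC \<phi>C)
  have pw: "cc t x = (h t x)\<^sup>2 * ?a t x" "h t x powr ((g + 1) / 2 - 1) = h t x * ?a t x"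
     "h t x powr (g - 1) = cc t x * ?a t x" if t: "0 \<le> t" "t < Tm" for t x
  proof -
    note hp = h_pos[OF t, of x]
    have e: "(g + 1) / 2 = 2 + (g - 3) / 2" "(g + 1) / 2 - 1 = 1 + (g - 3) / 2" "g - 1 = (g + 1) / 2 + (g - 3) / 2"
      by (simp_all add: field_simps)
    show "cc t x = (h t x)\<^sup>2 * ?a t x" unfolding cc_def e(1) powr_add using hp by simp
    show "h t x powr ((g + 1) / 2 - 1) = h t x * ?a t x" unfolding e(2) powr_add using hp by simp
    show "h t x powr (g - 1) = cc t x * ?a t x" unfolding cc_def by (subst e(3)) (rule powr_add)
  qed
  have eq: "ut t x + s * (?a t x * ht t x) + s * cc t x * ?rx t x = v t x" if t: "0 \<le> t" "t < Tm" for t x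
  proof -
    have "s * cc t x * ?rx t x = s * (cc t x * ux t x) + s * s * (cc t x * ?a t x * hx t x)"
      by (simp add: algebra_simps)
    moreover have "s * (?a t x * ht t x) = - (s * (cc t x * ux t x))"
      unfolding eq_h[OF t] pw(1)[OF t] by (simp add: algebra_simps)
    ultimately show ?thesis unfolding s eq_u[OF t] pw(3)[OF t] by simp
  qed
  note T1 = tder_space_derivative[OF rC vC cc_C1 eq]
  have cont: "cont2 Tm (\<lambda>t x. s * cc t x)" by (rule C1_with_cont(1)[OF cc_C1])
  note T2 = tder_mult_C1[OF T1 sqrt_h_C1 cont]
  show ?thesis
  proof (rule tder_cong[OF T2])
    fix t x assume t: "0 \<le> t" "t < Tm"
    show "sqrt (h t x) * ?rx t x = ZZ s t x" by (simp add: ZZ_def mult.assoc)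
    define q where "q = ?a t x * hx t x"
    define S where "S = sqrt (h t x)"
    have S: "0 < S" "h t x = S\<^sup>2" using h_pos[OF t, of x] by (auto simp: S_def)
    have Z: "ZZ s t x = S * (ux t x + s * q)" "ZZ (- s) t x = S * (ux t x - s * q)"
      by (auto simp: ZZ_def q_def S_def)
    have vxe: "vx t x = om x - 1 / S\<^sup>2" using vorticity[OF t, of x] S(2) by simp
    have dh: "ht t x + s * cc t x * hx t x = - (S\<^sup>2)\<^sup>2 * (ux t x - s * q)"
      unfolding eq_h[OF t] pw(1)[OF t] S(2) by (simp add: q_def S(2) algebra_simps)
    define X Y where "X = ux t x + s * q" and "Y = ux t x - s * q"
    have alg: "S * (V - (g + 1) / 2 * S\<^sup>2 * ((X - Y) / 2) * X) + inverse S / 2 * (- (S\<^sup>2)\<^sup>2 * Y) * X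
       = S * (V - (g + 1) / 4 * (S * X)\<^sup>2 + (g - 1) / 4 * (S * X) * (S * Y))" for V
      using S(1) by (simp add: field_simps power2_eq_square)
    have sq: "s * q = (X - Y) / 2" by (simp add: X_def Y_def)
    have "sqrt (h t x) * (vx t x - s * ((g + 1) / 2 * h t x powr ((g + 1) / 2 - 1) * hx t x) * ?rx t x)
      + (inverse (sqrt (h t x)) / 2 * ht t x + s * cc t x * (inverse (sqrt (h t x)) / 2 * hx t x)) * ?rx t x
      = S * (vx t x - (g + 1) / 2 * S\<^sup>2 * (s * q) * X) + inverse S / 2 * (ht t x + s * cc t x * hx t x) * X"
      unfolding pw(2)[OF t] S_def[symmetric] by (simp add: q_def X_def S(2) algebra_simps)
    also have "\<dots> = FZ s t x"
      unfolding dh[folded Y_def] sq alg unfolding FZ_def Z S_def[symmetric]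
      unfolding X_def[symmetric] Y_def[symmetric] vxe unfolding S(2) by simp
    finally show "sqrt (h t x) * (vx t x - s * ((g + 1) / 2 * h t x powr ((g + 1) / 2 - 1) * hx t x) * ?rx t x)
      + (inverse (sqrt (h t x)) / 2 * ht t x + s * cc t x * (inverse (sqrt (h t x)) / 2 * hx t x)) * ?rx t x
      = FZ s t x" .
  qed
qed

end

section \<open>Minimum principle and pointwise bounds\<close>

text \<open>The set where some Y_i lies at or below the falling level m - e t is compact. If its
  latest time were before T1, the overall minimum at that time would decrease faster than the level,
  by \<open>tder_descent\<close>, and produce a later point. Hence the differential inequality is
  required only at global minima over all indices and points.\<close>

lemma minimum_principle:
  fixes I :: "'i set" and Y F c :: "'i \<Rightarrow> real \<Rightarrow> real \<Rightarrow> real"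
  assumes I: "finite I" and T1: "0 \<le> T1" "T1 < Tm" and e: "0 \<le> e"
    and td: "\<And>i. i \<in> I \<Longrightarrow> tder Tm (c i) (Y i) (F i)"
    and cont: "\<And>i. i \<in> I \<Longrightarrow> cont2 Tm (c i)" "\<And>i. i \<in> I \<Longrightarrow> cont2 Tm (Y i)" "\<And>i. i \<in> I \<Longrightarrow> cont2 Tm (F i)"
    and out: "\<And>i t x. i \<in> I \<Longrightarrow> 0 \<le> t \<Longrightarrow> t \<le> T1 \<Longrightarrow> L < \<bar>x\<bar> \<Longrightarrow> m < Y i t x"
    and start: "i0 \<in> I" "Y i0 0 x0 \<le> m"
    and step: "\<And>i t x. i \<in> I \<Longrightarrow> 0 \<le> t \<Longrightarrow> t < T1 \<Longrightarrow> (\<And>j y. j \<in> I \<Longrightarrow> Y i t x \<le> Y j t y) \<Longrightarrow>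
      Y i t x \<le> m - e * t \<Longrightarrow> F i t x < - e"
  shows "\<exists>i\<in>I. \<exists>x. Y i T1 x \<le> m - e * T1"
proof -
  let ?B = "{0..T1} \<times> {-L..L}"
  define K where "K = (\<Union>i\<in>I. ?B \<inter> (\<lambda>p. m - e * fst p - Y i (fst p) (snd p)) -` {0..})"
  have inside: "(t, x) \<in> K" if "i \<in> I" "0 \<le> t" "t \<le> T1" "Y i t x \<le> m - e * t" for i t x
  proof -
    have "0 \<le> e * t" using e that by simp
    then have "Y i t x \<le> m" using that by simp
    then have "\<not> L < \<bar>x\<bar>" using out[of i t x] that by force
    then show ?thesis using that by (auto simp: K_def abs_if split: if_splits)
  qed
  have contB: "continuous_on ?B (\<lambda>p. Y i (fst p) (snd p))" if "i \<in> I" for i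
    by (rule continuous_on_subset[OF cont(2)[OF that]]) (use T1 in auto)
  have "compact (?B \<inter> (\<lambda>p. m - e * fst p - Y i (fst p) (snd p)) -` {0..})" if "i \<in> I" for i
  proof -
    have "closed (?B \<inter> (\<lambda>p. m - e * fst p - Y i (fst p) (snd p)) -` {0..})"
      by (intro continuous_closed_preimage continuous_intros contB that closed_Times)
    then have "compact (?B \<inter> (?B \<inter> (\<lambda>p. m - e * fst p - Y i (fst p) (snd p)) -` {0..}))"
      by (intro compact_Int_closed compact_Times) auto
    then show ?thesis by (simp add: Int_assoc[symmetric])
  qed
  then have K: "compact K" unfolding K_def by (intro compact_UN I)
  moreover have "K \<noteq> {}" using inside[of i0 0 x0] start T1 by auto
  moreover have "continuous_on K fst" by (intro continuous_intros)
  ultimately obtain p where p: "p \<in> K" "\<And>q. q \<in> K \<Longrightarrow> fst q \<le> fst p"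
    using continuous_attains_sup[of K fst] by blast
  define t where "t = fst p"
  obtain i1 where i1: "i1 \<in> I" "0 \<le> t" "t \<le> T1" "snd p \<in> {-L..L}" "Y i1 t (snd p) \<le> m - e * t"
    using p(1) by (auto simp: K_def t_def)
  have "t = T1"
  proof (rule ccontr)
    assume "t \<noteq> T1"
    then have tT: "t < T1" using i1 by simp
    define Q where "Q = I \<times> {-L..L}"
    have "\<exists>x\<in>{-L..L}. \<forall>y\<in>{-L..L}. Y i t x \<le> Y i t y" if "i \<in> I" for i
    proof (rule continuous_attains_inf)
      show "continuous_on {-L..L} (Y i t)" by (rule cont2_x[OF cont(2)[OF that]]) (use i1 T1 in auto)
    qed (use i1 in auto)
    then obtain X where X: "\<And>i. i \<in> I \<Longrightarrow> X i \<in> {-L..L}" "\<And>i y. i \<in> I \<Longrightarrow> y \<in> {-L..L} \<Longrightarrow> Y i t (X i) \<le> Y i t y"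
      by metis
    have "\<exists>i\<in>I. \<forall>j\<in>I. Y i t (X i) \<le> Y j t (X j)"
    proof -
      have "Min ((\<lambda>i. Y i t (X i)) ` I) \<in> (\<lambda>i. Y i t (X i)) ` I" using I i1(1) by (intro Min_in) auto
      then obtain i where "i \<in> I" "Y i t (X i) = Min ((\<lambda>i. Y i t (X i)) ` I)" by auto
      then show ?thesis using I by (intro bexI[of _ i]) auto
    qed
    then obtain i where i: "i \<in> I" "\<And>j. j \<in> I \<Longrightarrow> Y i t (X i) \<le> Y j t (X j)" by blast
    define x where "x = X i"
    have le: "Y i t x \<le> m - e * t"
      using i(2)[OF i1(1)] X(2)[OF i1(1) i1(4)] i1(5) by (simp add: x_def)
    have min: "Y i t x \<le> Y j t y" if "j \<in> I" for j y
    proof (cases "L < \<bar>y\<bar>")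
      case True
      have "0 \<le> e * t" using e i1 by simp
      then show ?thesis using out[OF that i1(2,3) True] le by linarith
    next
      case False
      then have "y \<in> {-L..L}" by (auto simp: abs_if split: if_splits)
      then show ?thesis using X(2)[OF that] i(2)[OF that] by (force simp: x_def)
    qed
    have F: "F i t x < - e" by (rule step[OF i(1) i1(2) tT min le])
    have td': "tder Tm (c i) (\<lambda>t x. Y i t x + e * t) (\<lambda>t x. F i t x + (e * 1 + c i t x * (e * 0)))"
      by (rule tder_add_C1[OF td[OF i(1)] C1_with_cmult[OF C1_with_time]])
    have "\<exists>t' x'. t < t' \<and> t' < t + (T1 - t) \<and> t' < Tm \<and> Y i t' x' + e * t' < Y i t x + e * t"
      by (rule tder_descent[OF td' cont(1)[OF i(1)]])
        (use min[OF i(1)] F i1 tT T1 in \<open>auto intro!: continuous_intros cont i\<close>)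
    then obtain t' x' where t': "t < t'" "t' < T1" "Y i t' x' + e * t' < Y i t x + e * t" by auto
    then have "(t', x') \<in> K" using inside[of i t' x'] i i1 le by auto
    then show False using p(2)[of "(t', x')"] t' by (simp add: t_def)
  qed
  then show ?thesis using i1 by auto
qed

context flow begin

lemma ZZ_cont: "cont2 Tm (ZZ s)"
proof -
  have "cont2 Tm (\<lambda>t x. h t x powr ((g - 3) / 2))" by (rule C1_with_cont(1)[OF h_powr_C1])
  then show ?thesis unfolding ZZ_def
    by (intro continuous_on_mult continuous_on_add continuous_on_real_sqrt continuous_on_const
        C1_with_cont[OF uC] C1_with_cont[OF hC])
qed

lemma FZ_cont: "cont2 Tm (FZ s)"
proof (rule continuous_on_eq)
  show "cont2 Tm (\<lambda>t x. sqrt (h t x) * (vx t x - (g + 1) / 4 * (ZZ s t x)\<^sup>2 + (g - 1) / 4 * ZZ s t x * ZZ (- s) t x))"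
    by (intro continuous_intros C1_with_cont[OF vC] C1_with_cont[OF hC] ZZ_cont)
  show "p \<in> strip Tm \<Longrightarrow> sqrt (h (fst p) (snd p)) * (vx (fst p) (snd p) - (g + 1) / 4 * (ZZ s (fst p) (snd p))\<^sup>2 + (g - 1) / 4 * ZZ s (fst p) (snd p) * ZZ (- s) (fst p) (snd p))
     = FZ s (fst p) (snd p)" for p
  proof -
    assume "p \<in> strip Tm"
    then have "vx (fst p) (snd p) = om (snd p) - 1 / h (fst p) (snd p)"
      using vorticity[of "fst p" "snd p"] by auto
    then show ?thesis by (simp only: FZ_def)
  qed
qed

lemma ZZ_out: "0 \<le> t \<Longrightarrow> t < Tm \<Longrightarrow> LL \<le> \<bar>x\<bar> \<Longrightarrow> ZZ s t x = 0"
  using dx_out[of t x] by (simp add: ZZ_def)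

lemma cc_cont: "cont2 Tm (\<lambda>t x. s * cc t x)" by (rule C1_with_cont(1)[OF cc_C1])

lemma dh_char:
  assumes t: "0 \<le> t" "t < Tm"
  shows "ht t x + s * cc t x * hx t x = - (h t x * sqrt (h t x) * ZZ (- s) t x)"
proof -
  have hp: "0 < h t x" by (rule h_pos[OF t])
  have "cc t x = (h t x)\<^sup>2 * h t x powr ((g - 3) / 2)"
  proof -
    have e: "(g + 1) / 2 = 2 + (g - 3) / 2" by (simp add: field_simps)
    show ?thesis unfolding cc_def e powr_add using hp by simp
  qed
  moreover have "h t x * sqrt (h t x) * ZZ (- s) t x = (h t x)\<^sup>2 * (ux t x - s * h t x powr ((g - 3) / 2) * hx t x)"
    using hp by (simp add: ZZ_def power2_eq_square algebra_simps)
  ultimately show ?thesis unfolding eq_h[OF t] by (simp add: algebra_simps)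
qed

text \<open>Where the square dominates the product, the two coefficients combine to -(\<gamma> + 1)
  / 4 + (\<gamma> - 1) / 4 = -1/2, independent of \<gamma>.\<close>

lemma FZ_le:
  assumes t: "0 \<le> t" "t < Tm" and w: "om x \<le> w" and Z: "ZZ s t x * ZZ (- s) t x \<le> (ZZ s t x)\<^sup>2"
  shows "FZ s t x \<le> sqrt (h t x) * (w - 1 / h t x - (ZZ s t x)\<^sup>2 / 2)"
  unfolding FZ_def
proof (rule mult_left_mono)
  have "(g - 1) / 4 * (ZZ s t x * ZZ (- s) t x) \<le> (g - 1) / 4 * (ZZ s t x)\<^sup>2"
    using Z g1 by (intro mult_left_mono) auto
  then show "om x - 1 / h t x - (g + 1) / 4 * (ZZ s t x)\<^sup>2 + (g - 1) / 4 * ZZ s t x * ZZ (- s) t x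
     \<le> w - 1 / h t x - (ZZ s t x)\<^sup>2 / 2"
    using w by (simp add: field_simps)
  show "0 \<le> sqrt (h t x)" using h_pos[OF t, of x] by simp
qed

text \<open>At a space-time maximum above M, taken over both families, w - Z^2 / 2 is negative and
  1/h only helps. The derivative along the characteristic is therefore negative, and a larger value
  would occur earlier.\<close>

lemma ZZ_upper:
  assumes w: "\<And>x. om x \<le> w" "1 \<le> w" and M: "sqrt (2 * w) \<le> M" and M0: "\<And>s x. s \<in> {1, -1} \<Longrightarrow> ZZ s 0 x \<le> M"
    and t: "0 \<le> t" "t < Tm" and s: "s \<in> {1, -1}"
  shows "ZZ s t x \<le> M"
proof (rule ccontr)
  assume gt: "\<not> ZZ s t x \<le> M"
  have Mp: "0 < M" using M w(2) by (meson less_le_trans mult_pos_pos real_sqrt_gt_zero zero_less_numeral zero_less_one)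
  let ?B = "{0..t} \<times> {-LL..LL}"
  have "\<exists>p\<in>?B. \<forall>q\<in>?B. max (ZZ 1 (fst q) (snd q)) (ZZ (-1) (fst q) (snd q)) \<le> max (ZZ 1 (fst p) (snd p)) (ZZ (-1) (fst p) (snd p))"
  proof (rule continuous_attains_sup)
    show "continuous_on ?B (\<lambda>q. max (ZZ 1 (fst q) (snd q)) (ZZ (-1) (fst q) (snd q)))"
      by (intro continuous_intros continuous_on_subset[OF ZZ_cont]) (use t in auto)
  qed (use t LL_pos in \<open>auto intro!: compact_Times\<close>)
  then obtain t1 x1 where p: "t1 \<in> {0..t}" "x1 \<in> {-LL..LL}"
    "\<And>t' x'. t' \<in> {0..t} \<Longrightarrow> x' \<in> {-LL..LL} \<Longrightarrow> max (ZZ 1 t' x') (ZZ (-1) t' x') \<le> max (ZZ 1 t1 x1) (ZZ (-1) t1 x1)"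
    by force
  obtain k where k: "k \<in> {1, -1}" "max (ZZ 1 t1 x1) (ZZ (-1) t1 x1) = ZZ k t1 x1"
    by (metis insertCI max_def)
  have in_box: "ZZ j t' x' \<le> ZZ k t1 x1" if "t' \<in> {0..t}" "x' \<in> {-LL..LL}" "j \<in> {1, -1}" for j t' x'
    using p(3)[OF that(1,2)] k that(3) by auto
  have "x \<in> {-LL..LL}"
  proof (rule ccontr)
    assume "x \<notin> {-LL..LL}"
    then have "LL \<le> \<bar>x\<bar>" by auto
    then show False using ZZ_out[OF t, of x s] gt Mp by simp
  qed
  then have big: "M < ZZ k t1 x1" using in_box[of t x s] gt s t by force
  have t1: "0 \<le> t1" "t1 < Tm" "t1 \<le> t" using p t by auto
  have all: "ZZ j t' x' \<le> ZZ k t1 x1" if "t' \<in> {0..t}" "j \<in> {1, -1}" for j t' x'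
  proof (cases "LL \<le> \<bar>x'\<bar>")
    case True
    then show ?thesis using ZZ_out[of t' x' j] that t big Mp by simp
  next
    case False
    then show ?thesis using in_box[of t' x' j] that by (auto simp: abs_if split: if_splits)
  qed
  have "t1 \<noteq> 0" using M0[OF k(1), of x1] big by auto
  then have t1p: "0 < t1" using t1 by simp
  have neg: "FZ k t1 x1 < 0"
  proof -
    have "- k \<in> {1, -1}" using k by auto
    then have "ZZ (- k) t1 x1 \<le> ZZ k t1 x1" using all[of t1 "-k" x1] t1 by auto
    then have "ZZ k t1 x1 * ZZ (- k) t1 x1 \<le> (ZZ k t1 x1)\<^sup>2"
      unfolding power2_eq_square using big Mp by (intro mult_left_mono) auto
    from FZ_le[OF t1(1,2) w(1) this] have "FZ k t1 x1 \<le> sqrt (h t1 x1) * (w - 1 / h t1 x1 - (ZZ k t1 x1)\<^sup>2 / 2)" .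
    also have "\<dots> < 0"
    proof (rule mult_pos_neg)
      have "(sqrt (2 * w))\<^sup>2 \<le> (ZZ k t1 x1)\<^sup>2" using M big w by (intro power_mono) auto
      then have "2 * w \<le> (ZZ k t1 x1)\<^sup>2" using w(2) by simp
      moreover have "0 < 1 / h t1 x1" using h_pos[OF t1(1,2)] by simp
      ultimately show "w - 1 / h t1 x1 - (ZZ k t1 x1)\<^sup>2 / 2 < 0" by linarith
    qed (use h_pos[OF t1(1,2)] in simp)
    finally show ?thesis .
  qed
  have "k * k = 1" using k by auto
  from tder_ascent_backward[OF Z_transport[OF this] cc_cont FZ_cont t1p t1(2) _ neg]
  obtain t' x' where "0 \<le> t'" "t' < t1" "ZZ k t1 x1 < ZZ k t' x'"
    using all[OF _ k(1), of t1] t1 by auto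
  then show False using all[OF _ k(1), of t' x'] t1 by auto
qed

text \<open>The x-derivative of \<open>yy\<close> is \<gamma>/4 (Z_2 - Z_1), and \<open>qfun\<close>
  is \<gamma>^2/2 times a part of the energy density. So the amplitude, being 0 in the far field,
  grows no faster than a multiple of the energy accumulated from either end.\<close>

lemma amplitude_le_energy:
  assumes t: "0 \<le> t" "t < Tm" and Z: "\<And>x. \<bar>ZZ 1 t x - ZZ (-1) t x\<bar> \<le> G"
  shows "\<bar>prim1 (qfun g) (yy t x)\<bar> \<le> g ^ 3 / 8 * G * NL t x"
    "\<bar>prim1 (qfun g) (yy t x)\<bar> \<le> g ^ 3 / 8 * G * (EE - NL t x)"
proof -
  let ?A = "\<lambda>x. prim1 (qfun g) (yy t x)" and ?k = "g ^ 3 / 8 * G"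
  let ?dy = "\<lambda>x. g / 2 * h t x powr (g / 2 - 1) * hx t x"
  have dA: "(?A has_real_derivative qfun g (yy t x) * ?dy x) (at x)" for x
    by (rule DERIV_chain2[OF af_deriv[OF yy_pos[OF t]] C1_with_dx[OF yy_C1 t]])
  have bound: "\<bar>qfun g (yy t x) * ?dy x\<bar> \<le> ?k * en t x" for x
  proof -
    have hp: "0 < h t x" by (rule h_pos[OF t])
    have e: "g / 2 - 1 = 1 / 2 + (g - 3) / 2" by (simp add: field_simps)
    have "h t x powr (g / 2 - 1) = sqrt (h t x) * h t x powr ((g - 3) / 2)"
      unfolding e powr_add using hp by (simp add: powr_half_sqrt)
    then have "?dy x = g / 4 * (ZZ 1 t x - ZZ (-1) t x)" by (simp add: ZZ_def algebra_simps)
    then have d: "\<bar>?dy x\<bar> \<le> g / 4 * G" using Z[of x] g1 by (simp add: abs_mult)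
    have q0: "0 \<le> qfun g (yy t x)" by (rule qf_nonneg[OF yy_pos[OF t]])
    have "qfun g (yy t x) = g\<^sup>2 / 2 * Qpot g (h t x)" using Qpot_alt[OF t, of x] g1 by simp
    also have "\<dots> \<le> g\<^sup>2 / 2 * en t x" unfolding en_def by (intro mult_left_mono) auto
    finally have "qfun g (yy t x) \<le> g\<^sup>2 / 2 * en t x" .
    then have "\<bar>qfun g (yy t x) * ?dy x\<bar> \<le> g\<^sup>2 / 2 * en t x * (g / 4 * G)"
      unfolding abs_mult[of "qfun g (yy t x)"] using d q0 en_nonneg[OF t] by (intro mult_mono) auto
    then show ?thesis by (simp add: power2_eq_square power3_eq_cube mult_ac)
  qed
  have mono: "?k * NL t a + \<sigma> * ?A a \<le> ?k * NL t b + \<sigma> * ?A b" if "a \<le> b" "\<sigma> = 1 \<or> \<sigma> = -1" for a b \<sigma>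
  proof (rule nondecreasing_from_deriv[OF that(1)])
    fix z
    show "((\<lambda>z. ?k * NL t z + \<sigma> * ?A z) has_real_derivative ?k * en t z + \<sigma> * (qfun g (yy t z) * ?dy z)) (at z)"
      by (intro DERIV_add DERIV_cmult NL_dx t dA)
    have "qfun g (yy t z) * ?dy z \<le> ?k * en t z" "- (qfun g (yy t z) * ?dy z) \<le> ?k * en t z"
      using bound[of z] unfolding abs_le_iff by blast+
    moreover have "0 \<le> K + \<sigma> * X" if "X \<le> K" "- X \<le> K" for X K :: real
      using that \<open>\<sigma> = 1 \<or> \<sigma> = -1\<close> by auto
    ultimately show "0 \<le> ?k * en t z + \<sigma> * (qfun g (yy t z) * ?dy z)" by blast
  qed
  have ends: "?A z = 0" if "LL \<le> \<bar>z\<bar>" for z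
    using trivial_out(1)[OF t, of z] that by (simp add: yy_def)
  define a b where "a = min x (-LL)" and "b = max x LL"
  have a: "a \<le> x" "LL \<le> \<bar>a\<bar>" "NL t a = 0" using LL_pos NL_left[OF t, of a] by (auto simp: a_def)
  have b: "x \<le> b" "LL \<le> \<bar>b\<bar>" "NL t b = EE" using LL_pos NL_right[OF t, of b] by (auto simp: b_def)
  show "\<bar>?A x\<bar> \<le> ?k * NL t x"
    using mono[OF a(1), of 1] mono[OF a(1), of "-1"] ends[OF a(2)] a(3) by (simp add: abs_le_iff)
  show "\<bar>?A x\<bar> \<le> ?k * (EE - NL t x)"
    using mono[OF b(1), of 1] mono[OF b(1), of "-1"] ends[OF b(2)] b(3)
    by (simp add: abs_le_iff right_diff_distrib)
qed

text \<open>For a point moving at speed c, the energy ahead changes by the flux minus c times the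
  density. Young's inequality in u, balanced with c = \<open>sqrt h * yy\<close>, eliminates the
  velocity and leaves \<open>St\<close>.\<close>

lemma flux_bound:
  assumes t: "0 \<le> t" "t < Tm"
  shows "\<bar>u t x * PR t x\<bar> - cc t x * en t x \<le> - (sqrt (h t x) * (2 / g\<^sup>2 * St (yy t x)))"
proof -
  define y S P where "y = yy t x" and "S = sqrt (h t x)" and "P = PR t x"
  have y: "0 < y" using yy_pos[OF t] by (simp add: y_def)
  have S: "0 < S" "S\<^sup>2 = h t x" using h_pos[OF t, of x] by (auto simp: S_def)
  have yp: "pp y = 1 / (y * S\<^sup>2)"
    using yy_powr[OF t, of x] y S unfolding y_def[symmetric] pp_def
    by (simp add: powr_diff powr_minus_divide)
  have P2: "P\<^sup>2 = (y\<^sup>2 - 1)\<^sup>2 / g\<^sup>2" by (simp add: P_def PR_alt[OF t] y_def power_divide)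
  have "S * (2 / g\<^sup>2 * St y) = S * y * (2 / g\<^sup>2 * qfun g y) - P\<^sup>2 / (2 * (S * y))"
    unfolding St_def yp P2 using S(1) y g1 by (simp add: field_simps power2_eq_square)
  moreover have "cc t x * en t x = S * y * ((u t x)\<^sup>2 / 2) + S * y * ((v t x)\<^sup>2 / 2) + S * y * (2 / g\<^sup>2 * qfun g y)"
    unfolding cc_alt[OF t] en_def Qpot_alt[OF t] S_def y_def by (simp add: field_simps)
  moreover have "0 \<le> S * y * ((v t x)\<^sup>2 / 2)" using S y by simp
  moreover have "\<bar>u t x * P\<bar> \<le> S * y * ((u t x)\<^sup>2 / 2) + P\<^sup>2 / (2 * (S * y))"
  proof -
    define k where "k = S * y"
    have k: "0 < k" using S y by (simp add: k_def)
    have "0 \<le> (k * \<bar>u t x\<bar> - \<bar>P\<bar>)\<^sup>2 / (2 * k)" using k by simp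
    also have "\<dots> = k * ((u t x)\<^sup>2 / 2) + P\<^sup>2 / (2 * k) - \<bar>u t x * P\<bar>"
      using k by (simp add: power2_diff power_mult_distrib abs_mult field_simps power2_eq_square)
    finally show ?thesis by (simp add: k_def)
  qed
  ultimately show ?thesis unfolding S_def[symmetric] y_def[symmetric] P_def[symmetric] by linarith
qed

end

section \<open>The barrier\<close>

text \<open>The setting of a contradiction: up to \<open>T1\<close> no Z_j has reached the
  threshold. The level m - e0 t / 20 falls to -2 sqrt(2 w) at \<open>T1\<close>; the factor 2 leaves
  room for the modified barrier functions, which may lie below Z_j. The 20 comes from sqrt h \<ge>
  1/10 in the potential barrier, with the rate halved to make the inequality strict.\<close>

locale small_data_escape = flow +
  fixes w M m yF T1 :: real
  assumes w: "\<And>x. om x \<le> w" and w1: "1 \<le> w"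
    and M: "sqrt (2 * w) \<le> M" and M0: "\<And>s x. s \<in> {1, -1} \<Longrightarrow> ZZ s 0 x \<le> M"
    and EE_pos: "0 < EE"
    and yF: "1 < yF" and GE: "(M + sqrt (2 * w)) * EE = 16 / (3 * g ^ 3) * Fh yF"
    and start: "\<exists>s\<in>{1, -1}. \<exists>x. ZZ s 0 x \<le> m"
    and m: "- sqrt (2 * w) < m" "m < 0"
    and e0: "0 < m\<^sup>2 / 2 - w + yF powr (- (2 / g))"
    and T1_def: "T1 = 20 * (m + 2 * sqrt (2 * w)) / (m\<^sup>2 / 2 - w + yF powr (- (2 / g)))"
    and T1_less: "T1 < Tm"
    and lower: "\<And>t s x. 0 \<le> t \<Longrightarrow> t \<le> T1 \<Longrightarrow> s \<in> {1, -1} \<Longrightarrow> - sqrt (2 * w) < ZZ s t x"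
begin

abbreviation "sl \<equiv> sqrt (2 * w)"
abbreviation "G \<equiv> M + sl"
abbreviation "e0 \<equiv> m\<^sup>2 / 2 - w + yF powr (- (2 / g))"

lemma sl: "sl\<^sup>2 = 2 * w" "1 < sl" "2 * sl \<le> G" "0 < G"
proof -
  show a: "sl\<^sup>2 = 2 * w" using w1 by simp
  show b: "1 < sl" using w1 by simp
  show "2 * sl \<le> G" using M by simp
  then show "0 < G" using b by linarith
qed

lemma T1_nonneg: "0 \<le> T1" "m - e0 / 20 * T1 = - 2 * sl"
proof -
  have "0 \<le> m + 2 * sl" using m sl(2) by linarith
  then show "0 \<le> T1" using e0 by (simp add: T1_def)
  have "d / 20 * (20 * k / d) = k" if "0 < d" for d k :: real using that by simp
  from this[OF e0, of "m + 2 * sl"] show "m - e0 / 20 * T1 = - 2 * sl" by (simp only: T1_def)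
qed

definition HF :: real where "HF = yF powr (2 / g)"

lemma HF: "1 < HF" "1 / HF = yF powr (- (2 / g))"
  using yF g1 by (auto simp: HF_def powr_minus_divide)

lemma h_le_HF_iff: "0 \<le> t \<Longrightarrow> t < Tm \<Longrightarrow> h t x \<le> HF \<longleftrightarrow> yy t x \<le> yF"
proof -
  assume t: "0 \<le> t" "t < Tm"
  show ?thesis
  proof
    assume "yy t x \<le> yF"
    then have "yy t x powr (2 / g) \<le> yF powr (2 / g)"
      using g1 yy_pos[OF t, of x] by (intro powr_mono2) auto
    then show "h t x \<le> HF" by (simp add: yy_powr[OF t] HF_def)
  next
    assume le: "h t x \<le> HF"
    show "yy t x \<le> yF"
    proof (rule ccontr)
      assume "\<not> yy t x \<le> yF"
      then have "yF powr (2 / g) < yy t x powr (2 / g)" using g1 yF by (intro powr_less_mono2) auto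
      then show False using le by (simp add: yy_powr[OF t] HF_def)
    qed
  qed
qed

lemma inv_h: "0 \<le> t \<Longrightarrow> t < Tm \<Longrightarrow> 1 / h t x = yy t x powr (- (2 / g))"
  using yy_pos[of t x] by (simp add: powr_minus_divide yy_powr)

text \<open>The fraction of the energy ahead of \<open>x\<close> for a point moving with velocity \<open>s c\<close>, since \<open>NL\<close> is the energy to the left
  of \<open>x\<close>.\<close>
definition nn :: "real \<Rightarrow> real \<Rightarrow> real \<Rightarrow> real" where "nn s t x = (1 + s) / 2 + (- s / EE) * NL t x"

lemma nn: assumes "0 \<le> t" "t < Tm" "s \<in> {1, -1}"
  shows "0 \<le> nn s t x" "nn (- s) t x = 1 - nn s t x"
  using assms NL_range[OF assms(1,2), of x] EE_pos by (auto simp: nn_def field_simps)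

lemma amplitude_le_nn:
  assumes t: "0 \<le> t" "t \<le> T1" and s: "s \<in> {1, -1}"
  shows "\<bar>prim1 (qfun g) (yy t x)\<bar> \<le> 2 / 3 * Fh yF * nn s t x"
    "\<bar>prim1 (qfun g) (yy t x)\<bar> \<le> 2 / 3 * Fh yF * (1 - nn s t x)"
proof -
  have tT: "t < Tm" using t T1_less by simp
  have Z: "\<bar>ZZ 1 t x - ZZ (- 1) t x\<bar> \<le> G" for x
    using ZZ_upper[OF w w1 M M0 t(1) tT, of 1 x] ZZ_upper[OF w w1 M M0 t(1) tT, of "-1" x]
      lower[OF t, of 1 x] lower[OF t, of "-1" x] by (auto simp: abs_le_iff)
  have k: "g ^ 3 / 8 * G * N = 2 / 3 * Fh yF * (N / EE)" for N
  proof -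
    have "g ^ 3 / 8 * G * N = g ^ 3 / 8 * (G * EE) * (N / EE)" using EE_pos by simp
    also have "\<dots> = 2 / 3 * Fh yF * (N / EE)" unfolding GE using g1 by simp
    finally show ?thesis .
  qed
  have a: "\<bar>prim1 (qfun g) (yy t x)\<bar> \<le> 2 / 3 * Fh yF * (NL t x / EE)"
    "\<bar>prim1 (qfun g) (yy t x)\<bar> \<le> 2 / 3 * Fh yF * ((EE - NL t x) / EE)"
    using amplitude_le_energy[OF t(1) tT Z, of x] unfolding k by auto
  have "nn 1 t x = (EE - NL t x) / EE" "nn (-1) t x = NL t x / EE" using EE_pos by (auto simp: nn_def field_simps)
  moreover have "1 - (EE - NL t x) / EE = NL t x / EE" "1 - NL t x / EE = (EE - NL t x) / EE"
    using EE_pos by (auto simp: field_simps)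
  ultimately show "\<bar>prim1 (qfun g) (yy t x)\<bar> \<le> 2 / 3 * Fh yF * nn s t x"
    "\<bar>prim1 (qfun g) (yy t x)\<bar> \<le> 2 / 3 * Fh yF * (1 - nn s t x)"
    using s a by (auto simp only: insert_iff empty_iff)
qed

lemma amplitude_le_third: "0 \<le> t \<Longrightarrow> t \<le> T1 \<Longrightarrow> prim1 (qfun g) (yy t x) \<le> Fh yF / 3"
  using amplitude_le_nn[of t 1 x] by (simp add: abs_le_iff algebra_simps)

lemma m_squared: "m\<^sup>2 / 2 = e0 + w - 1 / HF" "m\<^sup>2 < 2 * w"
proof -
  show "m\<^sup>2 / 2 = e0 + w - 1 / HF" by (simp add: HF(2))
  have "m\<^sup>2 < sl\<^sup>2" using m by (intro power2_strict_mono) auto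
  then show "m\<^sup>2 < 2 * w" by (simp only: sl(1))
qed

text \<open>sqrt h (1/H - e0) - 1 / sqrt h increases with h, because 1/H - e0 = w - m^2/2 > 0, so h
  = H is the worst case.\<close>

lemma branch_low:
  assumes t: "0 \<le> t" "t \<le> T1" and z: "ZZ s t x \<le> m" "ZZ s t x \<le> ZZ (- s) t x" and h: "h t x \<le> HF"
  shows "FZ s t x \<le> - e0"
proof -
  have tT: "t < Tm" using t T1_less by simp
  define S where "S = sqrt (h t x)"
  have S: "0 < S" "S\<^sup>2 = h t x" using h_pos[OF t(1) tT, of x] by (auto simp: S_def)
  have "ZZ s t x * ZZ (- s) t x \<le> (ZZ s t x)\<^sup>2"
    unfolding power2_eq_square using z m by (intro mult_left_mono_neg) auto
  from FZ_le[OF t(1) tT w this] have "FZ s t x \<le> S * (w - 1 / S\<^sup>2 - (ZZ s t x)\<^sup>2 / 2)"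
    by (simp add: S_def[symmetric] S(2))
  also have "\<dots> \<le> S * (w - 1 / S\<^sup>2 - m\<^sup>2 / 2)"
  proof -
    have "m\<^sup>2 \<le> (ZZ s t x)\<^sup>2" using z m by (simp add: abs_le_square_iff[symmetric])
    then show ?thesis using S by (intro mult_left_mono) auto
  qed
  also have "\<dots> = S * (1 / HF - e0) - 1 / S"
    using S(1) m_squared(1) by (simp add: field_simps power2_eq_square)
  also have "\<dots> \<le> sqrt HF * (1 / HF - e0) - 1 / sqrt HF"
  proof -
    have "S \<le> sqrt HF" using h by (simp add: S_def)
    moreover have "0 \<le> 1 / HF - e0" using m_squared by linarith
    ultimately have "S * (1 / HF - e0) \<le> sqrt HF * (1 / HF - e0)" "1 / sqrt HF \<le> 1 / S"
      using S(1) HF(1) by (auto intro!: mult_right_mono divide_left_mono)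
    then show ?thesis by linarith
  qed
  also have "\<dots> = - (sqrt HF * e0)" using HF(1) by (simp add: field_simps real_sqrt_divide[symmetric] real_div_sqrt)
  also have "\<dots> \<le> - e0"
  proof -
    have "1 * e0 \<le> sqrt HF * e0" using HF(1) e0 by (intro mult_right_mono) auto
    then show ?thesis by simp
  qed
  finally show ?thesis .
qed

text \<open>The minimum is taken over the four functions \<open>Z\<^sub>j\<close> and \<open>Z\<^sub>j (h / H)\<^bsup>b\<^esup>\<close>. Which kind attains it tells whether
  \<open>h \<le> H\<close> or \<open>h \<ge> H\<close>.\<close>
lemma no_escape_weight:
  assumes b: "0 \<le> b" "b \<le> (g - 1) / 4" "b \<le> 1 / 2"
    and wt: "\<And>y. yF \<le> y \<Longrightarrow> prim1 (qfun g) y \<le> Fh yF / 3 \<Longrightarrow>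
      (1 - y powr (- (2 / g))) * (y / yF) powr (2 * b * (2 / g)) \<le> (1 + 2 * b) * (1 - yF powr (- (2 / g)))"
  shows False
proof -
  define A where "A t x = (h t x / HF) powr b" for t x
  have weight: "(1 - 1 / h t x) * (A t x)\<^sup>2 \<le> (1 + 2 * b) * (1 - 1 / HF)" "(A t x)\<^sup>2 \<le> 1 + 2 * b"
    if t: "0 \<le> t" "t \<le> T1" and hH: "HF \<le> h t x" for t x
  proof -
    have tT: "t < Tm" using t T1_less by simp
    have yy: "yF \<le> yy t x"
    proof (rule ccontr)
      assume "\<not> yF \<le> yy t x"
      then have "yy t x powr (2 / g) < yF powr (2 / g)"
        using g1 yy_pos[OF t(1) tT, of x] by (intro powr_less_mono2) auto
      then show False using hH by (simp add: yy_powr[OF t(1) tT] HF_def)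
    qed
    have "h t x / HF = (yy t x / yF) powr (2 / g)"
      using yF yy by (simp add: HF_def powr_divide yy_powr[OF t(1) tT])
    then have "A t x = (yy t x / yF) powr (2 / g * b)" by (simp add: A_def powr_powr)
    then have "(A t x)\<^sup>2 = (yy t x / yF) powr (2 * b * (2 / g))"
      by (simp add: power2_eq_square mult_ac flip: powr_add)
    then show W: "(1 - 1 / h t x) * (A t x)\<^sup>2 \<le> (1 + 2 * b) * (1 - 1 / HF)"
      using wt[OF yy amplitude_le_third[OF t]] by (simp only: HF(2) inv_h[OF t(1) tT])
    have "(1 - 1 / HF) * (A t x)\<^sup>2 \<le> (1 - 1 / h t x) * (A t x)\<^sup>2"
      using hH HF(1) by (intro mult_right_mono diff_left_mono divide_left_mono) auto
    then have "(1 - 1 / HF) * (A t x)\<^sup>2 \<le> (1 - 1 / HF) * (1 + 2 * b)" using W by (simp add: mult.commute)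
    then show "(A t x)\<^sup>2 \<le> 1 + 2 * b" using HF(1) by (simp add: mult_le_cancel_left_pos)
  qed
  have A_alt: "A t x = HF powr (- b) * h t x powr b" if "0 \<le> t" "t < Tm" for t x
    using h_pos[OF that, of x] HF(1) by (simp add: A_def powr_divide powr_minus_divide)
  have AC: "C1_with (strip Tm) (\<lambda>t x. HF powr (- b) * h t x powr b)
     (\<lambda>t x. HF powr (- b) * (b * h t x powr (b - 1) * ht t x)) (\<lambda>t x. HF powr (- b) * (b * h t x powr (b - 1) * hx t x))"
    by (intro C1_with_cmult h_powr_C1)
  let ?Y = "\<lambda>i t x. if snd i then HF powr (- b) * h t x powr b * ZZ (fst i) t x else ZZ (fst i) t x"
  let ?Fb = "\<lambda>s t x. HF powr (- b) * h t x powr b * FZ s t x +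
     (HF powr (- b) * (b * h t x powr (b - 1) * ht t x) + s * cc t x * (HF powr (- b) * (b * h t x powr (b - 1) * hx t x))) * ZZ s t x"
  let ?F = "\<lambda>i t x. if snd i then ?Fb (fst i) t x else FZ (fst i) t x"
  \<comment> \<open>By \<open>dh_char\<close>, h changes along a characteristic at a rate given by
    the other Z. So the weight lowers the coefficient of the product from (\<gamma> - 1) / 4 to
    (\<gamma> - 1) / 4 - b.\<close>
  have Fb: "?Fb s t x = A t x * (FZ s t x - b * sqrt (h t x) * (ZZ (- s) t x * ZZ s t x))" if t: "0 \<le> t" "t < Tm" for s t x
  proof -
    have hp: "0 < h t x" by (rule h_pos[OF t])
    have p: "h t x powr (b - 1) * h t x = h t x powr b" using hp by (simp add: powr_diff)
    have "HF powr (- b) * (b * h t x powr (b - 1) * ht t x) + s * cc t x * (HF powr (- b) * (b * h t x powr (b - 1) * hx t x))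
       = HF powr (- b) * b * h t x powr (b - 1) * (ht t x + s * cc t x * hx t x)" by (simp add: algebra_simps)
    also have "\<dots> = - (HF powr (- b) * b * (h t x powr (b - 1) * h t x) * sqrt (h t x) * ZZ (- s) t x)"
      unfolding dh_char[OF t] by (simp add: mult_ac)
    finally show ?thesis unfolding p A_alt[OF t] by (simp add: algebra_simps)
  qed
  obtain s0 x0 where s0: "s0 \<in> {1, -1}" "ZZ s0 0 x0 \<le> m" using start by blast
  have "\<exists>i\<in>{1, -1} \<times> UNIV. \<exists>x. ?Y i T1 x \<le> m - e0 / 20 * T1"
  proof (rule minimum_principle[where c="\<lambda>i t x. fst i * cc t x" and F="?F" and L=LL and ?i0.0="(s0, False)" and ?x0.0=x0])
    show "finite ({1, -1 :: real} \<times> (UNIV :: bool set))" by simp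
    show "0 \<le> T1" "T1 < Tm" "0 \<le> e0 / 20" using T1_nonneg T1_less e0 by auto
    show "(s0, False) \<in> {1, -1} \<times> UNIV" using s0 by simp
    show "?Y (s0, False) 0 x0 \<le> m" using s0 by simp
    fix i :: "real \<times> bool" assume i: "i \<in> {1, -1} \<times> UNIV"
    then have ss: "fst i * fst i = 1" by auto
    show "tder Tm (\<lambda>t x. fst i * cc t x) (?Y i) (?F i)"
    proof (cases "snd i")
      case True
      then show ?thesis using tder_mult_C1[OF Z_transport[OF ss] AC cc_cont] by simp
    next
      case False
      then show ?thesis using Z_transport[OF ss] by simp
    qed
    show "cont2 Tm (\<lambda>t x. fst i * cc t x)" by (rule cc_cont)
    show "cont2 Tm (?Y i)"
      by (cases "snd i") (auto intro!: continuous_on_mult ZZ_cont continuous_on_const C1_with_cont(1)[OF h_powr_C1])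
    show "cont2 Tm (?F i)"
    proof (cases "snd i")
      case True
      have "cont2 Tm (?Fb (fst i))"
        by (intro continuous_on_mult[OF C1_with_cont(1)[OF AC] FZ_cont] continuous_on_add continuous_on_mult[OF _ ZZ_cont]
          C1_with_cont(2)[OF AC] continuous_on_mult[OF cc_cont C1_with_cont(3)[OF AC]])
      then show ?thesis using True by simp
    qed (simp add: FZ_cont)
    show "m < ?Y i t x" if "0 \<le> t" "t \<le> T1" "LL < \<bar>x\<bar>" for t x
      using ZZ_out[of t x "fst i"] that T1_less m by simp
    fix t x assume t: "0 \<le> t" "t < T1"
      and min: "\<And>j y. j \<in> {1, -1} \<times> UNIV \<Longrightarrow> ?Y i t x \<le> ?Y j t y" and le: "?Y i t x \<le> m - e0 / 20 * t"
    have tT: "t < Tm" "t \<le> T1" using t T1_less by auto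
    obtain s k where sk: "i = (s, k)" "s \<in> {1, -1}" using i by (cases i) auto
    have le': "?Y i t x \<le> m"
    proof -
      have "0 \<le> e0 / 20 * t" using e0 t by simp
      then show ?thesis using le by linarith
    qed
    have Ap: "0 < A t x" using h_pos[OF t(1) tT(1), of x] HF(1) by (simp add: A_def)
    have "- d < - (d / 20)" if "0 < d" for d :: real using that by simp
    from this[OF e0] have e20: "- e0 < - (e0 / 20)" .
    have ms: "- s \<in> {1, -1}" using sk by auto
    show "?F i t x < - (e0 / 20)"
    proof (cases k)
      case False
      have z: "ZZ s t x \<le> m" "ZZ s t x \<le> ZZ (- s) t x" "ZZ s t x \<le> A t x * ZZ s t x"
        using le' min[of "(- s, False)" x] min[of "(s, True)" x] sk ms False by (auto simp: A_alt[OF t(1) tT(1)])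
      have "A t x \<le> 1"
      proof (rule ccontr)
        assume "\<not> A t x \<le> 1"
        then have "A t x * ZZ s t x < 1 * ZZ s t x" using z(1) m by (intro mult_strict_right_mono_neg) auto
        then show False using z(3) by simp
      qed
      have "h t x \<le> HF \<or> b = 0"
      proof (rule ccontr)
        assume "\<not> (h t x \<le> HF \<or> b = 0)"
        then have "1 < A t x" unfolding A_def using b HF(1) by (intro gr_one_powr) (auto simp: field_simps)
        then show False using \<open>A t x \<le> 1\<close> by simp
      qed
      \<comment> \<open>For b = 0 the weight is 1 and says nothing about h; then the hypothesis on y
        itself excludes y > \<open>yF\<close>.\<close>
      moreover have "h t x \<le> HF" if "b = 0"
      proof (rule ccontr)
        assume gt: "\<not> h t x \<le> HF"
        then have gy: "yF < yy t x" using h_le_HF_iff[OF t(1) tT(1), of x] by simp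
        have "1 - yy t x powr (- (2 / g)) \<le> 1 - yF powr (- (2 / g))"
          using wt[of "yy t x"] amplitude_le_third[OF t(1) tT(2), of x] gy that yF by simp
        then have "1 / HF \<le> 1 / h t x" by (simp add: HF(2) inv_h[OF t(1) tT(1)])
        then show False using gt HF(1) h_pos[OF t(1) tT(1), of x] by (simp add: field_simps)
      qed
      ultimately have "h t x \<le> HF" by blast
      then show ?thesis using branch_low[OF t(1) tT(2) z(1,2)] e20 False sk by simp
    next
      case True
      have z: "A t x * ZZ s t x \<le> m" "A t x * ZZ s t x \<le> ZZ s t x" "A t x * ZZ s t x \<le> A t x * ZZ (- s) t x"
        using le' min[of "(- s, True)" x] min[of "(s, False)" x] sk ms True by (auto simp: A_alt[OF t(1) tT(1)])
      have zneg: "ZZ s t x < 0" using z(1) m Ap by (smt (verit) mult_nonneg_nonneg)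
      have zz: "ZZ s t x \<le> ZZ (- s) t x" using z(3) Ap by (simp add: mult_le_cancel_left_pos)
      have A1: "1 \<le> A t x"
      proof (rule ccontr)
        assume "\<not> 1 \<le> A t x"
        then have "1 * ZZ s t x < A t x * ZZ s t x" using zneg by (intro mult_strict_right_mono_neg) auto
        then show False using z(2) by simp
      qed
      show ?thesis
      proof (cases "b = 0")
        case True
        then have "A t x = 1" using h_pos[OF t(1) tT(1), of x] HF(1) by (simp add: A_def)
        have gy: "yy t x \<le> yF"
        proof (rule ccontr)
          assume "\<not> yy t x \<le> yF"
          then have gy: "yF < yy t x" by simp
          then have "1 - yy t x powr (- (2 / g)) \<le> 1 - yF powr (- (2 / g))"
            using wt[of "yy t x"] amplitude_le_third[OF t(1) tT(2), of x] True yF by simp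
          moreover have "yy t x powr (- (2 / g)) < yF powr (- (2 / g))"
            using gy yF g1 by (intro powr_less_mono2_neg) auto
          ultimately show False by simp
        qed
        then have "h t x \<le> HF" using h_le_HF_iff[OF t(1) tT(1)] by simp
        then have "FZ s t x \<le> - e0" using branch_low[OF t(1) tT(2) _ zz] z(1) \<open>A t x = 1\<close> by simp
        moreover have "?F i t x = FZ s t x"
        proof -
          have "?F i t x = A t x * (FZ s t x - b * sqrt (h t x) * (ZZ (- s) t x * ZZ s t x))"
            using Fb[OF t(1) tT(1), of x s] sk \<open>k\<close> by simp
          then show ?thesis using \<open>A t x = 1\<close> True by simp
        qed
        ultimately show ?thesis using e20 by simp
      next
        case False
        have hH: "HF \<le> h t x"
        proof (rule ccontr)
          assume "\<not> HF \<le> h t x"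
          then have "h t x / HF < 1" using HF(1) by simp
          then have "A t x < 1 powr b" unfolding A_def
            using b False h_pos[OF t(1) tT(1), of x] HF(1) by (intro powr_less_mono2) auto
          then show False using A1 by simp
        qed
        define \<Lambda> where "\<Lambda> = (A t x)\<^sup>2"
        have L1: "1 \<le> \<Lambda>" using A1 by (simp add: \<Lambda>_def)
        note W = weight[OF t(1) tT(2) hH, folded \<Lambda>_def]
        \<comment> \<open>The factor q \<ge> 1 relates h to H. Splitting w - 1/h into w - 1 \<ge> 0
          and 1 - 1/h reduces the comparison to the case w = 1, which is
          \<open>weight\<close>.\<close>
        define q where "q = (1 + 2 * b) / \<Lambda>"
        have q: "1 \<le> q" using W(2) L1 by (simp add: q_def)
        have "1 - 1 / h t x \<le> q * (1 - 1 / HF)" using W(1) L1 by (simp add: q_def field_simps)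
        moreover have "(w - 1) * 1 \<le> (w - 1) * q" using q w1 by (intro mult_left_mono) auto
        ultimately have om: "w - 1 / h t x \<le> q * (w - 1 / HF)" by (simp add: algebra_simps)
        have z2: "q * m\<^sup>2 \<le> (1 + 2 * b) * (ZZ s t x)\<^sup>2"
        proof -
          have "m\<^sup>2 \<le> (A t x * ZZ s t x)\<^sup>2" using z(1) m by (simp add: abs_le_square_iff[symmetric])
          then have "m\<^sup>2 \<le> \<Lambda> * (ZZ s t x)\<^sup>2" by (simp add: \<Lambda>_def power_mult_distrib)
          then have "(1 + 2 * b) * (m\<^sup>2 / \<Lambda>) \<le> (1 + 2 * b) * (ZZ s t x)\<^sup>2"
            using b L1 by (intro mult_left_mono) (auto simp: field_simps)
          then show ?thesis by (simp add: q_def)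
        qed
        have "?F i t x = A t x * (FZ s t x - b * sqrt (h t x) * (ZZ (- s) t x * ZZ s t x))"
          using Fb[OF t(1) tT(1), of x s] sk \<open>k\<close> by simp
        also have "FZ s t x - b * sqrt (h t x) * (ZZ (- s) t x * ZZ s t x) = sqrt (h t x) *
            (om x - 1 / h t x - (g + 1) / 4 * (ZZ s t x)\<^sup>2 + ((g - 1) / 4 - b) * (ZZ s t x * ZZ (- s) t x))"
          by (simp add: FZ_def algebra_simps)
        also have "A t x * \<dots> \<le> A t x * (sqrt (h t x) * (- e0))"
        proof (intro mult_left_mono)
          have "ZZ s t x * ZZ (- s) t x \<le> (ZZ s t x)\<^sup>2"
            unfolding power2_eq_square using zz zneg by (intro mult_left_mono_neg) auto
          then have "((g - 1) / 4 - b) * (ZZ s t x * ZZ (- s) t x) \<le> ((g - 1) / 4 - b) * (ZZ s t x)\<^sup>2"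
            using b by (intro mult_left_mono) auto
          then have "om x - 1 / h t x - (g + 1) / 4 * (ZZ s t x)\<^sup>2 + ((g - 1) / 4 - b) * (ZZ s t x * ZZ (- s) t x)
             \<le> w - 1 / h t x - (1 + 2 * b) * (ZZ s t x)\<^sup>2 / 2"
            using w[of x] by (simp add: field_simps)
          also have "\<dots> \<le> q * (w - 1 / HF) - q * m\<^sup>2 / 2" using om z2 by linarith
          also have "\<dots> = q * (w - 1 / HF - m\<^sup>2 / 2)" by (simp add: algebra_simps)
          also have "w - 1 / HF - m\<^sup>2 / 2 = - e0" by (simp add: HF(2))
          also have "q * - e0 \<le> 1 * - e0" using q e0 by (intro mult_right_mono_neg) auto
          finally show "om x - 1 / h t x - (g + 1) / 4 * (ZZ s t x)\<^sup>2 + ((g - 1) / 4 - b) * (ZZ s t x * ZZ (- s) t x) \<le> - e0"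
            by simp
        qed (use Ap h_pos[OF t(1) tT(1), of x] in auto)
        also have "\<dots> \<le> - e0"
        proof -
          have "1 \<le> sqrt (h t x)" using hH HF(1) by simp
          then have "1 * 1 \<le> A t x * sqrt (h t x)" using A1 by (intro mult_mono) auto
          then have "1 * e0 \<le> A t x * sqrt (h t x) * e0" using e0 by (intro mult_right_mono) auto
          then show ?thesis by (simp only: mult_minus_right mult.assoc mult_1 neg_le_iff_le)
        qed
        finally show ?thesis using e20 by simp
      qed
    qed
  qed
  then obtain s k x where sk: "s \<in> {1, -1}" "?Y (s, k) T1 x \<le> - 2 * sl" unfolding T1_nonneg(2) by force
  have T: "0 \<le> T1" "T1 < Tm" "T1 \<le> T1" using T1_nonneg T1_less by auto
  have zl: "- sl < ZZ s T1 x" by (rule lower[OF T(1,3) sk(1)])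
  show False
  proof (cases k)
    case False
    then show False using sk zl sl(2) by simp
  next
    case True
    have Az: "A T1 x * ZZ s T1 x \<le> - 2 * sl" using sk True by (simp add: A_alt[OF T(1,2)])
    have A0: "0 < A T1 x" using h_pos[OF T(1,2), of x] HF(1) by (simp add: A_def)
    \<comment> \<open>The final level -2 sqrt(2 w) is out of reach while Z_j > -sqrt(2 w) and the
      weight is below 2.\<close>
    have "A T1 x < 2"
    proof (cases "h T1 x \<le> HF")
      case True
      then have "A T1 x \<le> 1 powr b" unfolding A_def
        using b HF(1) h_pos[OF T(1,2), of x] by (intro powr_mono2) auto
      then show ?thesis by simp
    next
      case False
      then have "(A T1 x)\<^sup>2 \<le> 1 + 2 * b" using weight(2)[OF T(1,3)] by simp
      also have "\<dots> < 2\<^sup>2" using b by simp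
      finally have "(A T1 x)\<^sup>2 < 2\<^sup>2" .
      then show ?thesis by (rule power_less_imp_less_base) simp
    qed
    then have "A T1 x * sl < 2 * sl" using sl(2) by simp
    moreover have "A T1 x * (- sl) \<le> A T1 x * ZZ s T1 x" using zl A0 by (intro mult_left_mono) auto
    ultimately show False using Az by simp
  qed
qed

lemma nn_C1: "C1_with (strip Tm) (nn s) (\<lambda>t x. 0 + (- s / EE) * - (u t x * PR t x)) (\<lambda>t x. 0 + (- s / EE) * en t x)"
  unfolding nn_def[abs_def] by (intro C1_with_add C1_with_const C1_with_cmult NL_C1)

text \<open>The minimum is taken over the four functions \<open>Z\<^sub>j\<close> and \<open>Z\<^sub>j - 2 \<delta> / G (1 - 4/3 n\<^sub>j)\<close>, where \<open>n\<^sub>j\<close> is the fraction of energy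
  ahead. If one of the first kind attains it, then \<open>n\<^sub>j \<ge> 3/4\<close>, and the energy bound on the other side gives \<open>h \<le> H\<close>.\<close>
lemma no_escape_potential:
  assumes T: "5 / 4 \<le> 2 / g" and yF3: "yF \<le> 3"
  shows False
proof -
  define \<delta> where "\<delta> = dl yF"
  have d: "0 < \<delta>" "3 * \<delta> \<le> 1 - 1 / HF"
    using dl_pos[OF yF] dl_le_third[OF T yF] by (auto simp: \<delta>_def HF(2))
  have d1: "\<delta> \<le> 1 / 3"
  proof -
    have "0 < 1 / HF" using HF(1) by simp
    then show ?thesis using d(2) by linarith
  qed
  \<comment> \<open>Division by G has two effects: through \<open>GE\<close> the product of G and
    the energy becomes a multiple of \<open>Fh yF\<close>, and G \<ge> 2 sqrt(2 w) gives sqrt(2 w)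
    \<open>?K\<close> \<le> \<delta>, which bounds products of Z_j with the potential.\<close>
  let ?K = "2 * \<delta> / G"
  define f where "f s t x = ?K * (1 - 4/3 * nn s t x)" for s t x
  have K: "0 < ?K" "sl * ?K \<le> \<delta>"
  proof -
    show "0 < ?K" using d sl by simp
    have "2 * sl * \<delta> \<le> G * \<delta>" using sl(3) d by (intro mult_right_mono) auto
    then show "sl * ?K \<le> \<delta>" using sl(4) by (simp add: field_simps)
  qed
  have fC: "C1_with (strip Tm) (\<lambda>t x. - ?K + ?K * 4/3 * nn s t x)
    (\<lambda>t x. 0 + ?K * 4/3 * (0 + (- s / EE) * - (u t x * PR t x))) (\<lambda>t x. 0 + ?K * 4/3 * (0 + (- s / EE) * en t x))" for s
    by (intro C1_with_add C1_with_const C1_with_cmult nn_C1)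
  have fe: "- ?K + ?K * 4/3 * nn s t x = - f s t x" for s t x by (simp add: f_def algebra_simps)
  have f_le: "f s t x \<le> ?K" if "0 \<le> t" "t \<le> T1" "s \<in> {1, -1}" for s t x
  proof -
    have "?K * (1 - 4/3 * nn s t x) \<le> ?K * 1"
      using nn(1)[of t s x] that T1_less K by (intro mult_left_mono) auto
    then show ?thesis by (simp add: f_def)
  qed
  \<comment> \<open>Keeps the shifted functions above m in the far field, where Z_j = 0, and keeps
    Z_j negative wherever a shifted function is at most m.\<close>
  have Km: "m + ?K < 0"
  proof -
    have "6 * \<delta> < m\<^sup>2"
    proof -
      have "1 - 1 / HF \<le> w - 1 / HF" using w1 by simp
      then show ?thesis using m_squared(1) e0 d(2) by linarith
    qed
    moreover have "?K\<^sup>2 \<le> \<delta>\<^sup>2"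
    proof -
      have "1 * ?K \<le> sl * ?K" using sl(2) K(1) by (intro mult_right_mono) auto
      then show ?thesis using K by (intro power_mono) auto
    qed
    moreover have "\<delta>\<^sup>2 \<le> \<delta>" using d(1) d1 by (simp add: power2_eq_square mult_left_le)
    ultimately have "?K\<^sup>2 < (- m)\<^sup>2" using d(1) by simp
    then have "?K < - m" by (rule power_less_imp_less_base) (use m in simp)
    then show ?thesis by simp
  qed
  let ?Y = "\<lambda>i t x. if snd i then ZZ (fst i) t x + (- ?K + ?K * 4/3 * nn (fst i) t x) else ZZ (fst i) t x"
  let ?D = "\<lambda>s t x. (0 + ?K * 4/3 * (0 + (- s / EE) * - (u t x * PR t x))) + s * cc t x * (0 + ?K * 4/3 * (0 + (- s / EE) * en t x))"
  let ?F = "\<lambda>i t x. if snd i then FZ (fst i) t x + ?D (fst i) t x else FZ (fst i) t x"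
  have D: "?D s t x \<le> - (sqrt (h t x) * (\<delta> * g * St (yy t x) / Fh yF))"
    if t: "0 \<le> t" "t < Tm" and s: "s \<in> {1, -1}" for s t x
  proof -
    have ss: "s * s = 1" using s by auto
    define a where "a = ?K * 4 / 3 / EE"
    have a: "0 < a" unfolding a_def using K(1) EE_pos by (metis divide_pos_pos mult_pos_pos zero_less_numeral)
    have "(0 + k * 4/3 * (0 + (- s / E) * - P)) + s * c * (0 + k * 4/3 * (0 + (- s / E) * e))
      = k * 4 / 3 / E * (s * P - s * s * (c * e))" for k E P c e :: real
      by (simp add: algebra_simps diff_divide_distrib)
    then have "?D s t x = a * (s * (u t x * PR t x) - s * s * (cc t x * en t x))"
      unfolding a_def .
    also have "\<dots> = a * (s * (u t x * PR t x) - cc t x * en t x)" unfolding ss by simp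
    also have "\<dots> \<le> a * - (sqrt (h t x) * (2 / g\<^sup>2 * St (yy t x)))"
    proof (rule mult_left_mono)
      have "s * (u t x * PR t x) \<le> \<bar>u t x * PR t x\<bar>" using s by auto
      then show "s * (u t x * PR t x) - cc t x * en t x \<le> - (sqrt (h t x) * (2 / g\<^sup>2 * St (yy t x)))"
        using flux_bound[OF t, of x] by linarith
    qed (use a in simp)
    also have "\<dots> = - (sqrt (h t x) * (a * (2 / g\<^sup>2) * St (yy t x)))" by simp
    also have "a * (2 / g\<^sup>2) = \<delta> * g / Fh yF"
    proof -
      have "a = 8 / 3 * \<delta> / (G * EE)" by (simp add: a_def)
      also have "\<dots> = \<delta> * g ^ 3 / (2 * Fh yF)" unfolding GE using g1 Fh_pos[OF yF] by (simp add: field_simps)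
      finally show ?thesis using g1 by (simp add: power2_eq_square power3_eq_cube)
    qed
    finally show ?thesis by simp
  qed
  obtain s0 x0 where s0: "s0 \<in> {1, -1}" "ZZ s0 0 x0 \<le> m" using start by blast
  have "\<exists>i\<in>{1, -1} \<times> UNIV. \<exists>x. ?Y i T1 x \<le> m - e0 / 20 * T1"
  proof (rule minimum_principle[where c="\<lambda>i t x. fst i * cc t x" and F="?F" and L=LL and ?i0.0="(s0, False)" and ?x0.0=x0])
    show "finite ({1, -1 :: real} \<times> (UNIV :: bool set))" by simp
    show "0 \<le> T1" "T1 < Tm" "0 \<le> e0 / 20" using T1_nonneg T1_less e0 by auto
    show "(s0, False) \<in> {1, -1} \<times> UNIV" using s0 by simp
    show "?Y (s0, False) 0 x0 \<le> m" using s0 by simp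
    fix i :: "real \<times> bool" assume i: "i \<in> {1, -1} \<times> UNIV"
    then have ss: "fst i * fst i = 1" by auto
    show "tder Tm (\<lambda>t x. fst i * cc t x) (?Y i) (?F i)"
    proof (cases "snd i")
      case True
      then show ?thesis using tder_add_C1[OF Z_transport[OF ss] fC[of "fst i"]] by simp
    next
      case False
      then show ?thesis using Z_transport[OF ss] by simp
    qed
    show "cont2 Tm (\<lambda>t x. fst i * cc t x)" by (rule cc_cont)
    show "cont2 Tm (?Y i)"
    proof (cases "snd i")
      case True
      have "cont2 Tm (\<lambda>t x. ZZ (fst i) t x + (- ?K + ?K * 4/3 * nn (fst i) t x))"
        by (rule continuous_on_add[OF ZZ_cont C1_with_cont(1)[OF fC]])
      then show ?thesis using True by simp
    qed (simp add: ZZ_cont)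
    show "cont2 Tm (?F i)"
    proof (cases "snd i")
      case True
      have "cont2 Tm (\<lambda>t x. FZ (fst i) t x + ?D (fst i) t x)"
        by (intro continuous_on_add[OF FZ_cont] continuous_on_add[OF C1_with_cont(2)[OF fC]]
          continuous_on_mult[OF cc_cont C1_with_cont(3)[OF fC]])
      then show ?thesis using True by simp
    qed (simp add: FZ_cont)
    show "m < ?Y i t x" if "0 \<le> t" "t \<le> T1" "LL < \<bar>x\<bar>" for t x
      using ZZ_out[of t x "fst i"] that T1_less m f_le[of t "fst i" x] i Km unfolding fe by auto
    fix t x assume t: "0 \<le> t" "t < T1"
      and min: "\<And>j y. j \<in> {1, -1} \<times> UNIV \<Longrightarrow> ?Y i t x \<le> ?Y j t y" and le: "?Y i t x \<le> m - e0 / 20 * t"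
    have tT: "t < Tm" "t \<le> T1" using t T1_less by auto
    obtain s k where sk: "i = (s, k)" "s \<in> {1, -1}" using i by (cases i) auto
    have ms: "- s \<in> {1, -1}" using sk by auto
    have "0 \<le> e0 / 20 * t" using e0 t by simp
    then have le': "?Y i t x \<le> m" using le by linarith
    have gen: "- d < - (d / 20)" "- (d / 10) < - (d / 20)" if "0 < d" for d :: real using that by simp_all
    note amp = amplitude_le_nn[OF t(1) tT(2) sk(2), of x]
    show "?F i t x < - (e0 / 20)"
    proof (cases k)
      case False
      have z: "ZZ s t x \<le> m" "ZZ s t x \<le> ZZ (- s) t x" "f s t x \<le> 0"
        using le' min[of "(- s, False)" x] min[of "(s, True)" x] sk ms False unfolding fe by auto
      have "3 / 4 \<le> nn s t x"
      proof (rule ccontr)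
        assume "\<not> 3 / 4 \<le> nn s t x"
        then have "0 < f s t x" unfolding f_def by (intro mult_pos_pos[OF K(1)]) simp
        then show False using z(3) by simp
      qed
      have "yy t x \<le> yF"
      proof (cases "1 \<le> yy t x")
        case True
        \<comment> \<open>At most a quarter of the energy behind the point gives
          \<open>af y \<le> Fh yF / 6\<close>, which matches the factor 1/6 of
          \<open>af_lower\<close>.\<close>
        have "2 / 3 * Fh yF * (1 - nn s t x) \<le> 2 / 3 * Fh yF * (1 / 4)"
          using \<open>3 / 4 \<le> nn s t x\<close> Fh_pos[OF yF] by (intro mult_left_mono) auto
        then have "Fh (yy t x) \<le> Fh yF" using amp(2) af_lower[OF True] by linarith
        then show ?thesis using Fh_mono_iff[of "yy t x" yF] True yF by simp
      next
        case False
        then show ?thesis using yF by simp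
      qed
      then have "h t x \<le> HF" using h_le_HF_iff[OF t(1) tT(1)] by simp
      then have "FZ s t x \<le> - e0" by (rule branch_low[OF t(1) tT(2) z(1,2)])
      then show ?thesis using gen(1)[OF e0] False sk by (simp del: neg_less_iff_less)
    next
      case True
      have z: "ZZ s t x - f s t x \<le> m" "0 \<le> f s t x" "ZZ s t x - f s t x \<le> ZZ (- s) t x"
          "ZZ s t x - f s t x \<le> ZZ (- s) t x - f (- s) t x"
        using le' min[of "(s, False)" x] min[of "(- s, False)" x] min[of "(- s, True)" x] sk ms True unfolding fe by auto
      define n q q' where "n = nn s t x" and "q = 1 - 4/3 * n" and "q' = 1 - 4/3 * (1 - n)"
      have n: "0 \<le> n" "n \<le> 3 / 4"
      proof -
        show "0 \<le> n" using nn(1)[OF t(1) tT(1) sk(2)] by (simp add: n_def)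
        show "n \<le> 3 / 4"
        proof (rule ccontr)
          assume "\<not> n \<le> 3 / 4"
          then have "f s t x < 0" unfolding f_def n_def by (intro mult_pos_neg[OF K(1)]) simp
          then show False using z(2) by simp
        qed
      qed
      have ff: "f s t x = ?K * q" "f (- s) t x = ?K * q'"
        by (simp_all add: f_def q_def q'_def n_def nn(2)[OF t(1) tT(1) sk(2)])
      define B where "B = max 0 (q - max 0 q')"
      have q0: "0 \<le> q" using n by (simp add: q_def)
      have zneg: "ZZ s t x < 0" using z(1) f_le[OF t(1) tT(2) sk(2), of x] Km by linarith
      have zlow: "- sl < ZZ s t x" by (rule lower[OF t(1) tT(2) sk(2)])
      \<comment> \<open>A minimum of a shifted function need not be a minimum of Z_j; comparison
        with both functions of the other family bounds the excess by a difference of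
        potentials.\<close>
      have diff: "ZZ s t x - ZZ (- s) t x \<le> ?K * B"
      proof -
        have "ZZ s t x - ZZ (- s) t x \<le> ?K * q - max 0 (?K * q')" using z(3,4) ff by auto
        also have "max 0 (?K * q') = ?K * max 0 q'" using K(1) by (simp add: max_mult_distrib_left)
        also have "?K * q - ?K * max 0 q' = ?K * (q - max 0 q')" by (rule right_diff_distrib[symmetric])
        also have "\<dots> \<le> ?K * B" using K(1) by (intro mult_left_mono) (auto simp: B_def)
        finally show ?thesis .
      qed
      have b0: "0 \<le> (g - 1) / 4" using g1 by simp
      have coupling: "- ((g - 1) / 4 * ZZ s t x * (ZZ s t x - ZZ (- s) t x)) \<le> (g - 1) / 4 * (\<delta> * B)"
      proof -
        have B0: "0 \<le> B" by (simp add: B_def)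
        have "- ZZ s t x * (ZZ s t x - ZZ (- s) t x) \<le> - ZZ s t x * (?K * B)"
          using diff zneg by (intro mult_left_mono) auto
        also have "\<dots> \<le> sl * (?K * B)" using zlow K(1) B0 by (intro mult_right_mono mult_nonneg_nonneg) auto
        also have "\<dots> \<le> \<delta> * B" using mult_right_mono[OF K(2) B0] by (simp add: mult.assoc)
        finally have "(g - 1) / 4 * (- ZZ s t x * (ZZ s t x - ZZ (- s) t x)) \<le> (g - 1) / 4 * (\<delta> * B)"
          using b0 by (intro mult_left_mono)
        then show ?thesis by (simp only: mult_minus_left mult_minus_right mult.assoc)
      qed
      \<comment> \<open>From Z_j \<le> m + f < 0; the square of f is dropped, and |m|
        \<open>?K\<close> \<le> \<delta>.\<close>
      have zsq: "m\<^sup>2 / 2 - \<delta> * q \<le> (ZZ s t x)\<^sup>2 / 2"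
      proof -
        have "m + f s t x < 0" using f_le[OF t(1) tT(2) sk(2), of x] Km by linarith
        then have "(m + f s t x)\<^sup>2 \<le> (ZZ s t x)\<^sup>2" using z(1) by (simp add: abs_le_square_iff[symmetric])
        moreover have "(m + f s t x)\<^sup>2 = m\<^sup>2 + 2 * (m * f s t x) + (f s t x)\<^sup>2" by (simp add: power2_sum)
        moreover have "- (\<delta> * q) \<le> m * f s t x"
        proof -
          have "- m * (?K * q) \<le> sl * (?K * q)" using m by (intro mult_right_mono[OF _ mult_nonneg_nonneg[OF less_imp_le[OF K(1)] q0]]) simp
          also have "\<dots> \<le> \<delta> * q" using mult_right_mono[OF K(2) q0] by (simp add: mult.assoc)
          finally show ?thesis unfolding ff(1) by linarith
        qed
        ultimately show ?thesis using zero_le_power2[of "f s t x"] by linarith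
      qed
      have ineq: "1 / 10 < yy t x"
        "yF powr (- (2 / g)) - yy t x powr (- (2 / g)) + \<delta> * (q + (g - 1) / 4 * B) \<le> \<delta> * g * St (yy t x) / Fh yF"
      proof -
        have "(2 / (2 / g) - 1) / 4 = (g - 1) / 4" "2 / (2 / g) = g" using g1 by auto
        then show "1 / 10 < yy t x"
          "yF powr (- (2 / g)) - yy t x powr (- (2 / g)) + \<delta> * (q + (g - 1) / 4 * B) \<le> \<delta> * g * St (yy t x) / Fh yF"
          using barrier_ineq[OF T yF yF3 yy_pos[OF t(1) tT(1)] n amp[folded n_def]]
          by (simp_all only: \<delta>_def q_def q'_def B_def)
      qed
      have "?F i t x = FZ s t x + ?D s t x" using sk True by simp
      also have "\<dots> \<le> FZ s t x - sqrt (h t x) * (\<delta> * g * St (yy t x) / Fh yF)"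
        using D[OF t(1) tT(1) sk(2), of x] by linarith
      also have "FZ s t x = sqrt (h t x) * (om x - 1 / h t x - (ZZ s t x)\<^sup>2 / 2 - (g - 1) / 4 * ZZ s t x * (ZZ s t x - ZZ (- s) t x))"
        by (simp add: FZ_def field_simps power2_eq_square)
      also have "\<dots> - sqrt (h t x) * (\<delta> * g * St (yy t x) / Fh yF) = sqrt (h t x) *
         (om x - 1 / h t x - (ZZ s t x)\<^sup>2 / 2 - (g - 1) / 4 * ZZ s t x * (ZZ s t x - ZZ (- s) t x) - \<delta> * g * St (yy t x) / Fh yF)"
        by (simp only: right_diff_distrib)
      also have "\<dots> \<le> sqrt (h t x) * - e0"
      proof (rule mult_left_mono)
        have "\<delta> * (q + (g - 1) / 4 * B) = \<delta> * q + (g - 1) / 4 * (\<delta> * B)" by (simp add: algebra_simps)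
        then show "om x - 1 / h t x - (ZZ s t x)\<^sup>2 / 2 - (g - 1) / 4 * ZZ s t x * (ZZ s t x - ZZ (- s) t x)
          - \<delta> * g * St (yy t x) / Fh yF \<le> - e0"
          using w[of x] zsq coupling ineq(2) inv_h[OF t(1) tT(1), of x] by linarith
      qed (use h_pos[OF t(1) tT(1), of x] in simp)
      also have "\<dots> \<le> - (e0 / 10)"
      proof -
        \<comment> \<open>sqrt h is \<open>yy\<close> to the power 1/\<gamma> \<le> 1, so the lower
          bound 1/10 for \<open>yy\<close> carries over.\<close>
        have "1 / 10 \<le> sqrt (h t x)"
        proof -
          have "sqrt (h t x) = yy t x powr (1 / g)"
            using h_pos[OF t(1) tT(1), of x] g1 by (simp add: yy_def powr_powr powr_half_sqrt)
          moreover have "1 / 10 \<le> yy t x powr (1 / g)"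
          proof (cases "yy t x \<le> 1")
            case True
            have "yy t x powr 1 \<le> yy t x powr (1 / g)"
              using True g1 yy_pos[OF t(1) tT(1), of x] by (intro powr_mono') auto
            then show ?thesis using ineq(1) by simp
          next
            case False
            then have "1 \<le> yy t x powr (1 / g)" using g1 by (intro ge_one_powr_ge_zero) auto
            then show ?thesis by simp
          qed
          ultimately show ?thesis by simp
        qed
        then have "1 / 10 * e0 \<le> sqrt (h t x) * e0" using e0 by (intro mult_right_mono) auto
        then show ?thesis by linarith
      qed
      finally show ?thesis using gen(2)[OF e0] by linarith
    qed
  qed
  then obtain s k x where sk: "s \<in> {1, -1}" "?Y (s, k) T1 x \<le> - 2 * sl" unfolding T1_nonneg(2) by force
  have T: "0 \<le> T1" "T1 \<le> T1" using T1_nonneg by auto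
  have zl: "- sl < ZZ s T1 x" by (rule lower[OF T sk(1)])
  have "?K \<le> sl"
  proof -
    have "1 * ?K \<le> sl * ?K" using sl(2) K(1) by (intro mult_right_mono) auto
    then show ?thesis using K(2) d1 sl(2) by linarith
  qed
  then have "- 2 * sl < ?Y (s, k) T1 x"
    using zl sl(2) f_le[OF T sk(1), of x] unfolding fe by (cases k; simp only: snd_conv fst_conv if_True if_False; linarith)
  then show False using sk(2) by simp
qed

end

context flow begin

theorem reaches_threshold:
  fixes w M m yF :: real
  defines "e \<equiv> m\<^sup>2 / 2 - w + yF powr (- (2 / g))"
  assumes w: "\<And>x. om x \<le> w" and w1: "1 \<le> w"
    and M: "sqrt (2 * w) \<le> M" and M0: "\<And>s x. s \<in> {1, -1} \<Longrightarrow> ZZ s 0 x \<le> M"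
    and EE: "0 < EE" and yF: "1 < yF" and GE: "(M + sqrt (2 * w)) * EE = 16 / (3 * g ^ 3) * Fh yF"
    and start: "\<exists>s\<in>{1, -1}. \<exists>x. ZZ s 0 x \<le> m" and m: "- sqrt (2 * w) < m" "m < 0" and e: "0 < e"
    and T1: "T1 = 20 * (m + 2 * sqrt (2 * w)) / e" "T1 < Tm"
  shows "\<exists>t x. \<exists>s\<in>{1, -1}. 0 \<le> t \<and> t \<le> T1 \<and> ZZ s t x \<le> - sqrt (2 * w)"
proof (rule ccontr)
  assume no: "\<not> ?thesis"
  have lower: "- sqrt (2 * w) < ZZ s t x" if "0 \<le> t" "t \<le> T1" "s \<in> {1, -1}" for t s x
    using no that by (meson not_le)
  interpret small_data_escape g Tm R h u v ht hx ut ux vt vx w M m yF T1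
  proof
    show "0 < m\<^sup>2 / 2 - w + yF powr - (2 / g)" using e by (simp only: e_def)
    show "T1 = 20 * (m + 2 * sqrt (2 * w)) / (m\<^sup>2 / 2 - w + yF powr - (2 / g))"
      using T1(1) by (simp only: e_def)
    show "\<And>t s x. 0 \<le> t \<Longrightarrow> t \<le> T1 \<Longrightarrow> s \<in> {1, -1} \<Longrightarrow> - sqrt (2 * w) < ZZ s t x" by (rule lower)
  qed (fact w w1 M M0 EE yF GE start m T1(2))+
  show False
  proof (cases "2 / g \<le> 5 / 4 \<or> 3 \<le> yF")
    case True
    have "2 / (2 / g) = g" using g1 by simp
    then obtain b where "0 \<le> b" "b \<le> (g - 1) / 4" "b \<le> 1 / 2"
      "\<And>y. yF \<le> y \<Longrightarrow> prim1 (qfun g) y \<le> Fh yF / 3 \<Longrightarrow>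
        (1 - y powr - (2 / g)) * (y / yF) powr (2 * b * (2 / g)) \<le> (1 + 2 * b) * (1 - yF powr - (2 / g))"
      using weight_exists[OF yF True] by auto
    then show False by (rule no_escape_weight)
  next
    case False
    then show False by (intro no_escape_potential) auto
  qed
qed

end

section \<open>Reaching the threshold\<close>

lemma Fgam_eq_Fh:
  assumes "1 \<le> g" "0 \<le> a"
  shows "Fgam g a = 16 / (3 * g ^ 3) * profile.Fh (2 / g) (a + 1)"
proof -
  interpret profile "2 / g" "qfun g" "prim1 (qfun g)" by (rule profile_gamma[OF assms(1)])
  define y where "y = a + 1"
  have y: "0 < y" using assms by (simp add: y_def)
  have "y powr (3 - 2 / g) = y powr (- 1 - 2 / g) * y ^ 4" "y powr (2 - 2 / g) = y powr (- 1 - 2 / g) * y ^ 3"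
    using y powr_add[of y "- 1 - 2 / g" 4] powr_add[of y "- 1 - 2 / g" 3] by simp_all
  moreover have "a ^ 3 / y ^ 3 * (P * y ^ 4 + P * y ^ 3) = a ^ 3 * (y + 1) * P" for P
    using y by (simp add: field_simps eval_nat_numeral)
  ultimately have "a ^ 3 / y ^ 3 * (y powr (3 - 2 / g) + y powr (2 - 2 / g)) = Fh y"
    by (simp add: Fh_def pp_def y_def)
  then show ?thesis by (simp only: Fgam_def y_def[symmetric] mult.assoc)
qed

lemma Fgam_strict_mono:
  assumes "1 \<le> g" "0 \<le> a" "a < b" shows "Fgam g a < Fgam g b"
proof -
  interpret profile "2 / g" "qfun g" "prim1 (qfun g)" by (rule profile_gamma[OF assms(1)])
  show ?thesis using assms Fh_strict_mono[of "a + 1" "b + 1"]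
    by (simp add: Fgam_eq_Fh mult_strict_left_mono divide_strict_right_mono)
qed

lemma Fgam_inj: "1 \<le> g \<Longrightarrow> 0 \<le> a \<Longrightarrow> 0 \<le> b \<Longrightarrow> Fgam g a = Fgam g b \<Longrightarrow> a = b"
  using Fgam_strict_mono[of g a b] Fgam_strict_mono[of g b a] by (cases a b rule: linorder_cases) auto

lemma Fgam_surj:
  assumes g: "1 \<le> g" and y: "0 \<le> y" shows "\<exists>a\<ge>0. Fgam g a = y"
proof -
  interpret profile "2 / g" "qfun g" "prim1 (qfun g)" by (rule profile_gamma[OF g])
  let ?k = "16 / (3 * g ^ 3)"
  have k: "0 < ?k" using g by simp
  \<comment> \<open>T \<le> 2 gives \<open>Fh (N + 1)\<close> \<ge> N^3 (N + 2) / (N + 1)^3 \<ge> (N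
    + 2) / 8, and N is chosen so that this growth passes y.\<close>
  define N where "N = 8 * y / ?k + 1"
  have N: "1 \<le> N" using y k by (simp add: N_def)
  have big: "y \<le> ?k * Fh (N + 1)"
  proof -
    have "(N + 1) powr (- 3) \<le> pp (N + 1)" unfolding pp_def
      using g N by (intro powr_mono) (auto simp: field_simps)
    then have "N ^ 3 * (N + 2) * (N + 1) powr (- 3) \<le> N ^ 3 * (N + 2) * pp (N + 1)"
      using N by (intro mult_left_mono) auto
    also have "\<dots> = Fh (N + 1)" by (simp add: Fh_def)
    finally have "N ^ 3 * (N + 2) / (N + 1) ^ 3 \<le> Fh (N + 1)"
      using N powr_numeral[of "N + 1" "num.Bit1 num.One"] by (simp add: powr_minus_divide)
    moreover have "1 / 8 * (N + 2) \<le> N ^ 3 * (N + 2) / (N + 1) ^ 3"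
    proof -
      have "(1 / 2) ^ 3 \<le> (N / (N + 1)) ^ 3" using N by (intro power_mono) (auto simp: field_simps)
      then have "(1 / 2) ^ 3 * (N + 2) \<le> (N / (N + 1)) ^ 3 * (N + 2)" using N by (intro mult_right_mono) auto
      then show ?thesis by (simp add: power_divide eval_nat_numeral)
    qed
    ultimately have "1 / 8 * (N + 2) \<le> Fh (N + 1)" by linarith
    then have "?k * (1 / 8 * (N + 2)) \<le> ?k * Fh (N + 1)" using k by (intro mult_left_mono) auto
    moreover have "y \<le> k * (1 / 8 * (8 * y / k + 1 + 2))" if "0 < k" for k using that y by (simp add: field_simps)
    ultimately show ?thesis using k unfolding N_def by (meson order_trans)
  qed
  have c: "continuous_on {1..N + 1} (\<lambda>z. ?k * Fh z)"
    by (intro continuous_on_mult continuous_on_const, rule DERIV_continuous_on, rule DERIV_subset[OF Fh_deriv]) auto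
  have "\<exists>z\<ge>1. z \<le> N + 1 \<and> ?k * Fh z = y"
    using IVT'[of "\<lambda>z. ?k * Fh z" 1 y "N + 1", OF _ big _ c] y N by simp
  then obtain z where "1 \<le> z" "?k * Fh z = y" by blast
  then show ?thesis using Fgam_eq_Fh[OF g, of "z - 1"] by (intro exI[of _ "z - 1"]) auto
qed

lemma Fgam_inv:
  assumes g: "1 \<le> g" and y: "0 \<le> y"
  shows "0 \<le> Fgam_inv g y" "Fgam g (Fgam_inv g y) = y"
proof -
  have "\<exists>!a. a \<ge> 0 \<and> Fgam g a = y"
    using Fgam_surj[OF g y] Fgam_inj[OF g] by blast
  from theI'[OF this] show "0 \<le> Fgam_inv g y" "Fgam g (Fgam_inv g y) = y" by (auto simp: Fgam_inv_def)
qed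

lemma Fgam_inv_Fgam: "1 \<le> g \<Longrightarrow> 0 \<le> a \<Longrightarrow> Fgam_inv g (Fgam g a) = a"
  unfolding Fgam_inv_def by (rule the_equality) (auto intro: Fgam_inj)

lemma Fgam_0 [simp]: "Fgam g 0 = 0" by (simp add: Fgam_def)

lemma Fgam_inv_mono: "1 \<le> g \<Longrightarrow> 0 \<le> x \<Longrightarrow> x \<le> y \<Longrightarrow> Fgam_inv g x \<le> Fgam_inv g y"
  using Fgam_inv[of g x] Fgam_inv[of g y] Fgam_strict_mono[of g "Fgam_inv g y" "Fgam_inv g x"] by force

lemma Fgam_inv_continuous:
  assumes g: "1 \<le> g" shows "continuous_on {0..} (Fgam_inv g)"
proof -
  \<comment> \<open>Extended by the identity below 0, the inverse is monotone and onto the whole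
    line, hence continuous.\<close>
  let ?I = "\<lambda>y. if y < 0 then y else Fgam_inv g y"
  have "range ?I = UNIV"
  proof -
    have "\<exists>y. a = ?I y" for a
    proof (cases "a < 0")
      case False
      then have "0 \<le> Fgam g a" using Fgam_strict_mono[OF g, of 0 a] by (cases "a = 0") auto
      then show ?thesis using Fgam_inv_Fgam[OF g, of a] False by (intro exI[of _ "Fgam g a"]) auto
    qed (auto intro: exI[of _ a])
    then show ?thesis by blast
  qed
  moreover have "?I x \<le> ?I y" if "x \<le> y" for x y
    using that Fgam_inv_mono[OF g, of x y] Fgam_inv(1)[OF g, of y] by auto
  ultimately have "continuous_on UNIV ?I" by (intro continuous_onI_mono) simp_all
  then have "continuous_on {0..} ?I" by (rule continuous_on_subset) simp
  then show ?thesis by (simp cong: continuous_on_cong_simp)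
qed

definition escape_time :: "real \<Rightarrow> real \<times> real \<times> real \<times> real \<Rightarrow> real" where
  "escape_time g = (\<lambda>(G, E, w, m). 20 * (m + 2 * sqrt (2 * w)) /
     (m\<^sup>2 / 2 - w + (Fgam_inv g (G * E) + 1) powr (- (2 / g))))"

text \<open>If k > w, the root of the negative radicand is negative and the bound on m is positive,
  but then the gap is positive in any case.\<close>

lemma escape_gap_pos:
  fixes m w k :: real
  assumes "m < - sqrt 2 * sqrt (w - k)" shows "0 < m\<^sup>2 / 2 - w + k"
proof (cases "k \<le> w")
  case True
  have "(sqrt 2 * sqrt (w - k))\<^sup>2 < (- m)\<^sup>2" using assms True by (intro power_strict_mono) auto
  then show ?thesis using True by (simp add: power_mult_distrib)
next
  case False
  then show ?thesis using zero_le_power2[of m] by linarith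
qed

lemma escape_time_continuous:
  assumes g: "1 \<le> g" shows "continuous_on (adm_region g) (escape_time g)"
proof -
  have "continuous_on (adm_region g) (\<lambda>p. Fgam_inv g (fst p * fst (snd p)))"
    by (rule continuous_on_compose2[OF Fgam_inv_continuous[OF g]])
      (auto simp: adm_region_def intro!: continuous_intros)
  moreover have "0 < (snd (snd (snd p)))\<^sup>2 / 2 - fst (snd (snd p)) + (Fgam_inv g (fst p * fst (snd p)) + 1) powr (- (2 / g))"
    if "p \<in> adm_region g" for p
    using that by (intro escape_gap_pos) (auto simp: adm_region_def)
  moreover have "0 < Fgam_inv g (fst p * fst (snd p)) + 1" if "p \<in> adm_region g" for p
    using that Fgam_inv(1)[OF g, of "fst p * fst (snd p)"] by (auto simp: adm_region_def)
  ultimately show ?thesis unfolding escape_time_def case_prod_beta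
    by (intro continuous_intros) (auto simp: less_imp_neq[symmetric])
qed

lemma attains_inf_const_outside:
  fixes f :: "real \<Rightarrow> real"
  assumes c: "continuous_on UNIV f" and L: "0 \<le> L" and k: "\<And>x. L \<le> \<bar>x\<bar> \<Longrightarrow> f x = k"
  obtains x0 where "\<And>x. f x0 \<le> f x"
proof -
  have "continuous_on {-L..L} f" using c by (rule continuous_on_subset) simp
  then obtain x0 where x0: "x0 \<in> {-L..L}" "\<And>x. x \<in> {-L..L} \<Longrightarrow> f x0 \<le> f x"
    using continuous_attains_inf[of "{-L..L}" f] L by auto
  have "f x0 \<le> f x" for x
  proof (cases "\<bar>x\<bar> \<le> L")
    case False
    then have "f x = f L" using k[of x] k[of L] L by simp
    then show ?thesis using x0(2)[of L] L by simp
  qed (use x0(2)[of x] in \<open>auto simp: abs_le_iff\<close>)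
  then show ?thesis by (rule that)
qed

section \<open>Attained extrema and the first hitting time\<close>

context flow begin

definition mz :: "real \<Rightarrow> real \<Rightarrow> real" where "mz t x = min (ZZ (- 1) t x) (ZZ 1 t x)"

lemma Zj_eq:
  assumes "0 \<le> t" "t < Tm"
  shows "Zj g 1 h u t x = ZZ (- 1) t x" "Zj g 2 h u t x = ZZ 1 t x"
  using DERIV_imp_deriv[OF C1_with_dx[OF hC assms, of x]] DERIV_imp_deriv[OF C1_with_dx[OF uC assms, of x]]
  by (simp_all add: Zj_def ZZ_def dxi_def)

lemma mz_cont: "cont2 Tm mz"
  unfolding mz_def by (intro continuous_on_min ZZ_cont)

lemma mz_out: "0 \<le> t \<Longrightarrow> t < Tm \<Longrightarrow> LL \<le> \<bar>x\<bar> \<Longrightarrow> mz t x = 0"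
  by (simp add: mz_def ZZ_out)

lemma minZ_attained:
  assumes t: "0 \<le> t" "t < Tm"
  obtains x0 where "minZ g h u t = mz t x0" "\<And>x. mz t x0 \<le> mz t x"
proof -
  obtain x0 where x0: "\<And>x. mz t x0 \<le> mz t x"
    by (rule attains_inf_const_outside[OF cont2_x[OF mz_cont t], of LL 0])
      (use mz_out[OF t] LL_pos in auto)
  moreover have "minZ g h u t = (INF x. mz t x)" by (simp only: minZ_def mz_def Zj_eq[OF t])
  moreover have "(INF x. mz t x) = mz t x0" by (rule cInf_eq_minimum) (use x0 in auto)
  ultimately show ?thesis using that by simp
qed

text \<open>The argument runs at fixed x instead of through continuity of the infimum: at the first
  time at which some value is at or below -c, the intermediate value theorem excludes values below
  -c, so the minimum is exactly -c.\<close>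

lemma minZ_hits:
  assumes c: "0 < c" "- c < minZ g h u 0"
    and reached: "0 \<le> t1" "t1 \<le> T1" "mz t1 x1 \<le> - c" and T1: "T1 < Tm"
  shows "\<exists>t. 0 \<le> t \<and> t \<le> T1 \<and> minZ g h u t = - c"
proof -
  let ?S = "({0..T1} \<times> {-LL..LL}) \<inter> (\<lambda>p. mz (fst p) (snd p)) -` {..- c}"
  have K: "continuous_on ({0..T1} \<times> {-LL..LL}) (\<lambda>p. mz (fst p) (snd p))"
    by (rule continuous_on_subset[OF mz_cont]) (use T1 in auto)
  have in_S: "(t, x) \<in> ?S" if "0 \<le> t" "t \<le> T1" "mz t x \<le> - c" for t x
    using mz_out[of t x] that T1 c by (cases "LL \<le> \<bar>x\<bar>") (auto simp: abs_less_iff)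
  have "closed ?S" by (intro continuous_closed_preimage[OF K] closed_Times) auto
  then have "compact (({0..T1} \<times> {-LL..LL}) \<inter> ?S)" by (intro compact_Int_closed compact_Times) auto
  then have "compact ?S" by (simp only: Int_left_absorb)
  moreover have "?S \<noteq> {}" using in_S[OF reached] by blast
  ultimately have "\<exists>p\<in>?S. \<forall>q\<in>?S. fst p \<le> fst q"
    by (rule continuous_attains_inf[OF _ _ continuous_on_fst[OF continuous_on_id]])
  then obtain p where p: "p \<in> ?S" "\<And>q. q \<in> ?S \<Longrightarrow> fst p \<le> fst q" by (elim bexE) (simp only: Ball_def)
  obtain tb xb where tb: "p = (tb, xb)" by (cases p)
  have t: "0 \<le> tb" "tb \<le> T1" "tb < Tm" "mz tb xb \<le> - c" using p(1) T1 by (auto simp: tb)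
  have first: "tb \<le> t" if "0 \<le> t" "t \<le> T1" "mz t x \<le> - c" for t x
    using p(2)[OF in_S[OF that]] by (simp add: tb)
  have low: "- c \<le> mz tb x" for x
  proof (rule ccontr)
    assume lt: "\<not> - c \<le> mz tb x"
    obtain x0 where "minZ g h u 0 = mz 0 x0" "mz 0 x0 \<le> mz 0 x"
      using minZ_attained[of 0] Tm_pos by auto
    then have "- c \<le> mz 0 x" using c by simp
    moreover have "continuous_on {0..tb} (\<lambda>t. mz t x)"
      by (rule continuous_on_compose2[OF mz_cont, of _ "\<lambda>t. (t, x)", simplified])
        (use t in \<open>auto intro!: continuous_intros\<close>)
    ultimately obtain t' where "0 \<le> t'" "t' \<le> tb" "mz t' x = - c"
      using IVT2'[of "\<lambda>t. mz t x" tb "- c" 0] lt t by auto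
    moreover from this have "tb \<le> t'" using first[of t' x] t by simp
    ultimately show False using lt by simp
  qed
  obtain x0 where "minZ g h u tb = mz tb x0" "mz tb x0 \<le> mz tb xb"
    using minZ_attained[OF t(1,3)] by metis
  then have "minZ g h u tb = - c" using low[of x0] t(4) by simp
  then show ?thesis using t by blast
qed

lemma om_le_omega_sharp0: "om x \<le> omega_sharp0 h v" "1 \<le> omega_sharp0 h v"
proof -
  have vx: "deriv (v 0) x = vx 0 x" for x using DERIV_imp_deriv[OF C1_with_dx[OF vC, of 0 x]] Tm_pos by simp
  have "continuous_on UNIV (h 0)" "continuous_on UNIV (vx 0)"
    by (rule cont2_x[OF C1_with_cont(1)[OF hC]] cont2_x[OF C1_with_cont(3)[OF vC]]; simp add: Tm_pos)+
  then have "continuous_on UNIV (\<lambda>x. - om x)" unfolding om_def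
    using h_pos[of 0] Tm_pos by (intro continuous_intros) (auto simp: less_imp_neq[symmetric])
  then obtain x0 where x0: "\<And>x. - om x0 \<le> - om x"
    by (rule attains_inf_const_outside[of _ LL "- 1"])
      (use LL_pos trivial_out[of 0] dx_out[of 0] Tm_pos in \<open>auto simp: om_def\<close>)
  have "omega_sharp0 h v = (SUP x. om x)" by (simp add: omega_sharp0_def om_def vx)
  moreover have "(SUP x. om x) = om x0" by (rule cSup_eq_maximum) (use x0 in auto)
  ultimately show "om x \<le> omega_sharp0 h v" "1 \<le> omega_sharp0 h v"
    using x0[of x] x0[of LL] LL_pos trivial_out[of 0 LL] dx_out[of 0 LL] Tm_pos by (auto simp: om_def)
qed

lemma ZZ_le_Zsharp0: "s \<in> {1, -1} \<Longrightarrow> ZZ s 0 x \<le> Zsharp0 g h u"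
proof -
  assume s: "s \<in> {1, -1}"
  let ?M = "\<lambda>x. max (ZZ (- 1) 0 x) (ZZ 1 0 x)"
  have "continuous_on UNIV (\<lambda>x. - ?M x)"
    by (intro continuous_on_minus continuous_on_max cont2_x[OF ZZ_cont]) (simp_all add: Tm_pos)
  then obtain x0 where x0: "\<And>x. - ?M x0 \<le> - ?M x"
    by (rule attains_inf_const_outside[of _ LL 0]) (use LL_pos ZZ_out[of 0] Tm_pos in auto)
  have "Zsharp0 g h u = (SUP x. ?M x)" by (simp only: Zsharp0_def Zj_eq[OF order_refl Tm_pos])
  moreover have "(SUP x. ?M x) = ?M x0" by (rule cSup_eq_maximum) (use x0 in force)+
  ultimately show ?thesis using s x0[of x] by auto
qed

text \<open>Positive energy makes the energy fraction \<open>nn\<close> meaningful and gives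
  \<open>yF > 1\<close>. If the total vanishes, \<open>NL 0\<close> is identically 0, hence so is
  its derivative, the density, and the data are trivial.\<close>

lemma EE_pos_of_nontrivial:
  assumes "ZZ s 0 x0 \<noteq> 0" shows "0 < EE"
proof (rule ccontr)
  assume "\<not> 0 < EE"
  then have N: "NL 0 = (\<lambda>x. 0)" using NL_range[OF order_refl Tm_pos] by (intro ext) (meson le_less_trans not_le order_antisym)
  have "en 0 x = 0" for x
    using DERIV_unique[of "NL 0" "en 0 x" x 0] NL_dx[OF order_refl Tm_pos, of x] unfolding N by simp
  then have "h 0 = (\<lambda>x. 1)" "u 0 = (\<lambda>x. 0)" using en_zero_iff[of 0] Tm_pos by (auto simp: fun_eq_iff)
  then have "hx 0 x0 = 0" "ux 0 x0 = 0"
    using C1_with_dx[OF hC, of 0 x0] C1_with_dx[OF uC, of 0 x0] Tm_pos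
    by (auto dest: DERIV_unique[OF _ DERIV_const])
  then show False using assms by (simp add: ZZ_def)
qed

theorem minZ_reaches_threshold:
  fixes w m G E :: real
  defines "w \<equiv> omega_sharp0 h v" and "m \<equiv> minZ g h u 0" and "G \<equiv> G0 g h u v" and "E \<equiv> energy g h u v 0"
  assumes m: "- sqrt (2 * w) < m" "m < - sqrt 2 * sqrt (w - (Fgam_inv g (G * E) + 1) powr (- 2 / g))"
    and T1: "max 0 (escape_time g (G, E, w, m)) < Tm"
  shows "\<exists>t. 0 \<le> t \<and> t \<le> max 0 (escape_time g (G, E, w, m)) \<and> minZ g h u t = - sqrt (2 * w)"
proof -
  define M where "M = max (Zsharp0 g h u) (sqrt (2 * w))"
  define yF where "yF = Fgam_inv g (G * E) + 1"
  have w: "om x \<le> w" "1 \<le> w" for x using om_le_omega_sharp0 by (auto simp: w_def)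
  have M: "sqrt (2 * w) \<le> M" "\<And>s x. s \<in> {1, -1} \<Longrightarrow> ZZ s 0 x \<le> M"
    using ZZ_le_Zsharp0 by (auto simp: M_def le_max_iff_disj)
  have G: "G = M + sqrt (2 * w)" by (simp add: G_def G0_def M_def w_def)
  have E: "E = EE" by (simp add: E_def energy_eq)
  have EE: "0 \<le> EE" using NL_range[of 0] Tm_pos by force
  have GE: "0 \<le> G * E" using EE M(1) w(2) by (auto simp: G E intro!: mult_nonneg_nonneg add_nonneg_nonneg intro: order_trans[of 0 "sqrt (2 * w)"])
  have yF1: "1 \<le> yF" using Fgam_inv(1)[OF g1 GE] by (simp add: yF_def)
  \<comment> \<open>Since \<open>yF \<ge> 1\<close> and w \<ge> 1, the radicand is nonnegative, so
    the upper bound on m is at most 0.\<close>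
  have m0: "m < 0"
  proof -
    have "yF powr (- (2 / g)) \<le> 1" using yF1 g1 powr_mono[of "- (2 / g)" 0 yF] by simp
    then have "0 \<le> sqrt 2 * sqrt (w - yF powr (- 2 / g))" using w(2) by simp
    then show ?thesis using m(2) unfolding yF_def by linarith
  qed
  obtain x0 where x0: "m = mz 0 x0" using minZ_attained[OF order_refl Tm_pos] unfolding m_def by metis
  then obtain s where s: "s \<in> {1, -1}" "ZZ s 0 x0 = m" by (auto simp: mz_def min_def split: if_splits)
  have EE: "0 < EE" by (rule EE_pos_of_nontrivial[of s x0]) (use s m0 in simp)
  have GE: "0 < G * E" using EE M(1) w(2) by (auto simp: G E intro!: mult_pos_pos add_nonneg_pos intro: order_trans[of 0 "sqrt (2 * w)"])
  have yF: "1 < yF" "16 / (3 * g ^ 3) * Fh yF = G * E"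
    using Fgam_inv[OF g1, of "G * E"] GE Fgam_eq_Fh[OF g1, of "Fgam_inv g (G * E)"]
    by (auto simp: yF_def order.strict_iff_order)
  have e: "0 < m\<^sup>2 / 2 - w + yF powr (- (2 / g))"
    using escape_gap_pos[OF m(2)] by (simp add: yF_def)
  define T0 where "T0 = 20 * (m + 2 * sqrt (2 * w)) / (m\<^sup>2 / 2 - w + yF powr (- (2 / g)))"
  have T0: "escape_time g (G, E, w, m) = T0" by (simp add: escape_time_def T0_def yF_def)
  have "\<exists>t x. \<exists>s\<in>{1, -1}. 0 \<le> t \<and> t \<le> T0 \<and> ZZ s t x \<le> - sqrt (2 * w)"
  proof (rule reaches_threshold[OF w M EE yF(1) _ _ m(1) m0 e T0_def])
    show "(M + sqrt (2 * w)) * EE = 16 / (3 * g ^ 3) * Fh yF" using yF(2) by (simp add: G E)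
    show "\<exists>s\<in>{1, -1}. \<exists>x. ZZ s 0 x \<le> m" using s by blast
    show "T0 < Tm" using T1 by (simp add: T0)
  qed
  then obtain t x s where tx: "s \<in> {1, -1}" "0 \<le> t" "t \<le> T0" "ZZ s t x \<le> - sqrt (2 * w)" by blast
  then have "mz t x \<le> - sqrt (2 * w)" by (auto simp: mz_def min_le_iff_disj)
  then show ?thesis
    unfolding T0 using tx w(2) m(1) T1[unfolded T0] by (intro minZ_hits[of _ t _ x]) (auto simp: m_def)
qed

end

lemma classical_solution_flow:
  assumes g: "1 \<le> g" and T: "0 < T" and sol: "classical_solution g T h u v"
    and K: "compact K" "\<And>x. x \<notin> K \<Longrightarrow> h 0 x = 1 \<and> u 0 x = 0 \<and> v 0 x = 0"
  obtains R ht hx ut ux vt vx where "flow g T R h u v ht hx ut ux vt vx"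
proof -
  obtain ht hx ut ux vt vx where C: "C1_with (strip T) h ht hx" "C1_with (strip T) u ut ux" "C1_with (strip T) v vt vx"
    and eq: "\<And>t x. 0 \<le> t \<Longrightarrow> t < T \<Longrightarrow> h t x > 0 \<and> ht t x + (h t x)\<^sup>2 * ux t x = 0 \<and>
           ut t x + deriv (\<lambda>y. h t y powr g / g) x - v t x = 0 \<and> vt t x + u t x = 0"
    using sol unfolding classical_solution_def by auto
  obtain R where R: "0 < R" "\<And>x. x \<in> K \<Longrightarrow> \<bar>x\<bar> < R"
  proof -
    obtain B where "\<And>x. x \<in> K \<Longrightarrow> norm x \<le> B" using compact_imp_bounded[OF K(1)] by (auto simp: bounded_iff)
    then show ?thesis using that[of "\<bar>B\<bar> + 1"] by force
  qed
  have "flow g T R h u v ht hx ut ux vt vx"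
  proof
    show "ut t x = v t x - h t x powr (g - 1) * hx t x" if t: "0 \<le> t" "t < T" for t x
    proof -
      have "((\<lambda>y. h t y powr g / g) has_real_derivative h t x powr (g - 1) * hx t x) (at x)"
        using C1_with_dx[OF C(1) t, of x] eq[OF t] g
        by (auto intro!: derivative_eq_intros simp: powr_diff)
      then show ?thesis using eq[OF t, of x] by (simp add: DERIV_imp_deriv)
    qed
    show "ht t x = - (h t x)\<^sup>2 * ux t x" "vt t x = - u t x" "0 < h t x" if "0 \<le> t" "t < T" for t x
      using eq[OF that, of x] by auto
    show "h 0 x = 1 \<and> u 0 x = 0 \<and> v 0 x = 0" if "R \<le> \<bar>x\<bar>" for x using K(2)[of x] R(2)[of x] that by auto
  qed (use g T C R in auto)
  then show ?thesis by (rule that)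
qed

theorem theorem3p3:
  fixes \<gamma> :: real
  assumes "\<gamma> \<ge> 1"
  shows "\<exists>\<Phi> :: real \<times> real \<times> real \<times> real \<Rightarrow> real.
    continuous_on (adm_region \<gamma>) \<Phi> \<and>
    (\<forall>h u v :: real \<Rightarrow> real \<Rightarrow> real.
       ((\<lambda>x. h 0 x) C1_differentiable_on UNIV) \<and>
       ((\<lambda>x. u 0 x) C1_differentiable_on UNIV) \<and>
       ((\<lambda>x. v 0 x) C1_differentiable_on UNIV) \<and>
       (\<exists>K. compact K \<and> (\<forall>x. x \<notin> K \<longrightarrow> h 0 x = 1 \<and> u 0 x = 0 \<and> v 0 x = 0)) \<and>
       (INF x. h 0 x) > 0 \<and>
       - sqrt (2 * omega_sharp0 h v) < minZ \<gamma> h u 0 \<and>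
       minZ \<gamma> h u 0 < - sqrt 2 * sqrt (omega_sharp0 h v
            - (Fgam_inv \<gamma> (G0 \<gamma> h u v * energy \<gamma> h u v 0) + 1) powr (- 2 / \<gamma>))
       \<longrightarrow>
       (\<exists>Tstar. Tstar \<le> \<Phi> (G0 \<gamma> h u v, energy \<gamma> h u v 0, omega_sharp0 h v, minZ \<gamma> h u 0) \<and>
          (\<forall>T. T > Tstar \<and> classical_solution \<gamma> T h u v \<longrightarrow>
             (\<exists>t. 0 \<le> t \<and> t \<le> Tstar \<and> minZ \<gamma> h u t = - sqrt (2 * omega_sharp0 h v)))))"
proof (intro exI[of _ "\<lambda>p. max 0 (escape_time \<gamma> p)"] conjI allI impI)
  show "continuous_on (adm_region \<gamma>) (\<lambda>p. max 0 (escape_time \<gamma> p))"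
    by (intro continuous_on_max continuous_on_const escape_time_continuous assms)
  fix h u v :: "real \<Rightarrow> real \<Rightarrow> real"
  \<comment> \<open>The maximum with 0 makes every T > \<open>?T\<close> positive, so that t = 0
    belongs to the strip before anything is known about the sign of the escape time.\<close>
  let ?T = "max 0 (escape_time \<gamma> (G0 \<gamma> h u v, energy \<gamma> h u v 0, omega_sharp0 h v, minZ \<gamma> h u 0))"
  assume data: "((\<lambda>x. h 0 x) C1_differentiable_on UNIV) \<and>
       ((\<lambda>x. u 0 x) C1_differentiable_on UNIV) \<and>
       ((\<lambda>x. v 0 x) C1_differentiable_on UNIV) \<and>
       (\<exists>K. compact K \<and> (\<forall>x. x \<notin> K \<longrightarrow> h 0 x = 1 \<and> u 0 x = 0 \<and> v 0 x = 0)) \<and>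
       (INF x. h 0 x) > 0 \<and>
       - sqrt (2 * omega_sharp0 h v) < minZ \<gamma> h u 0 \<and>
       minZ \<gamma> h u 0 < - sqrt 2 * sqrt (omega_sharp0 h v
            - (Fgam_inv \<gamma> (G0 \<gamma> h u v * energy \<gamma> h u v 0) + 1) powr (- 2 / \<gamma>))"
  then obtain K where K: "compact K" "\<And>x. x \<notin> K \<Longrightarrow> h 0 x = 1 \<and> u 0 x = 0 \<and> v 0 x = 0" by blast
  have "\<exists>t. 0 \<le> t \<and> t \<le> ?T \<and> minZ \<gamma> h u t = - sqrt (2 * omega_sharp0 h v)"
    if T: "?T < T" "classical_solution \<gamma> T h u v" for T
  proof -
    have "0 < T" using T(1) by simp
    then obtain R ht hx ut ux vt vx where "flow \<gamma> T R h u v ht hx ut ux vt vx"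
      by (rule classical_solution_flow[OF assms _ T(2) K])
    then interpret flow \<gamma> T R h u v ht hx ut ux vt vx .
    show ?thesis by (rule minZ_reaches_threshold) (use data T(1) in auto)
  qed
  then show "\<exists>Tstar\<le>?T. \<forall>T. T > Tstar \<and> classical_solution \<gamma> T h u v \<longrightarrow>
             (\<exists>t. 0 \<le> t \<and> t \<le> Tstar \<and> minZ \<gamma> h u t = - sqrt (2 * omega_sharp0 h v))"
    by (intro exI[of _ ?T]) auto
qed

end
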